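(* Let $d\ge2$, fix an integer $H\ge 2-2d$, let $n\ge1$ and write $n=\omega_d r^d$. Let $S_{n,H}$ be the set of sites visited by the abelian sandpile in $\mathbb{Z}^d$ with holes of depth $H$, started from $n$ grains at the origin. Then \[ B_{c_1 r-c_2}\subset S_{n,H},\qquad c_1=(2d-1+H)^{-1/d}, \] where $c_2$ is a constant depending only on $d$. Moreover, if $H\ge1-d$, then for every $\epsilon$ with $0<\epsilon<d+H$, \[ S_{n,H}\subset B_{c_1' r+c_2'},\qquad c_1'=(d-\epsilon+H)^{-1/d}, \] where $c_2'$ is independent of $n$ but may depend on $d$, $H$ and $\epsilon$.
   Context: Abelian sandpile with holes of depth $H$: every site of $\mathbb{Z}^d$ has a "hole" of depth $H$, meaning it absorbs (permanently keeps) the first $H$ grains it receives and thereafter behaves normally; if $H<0$ this means every site starts with $-H$ grains already present. A site holding at least $2d$ grains beyond its absorbed ones topples, sending one grain to each of its $2d$ lattice neighbors. Starting with $n$ grains placed at the origin (and this initial configuration elsewhere), topple until stable (the result does not depend on the toppling order). $S_{n,H}$ consists of the origin together with every site that receives at least one grain during this process. $\omega_d$ is the volume of the unit ball in $\mathbb{R}^d$ and $B_\rho=\{x\in\mathbb{Z}^d:|x|<\rho\}$ (Euclidean norm). The case $H=0$ is the classical abelian sandpile. *)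

theory Defs
  imports "HOL-Analysis.Analysis"
begin

definition site :: "nat \<Rightarrow> int list \<Rightarrow> bool" where
  "site d x \<longleftrightarrow> length x = d"

definition origin :: "nat \<Rightarrow> int list" where
  "origin d = replicate d 0"

definition adjacent :: "nat \<Rightarrow> int list \<Rightarrow> int list \<Rightarrow> bool" where
  "adjacent d x y \<longleftrightarrow> site d x \<and>
     (\<exists>i<d. y = x[i := x ! i + 1] \<or> y = x[i := x ! i - 1])"

definition lnorm :: "int list \<Rightarrow> real" where
  "lnorm x = sqrt (\<Sum>z\<leftarrow>x. (real_of_int z)\<^sup>2)"

definition lball :: "nat \<Rightarrow> real \<Rightarrow> int list set" where
  "lball d \<rho> = {x. site d x \<and> lnorm x < \<rho>}"

text \<open>Configurations record the number of grains beyond the absorbed ones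
  (negative while a hole is not yet filled).  Initially n grains at the origin,
  every site with a hole of depth H (if H<0: -H grains already present).\<close>
definition init_config :: "nat \<Rightarrow> nat \<Rightarrow> int \<Rightarrow> int list \<Rightarrow> int" where
  "init_config d n H x = (if x = origin d then int n else 0) - H"

definition topple :: "nat \<Rightarrow> (int list \<Rightarrow> int) \<Rightarrow> int list \<Rightarrow> int list \<Rightarrow> int" where
  "topple d \<eta> x = (\<lambda>y. \<eta> y - (if y = x then 2 * int d else 0)
                          + (if adjacent d x y then 1 else 0))"

fun legal :: "nat \<Rightarrow> (int list \<Rightarrow> int) \<Rightarrow> int list list \<Rightarrow> bool" where
  "legal d \<eta> [] = True"
| "legal d \<eta> (x # xs) =
     (site d x \<and> \<eta> x \<ge> 2 * int d \<and> legal d (topple d \<eta> x) xs)"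

text \<open>S_{n,H}: the origin together with every site receiving at least one grain
  during the toppling process, i.e. every neighbour of a site toppled in some legal
  toppling sequence (by the abelian property this is the same as for the
  toppling sequence run until stabilization).\<close>
definition visited :: "nat \<Rightarrow> nat \<Rightarrow> int \<Rightarrow> int list set" where
  "visited d n H = {origin d} \<union>
     {y. \<exists>xs x. legal d (init_config d n H) xs \<and> x \<in> set xs \<and> adjacent d x y}"

end

theory Submission
  imports Defs
begin

text \<open>
  Both bounds test the odometer \<open>u\<close> of a legal toppling sequence against functions with
  controlled discrete Laplacian. Writing \<open>\<Delta>\<close> for the unnormalised Laplacian,
  \<open>\<Delta>u = \<eta> + H - n\<delta>\<close>, where \<open>\<eta>\<close> is the current configuration.

  Inner bound. Toppling as long as possible inside a large ball gives \<open>\<Delta>u \<le> 2d - 1 + H - n\<delta>\<close>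
  there. If \<open>x\<close> is never visited, then \<open>u(x) = 0\<close>, and this inequality keeps \<open>u\<close> bounded near
  \<open>x\<close>. Pair \<open>u\<close> with the positive part of the Poisson kernel of the ball of radius \<open>|x|\<close> with
  pole at \<open>x\<close>, made discretely subharmonic by a lower-order term and cut off near the pole. Since
  \<open>u\<close> is bounded near \<open>x\<close>, the cut-off costs little, so \<open>n\<close> times the value of the kernel at the
  origin is at most \<open>2d - 1 + H\<close> times its sum. After a shift of the lattice by a vector of bounded
  length the sum is at most the integral, which the mean value property evaluates in terms of the
  volume of the ball, up to an error of one order less.

  Outer bound. Every edge between toppled sites leaves a grain behind, so on a ball inside the
  toppled set the average density is at least \<open>d\<close> up to a boundary term. Hence the average of
  \<open>u\<close> over a ball of large fixed radius is subharmonic with a definite rate away from the origin,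
  and the maximum principle compares it with a quadratic plus an explicit superharmonic potential;
  this bounds \<open>u\<close> outside a ball slightly smaller than the claimed one. Beyond it, an
  exponential test function shows that the number of topplings decays exponentially, hence is
  zero at the claimed radius once \<open>n\<close> is large.
\<close>

section \<open>Lattice neighbours and the discrete Laplacian\<close>

text \<open>For a ball of radius \<rho> the Poisson kernel with pole on the sphere has the value
  \<rho>^(2-d) at the centre and the integral \<omega> \<rho>^2. The pairing therefore reads n \<le>
  (2d - 1 + H) \<omega> \<rho>^d (1 + O(1/\<rho>)), and a relative error 1/\<rho> is only an
  additive constant in the radius. All bounds are linear in 2d - 1 + H, including the one for
  \<open>u\<close> near \<open>x\<close>; this keeps the inner constant free of \<open>H\<close>.
  Explicit functions with fourth-order Taylor bounds take the place of lattice Green functions. The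
  lattice is shifted because averaging over shifts compares sum and integral with no regularity
  required of the kernel at its pole. In the outer bound \<epsilon> is spent in two halves. One pays
  for the boundary term of the averaging ball, which fixes the radius of that ball independently of
  n. The other makes the radius beyond which \<open>u\<close> is bounded smaller than the claimed
  one by a fixed factor. The gap then grows like n^(1/d), and exponential decay across it beats a
  cubic bound on the number of topplings.\<close>

definition nbrs :: "nat \<Rightarrow> int list \<Rightarrow> int list set" where
  "nbrs d y = {z. adjacent d y z}"

definition lap :: "nat \<Rightarrow> (int list \<Rightarrow> real) \<Rightarrow> int list \<Rightarrow> real" where
  "lap d f y = (\<Sum>z\<in>nbrs d y. f z - f y)"

lemma nbrs_eq:
  assumes "site d y"
  shows "nbrs d y = (\<lambda>i. y[i := y ! i + 1]) ` {..<d} \<union> (\<lambda>i. y[i := y ! i - 1]) ` {..<d}"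
  using assms by (auto simp: nbrs_def adjacent_def)

lemma inj_on_list_shift:
  assumes "length y = d" "c \<noteq> (0::int)"
  shows "inj_on (\<lambda>i. y[i := y ! i + c]) {..<d}"
proof (rule inj_onI, rule ccontr)
  fix i j assume "i \<in> {..<d}" "j \<in> {..<d}" and e: "y[i := y ! i + c] = y[j := y ! j + c]" and "i \<noteq> j"
  then have "y[i := y ! i + c] ! i = y[j := y ! j + c] ! i" by simp
  with \<open>i \<noteq> j\<close> \<open>i \<in> {..<d}\<close> assms show False by simp
qed

lemma sum_nbrs:
  assumes "site d y"
  shows "(\<Sum>z\<in>nbrs d y. g z) = (\<Sum>i<d. g (y[i := y ! i + 1]) + g (y[i := y ! i - 1]))"
proof -
  have l: "length y = d" using assms by (simp add: site_def)
  have disj: "(\<lambda>i. y[i := y ! i + 1]) ` {..<d} \<inter> (\<lambda>i. y[i := y ! i - 1]) ` {..<d} = {}"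
  proof -
    have "y[i := y ! i + 1] \<noteq> y[j := y ! j - 1]" if "i < d" "j < d" for i j
    proof
      assume e: "y[i := y ! i + 1] = y[j := y ! j - 1]"
      have "y[i := y ! i + 1] ! i = y[j := y ! j - 1] ! i" by (simp add: e)
      then show False using that l by (cases "i = j") auto
    qed
    then show ?thesis by auto
  qed
  have "(\<Sum>z\<in>nbrs d y. g z) = (\<Sum>z\<in>(\<lambda>i. y[i := y ! i + 1]) ` {..<d}. g z) + (\<Sum>z\<in>(\<lambda>i. y[i := y ! i - 1]) ` {..<d}. g z)"
    unfolding nbrs_eq[OF assms] by (rule sum.union_disjoint) (use disj in auto)
  also have "\<dots> = (\<Sum>i<d. g (y[i := y ! i + 1])) + (\<Sum>i<d. g (y[i := y ! i - 1]))"
    using inj_on_list_shift[OF l, of 1] inj_on_list_shift[OF l, of "-1"] by (simp add: sum.reindex)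
  finally show ?thesis by (simp add: sum.distrib)
qed

lemma finite_nbrs [simp]: "finite (nbrs d y)"
proof (cases "site d y")
  case True then show ?thesis by (simp add: nbrs_eq)
qed (simp add: nbrs_def adjacent_def)

lemma card_nbrs: "site d y \<Longrightarrow> card (nbrs d y) = 2 * d"
  using sum_nbrs[of d y "\<lambda>_. 1::nat"] by simp

lemma nbrs_site: "z \<in> nbrs d y \<Longrightarrow> site d z \<and> site d y"
  by (auto simp: nbrs_def adjacent_def site_def)

lemma nbrs_neq: "z \<in> nbrs d y \<Longrightarrow> z \<noteq> y"
proof
  assume "z \<in> nbrs d y" "z = y"
  then obtain i where i: "i < d" "length y = d" "y = y[i := y ! i + 1] \<or> y = y[i := y ! i - 1]"
    by (auto simp: nbrs_def adjacent_def site_def)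
  then have "y ! i = y ! i + 1 \<or> y ! i = y ! i - 1"
    by (metis nth_list_update_eq)
  then show False by simp
qed

lemma nbrs_sym: "z \<in> nbrs d y \<longleftrightarrow> y \<in> nbrs d z"
proof -
  have "y \<in> nbrs d z" if "z \<in> nbrs d y" for y z
  proof -
    from that obtain i where i: "i < d" "length y = d" "z = y[i := y ! i + 1] \<or> z = y[i := y ! i - 1]"
      by (auto simp: nbrs_def adjacent_def site_def)
    then show ?thesis
      unfolding nbrs_def adjacent_def site_def by (auto intro!: exI[of _ i])
  qed
  then show ?thesis by blast
qed

lemma lap_eq:
  assumes "site d y"
  shows "lap d f y = (\<Sum>z\<in>nbrs d y. f z) - 2 * real d * f y"
  using card_nbrs[OF assms] by (simp add: lap_def sum_subtractf)

lemma lap_coord: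
  assumes "site d y"
  shows "lap d f y = (\<Sum>i<d. f (y[i := y ! i + 1]) + f (y[i := y ! i - 1]) - 2 * f y)"
  unfolding lap_eq[OF assms] sum_nbrs[OF assms] by (simp add: sum_subtractf)

lemma sum_nbrs_swap:
  fixes h :: "int list \<Rightarrow> int list \<Rightarrow> real"
  assumes "finite F"
  shows "(\<Sum>y\<in>F. \<Sum>z\<in>nbrs d y \<inter> F. h y z) = (\<Sum>y\<in>F. \<Sum>z\<in>nbrs d y \<inter> F. h z y)"
proof -
  have e: "(\<Sum>z\<in>nbrs d y \<inter> F. g z) = (\<Sum>z\<in>F. if z \<in> nbrs d y then g z else 0)" for y and g :: "int list \<Rightarrow> real"
    using assms by (subst sum.inter_restrict[symmetric]) (auto simp: Int_commute)
  have "(\<Sum>y\<in>F. \<Sum>z\<in>nbrs d y \<inter> F. h y z) = (\<Sum>z\<in>F. \<Sum>y\<in>F. if z \<in> nbrs d y then h y z else 0)"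
    unfolding e by (rule sum.swap)
  also have "\<dots> = (\<Sum>y\<in>F. \<Sum>z\<in>nbrs d y \<inter> F. h z y)"
    unfolding e by (intro sum.cong refl) (use nbrs_sym in auto)
  finally show ?thesis .
qed

text \<open>Green's identity, from the symmetry of the neighbour relation. Since \<open>u\<close>
  vanishes off \<open>T\<close> and \<open>F\<close> contains every neighbour of \<open>T\<close>,
  no boundary terms arise and \<open>f\<close> is unrestricted.\<close>

lemma sum_by_parts:
  fixes f u :: "int list \<Rightarrow> real"
  assumes F: "finite F" "\<And>y. y \<in> F \<Longrightarrow> site d y" "T \<subseteq> F" "\<And>y. y \<in> T \<Longrightarrow> nbrs d y \<subseteq> F"
    and u: "\<And>y. y \<notin> T \<Longrightarrow> u y = 0"
  shows "(\<Sum>y\<in>F. f y * lap d u y) = (\<Sum>y\<in>F. u y * lap d f y)"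
proof -
  have 1: "(\<Sum>z\<in>nbrs d y. f y * u z) = (\<Sum>z\<in>nbrs d y \<inter> F. f y * u z)" for y
    by (rule sum.mono_neutral_right) (use u F in auto)
  have 2: "(\<Sum>z\<in>nbrs d y. f z * u y) = (\<Sum>z\<in>nbrs d y \<inter> F. f z * u y)" for y
  proof (cases "y \<in> T")
    case True then have "nbrs d y \<inter> F = nbrs d y" using F by blast
    then show ?thesis by simp
  qed (simp add: u)
  have "(\<Sum>y\<in>F. f y * lap d u y) = (\<Sum>y\<in>F. (\<Sum>z\<in>nbrs d y. f y * u z) - 2 * real d * f y * u y)"
    by (rule sum.cong) (auto simp: lap_eq F sum_distrib_left algebra_simps)
  also have "\<dots> = (\<Sum>y\<in>F. \<Sum>z\<in>nbrs d y \<inter> F. f y * u z) - (\<Sum>y\<in>F. 2 * real d * f y * u y)"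
    by (simp add: sum_subtractf 1)
  also have "(\<Sum>y\<in>F. \<Sum>z\<in>nbrs d y \<inter> F. f y * u z) = (\<Sum>y\<in>F. \<Sum>z\<in>nbrs d y \<inter> F. f z * u y)"
    by (rule sum_nbrs_swap[OF F(1)])
  also have "\<dots> - (\<Sum>y\<in>F. 2 * real d * f y * u y) = (\<Sum>y\<in>F. (\<Sum>z\<in>nbrs d y. f z * u y) - 2 * real d * f y * u y)"
    by (simp add: sum_subtractf 2)
  also have "\<dots> = (\<Sum>y\<in>F. u y * lap d f y)"
    by (rule sum.cong) (auto simp: lap_eq F sum_distrib_left algebra_simps)
  finally show ?thesis .
qed

section \<open>Legal toppling sequences\<close>

lemma legal_append: "legal d \<eta> (xs @ ys) \<longleftrightarrow> legal d \<eta> xs \<and> legal d (foldl (topple d) \<eta> xs) ys"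
  by (induction xs arbitrary: \<eta>) auto

lemma legal_sites: "legal d \<eta> xs \<Longrightarrow> x \<in> set xs \<Longrightarrow> site d x"
  by (induction xs arbitrary: \<eta>) auto

text \<open>Only the number of topplings of each site enters, not their order. This is the form of
  the abelian property on which the odometer rests.\<close>

lemma foldl_topple:
  assumes "site d y" "\<And>x. x \<in> set xs \<Longrightarrow> site d x"
  shows "foldl (topple d) \<eta> xs y =
    \<eta> y + (\<Sum>z\<in>nbrs d y. int (count_list xs z)) - 2 * int d * int (count_list xs y)"
  using assms(2)
proof (induction xs rule: rev_induct)
  case (snoc x xs)
  have "(\<Sum>z\<in>nbrs d y. int (count_list (xs @ [x]) z)) =
    (\<Sum>z\<in>nbrs d y. int (count_list xs z)) + (\<Sum>z\<in>nbrs d y. if x = z then 1 else 0)"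
    unfolding sum.distrib[symmetric] by (rule sum.cong) auto
  also have "(\<Sum>z\<in>nbrs d y. if x = z then 1 else 0) = (if adjacent d x y then 1 else (0::int))"
    using nbrs_sym[of x d y] by (subst sum.delta'[OF finite_nbrs]) (simp add: nbrs_def)
  finally show ?case using snoc by (auto simp: topple_def algebra_simps)
qed simp

definition odo :: "int list list \<Rightarrow> int list \<Rightarrow> real" where
  "odo xs y = real (count_list xs y)"

lemma odo_nonneg [simp]: "0 \<le> odo xs y"
  by (simp add: odo_def)

lemma odo_eq_0: "odo xs y = 0 \<longleftrightarrow> y \<notin> set xs"
  by (induction xs) (auto simp: odo_def)

lemma odo_ge_1: "y \<in> set xs \<Longrightarrow> 1 \<le> odo xs y"
  using odo_eq_0[of xs y] by (simp add: odo_def)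

lemma final_config:
  assumes "legal d \<eta> xs" "site d y"
  shows "real_of_int (foldl (topple d) \<eta> xs y) = real_of_int (\<eta> y) + lap d (odo xs) y"
proof -
  have "foldl (topple d) \<eta> xs y =
    \<eta> y + (\<Sum>z\<in>nbrs d y. int (count_list xs z)) - 2 * int d * int (count_list xs y)"
    by (rule foldl_topple) (use assms legal_sites in auto)
  then show ?thesis by (simp add: lap_eq[OF assms(2)] odo_def)
qed

section \<open>Order of the last topplings and the mass it leaves behind\<close>

text \<open>Sites that topple after the last toppling of \<open>y\<close>: in the reversed list the
  last occurrence of \<open>y\<close> comes first. If \<open>y\<close> does not topple, this is all
  of \<open>set xs\<close>.\<close>

definition later :: "'a \<Rightarrow> 'a list \<Rightarrow> 'a set" where
  "later y xs = set (takeWhile (\<lambda>z. z \<noteq> y) (rev xs))"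

lemma later_snoc: "later y (xs @ [x]) = (if x = y then {} else insert x (later y xs))"
  unfolding later_def by (cases "x = y") auto

lemma later_subset: "later y xs \<subseteq> set xs"
  unfolding later_def by (auto dest: set_takeWhileD)

lemma later_total: "y \<in> set xs \<Longrightarrow> z \<in> set xs \<Longrightarrow> y \<noteq> z \<Longrightarrow> y \<in> later z xs \<or> z \<in> later y xs"
  by (induction xs rule: rev_induct) (auto simp: later_snoc)

text \<open>After its last toppling a site keeps every grain sent by a neighbour toppled later.\<close>

lemma config_ge_later:
  assumes "legal d \<eta> xs" "y \<in> set xs"
  shows "int (card (nbrs d y \<inter> later y xs)) \<le> foldl (topple d) \<eta> xs y"
  using assms
proof (induction xs rule: rev_induct)
  case (snoc x xs)
  from snoc.prems have l: "legal d \<eta> xs" "site d x" "2 * int d \<le> foldl (topple d) \<eta> xs x"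
    by (auto simp: legal_append)
  show ?case
  proof (cases "x = y")
    case True
    have "\<not> adjacent d y y" using nbrs_neq[of y d y] by (auto simp: nbrs_def)
    then show ?thesis using True l by (simp add: later_snoc topple_def[of _ "foldl (topple d) \<eta> xs"])
  next
    case False
    with snoc.prems have "y \<in> set xs" by simp
    with snoc.IH l have IH: "int (card (nbrs d y \<inter> later y xs)) \<le> foldl (topple d) \<eta> xs y" by simp
    have "nbrs d y \<inter> later y (xs @ [x]) \<subseteq> (nbrs d y \<inter> later y xs) \<union> (if adjacent d x y then {x} else {})"
      using False nbrs_sym[of x d y] by (auto simp: later_snoc nbrs_def)
    then have "card (nbrs d y \<inter> later y (xs @ [x])) \<le> card ((nbrs d y \<inter> later y xs) \<union> (if adjacent d x y then {x} else {}))"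
      by (intro card_mono) auto
    also have "\<dots> \<le> card (nbrs d y \<inter> later y xs) + card (if adjacent d x y then {x} else {})"
      by (rule card_Un_le)
    finally have "int (card (nbrs d y \<inter> later y (xs @ [x]))) \<le>
      int (card (nbrs d y \<inter> later y xs)) + (if adjacent d x y then 1 else 0)" by (auto split: if_splits)
    then show ?thesis using IH False by (simp add: topple_def[of _ "foldl (topple d) \<eta> xs"])
  qed
qed simp

lemma legal_config_nonneg:
  assumes "legal d \<eta> xs" "y \<in> set xs"
  shows "0 \<le> foldl (topple d) \<eta> xs y"
  using config_ge_later[OF assms] by linarith

definition src :: "nat \<Rightarrow> nat \<Rightarrow> int list \<Rightarrow> real" where
  "src d n y = (if y = origin d then real n else 0)"

lemma lap_odo:
  assumes "legal d (init_config d n H) xs" "site d y"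
  shows "lap d (odo xs) y = real_of_int (foldl (topple d) (init_config d n H) xs y) + real_of_int H - src d n y"
  using final_config[OF assms] by (simp add: init_config_def src_def)

lemma site_origin [simp]: "site d (origin d)"
  by (simp add: site_def origin_def)

text \<open>Each edge inside the toppled set contributes a grain to the
  endpoint whose last toppling came first.\<close>

lemma weighted_mass_lower:
  fixes \<psi> :: "int list \<Rightarrow> real"
  assumes leg: "legal d (init_config d n H) xs"
    and F: "finite F" "\<And>y. y \<in> F \<Longrightarrow> site d y" "set xs \<subseteq> F" "\<And>y. y \<in> set xs \<Longrightarrow> nbrs d y \<subseteq> F"
    and psi: "\<And>y. 0 \<le> \<psi> y"
  shows "(real d + real_of_int H) * (\<Sum>y\<in>set xs. \<psi> y)
      - (\<Sum>y\<in>set xs. \<Sum>z\<in>nbrs d y. \<bar>\<psi> y - \<psi> z\<bar>) / 2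
    \<le> (\<Sum>y\<in>F. \<psi> y * (lap d (odo xs) y + src d n y))"
proof -
  let ?T = "set xs" and ?u = "odo xs"
  define A where "A y = lap d ?u y + src d n y" for y
  have AT: "real_of_int H + (\<Sum>z\<in>nbrs d y \<inter> ?T. if z \<in> later y xs then 1 else 0) \<le> A y" if "y \<in> ?T" for y
  proof -
    have s: "site d y" using that F by blast
    have "(\<Sum>z\<in>nbrs d y \<inter> ?T. if z \<in> later y xs then 1 else 0) = real (card (nbrs d y \<inter> later y xs))"
      using later_subset[of y xs]
      by (simp add: sum.If_cases) (metis Int_assoc Int_absorb1)
    then show ?thesis using config_ge_later[OF leg that] lap_odo[OF leg s] unfolding A_def by linarith
  qed
  \<comment> \<open>At an untoppled site \<open>A\<close> is the number of grains sent or placed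
    there, so \<open>H\<close> does not enter.\<close>
  have AN: "(\<Sum>z\<in>nbrs d y \<inter> ?T. 1) \<le> A y" if "y \<in> F" "y \<notin> ?T" for y
  proof -
    have s: "site d y" using that F by blast
    have "(\<Sum>z\<in>nbrs d y \<inter> ?T. 1) \<le> (\<Sum>z\<in>nbrs d y \<inter> ?T. ?u z)"
      by (rule sum_mono) (use odo_ge_1 in auto)
    also have "\<dots> \<le> (\<Sum>z\<in>nbrs d y. ?u z)" by (rule sum_mono2) auto
    also have "\<dots> = lap d ?u y" using that by (simp add: lap_eq[OF s] odo_eq_0)
    finally show ?thesis unfolding A_def src_def by (cases "y = origin d") simp_all
  qed
  \<comment> \<open>The part of the bound on \<open>A y\<close> that the edge from \<open>y\<close>
    to \<open>z\<close> accounts for: the kept grain sits at the end whose last toppling came first,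
    or at the untoppled end.\<close>
  define g where "g y z = (if y \<in> ?T then if z \<in> ?T then if z \<in> later y xs then \<psi> y else 0 else 0
      else if z \<in> ?T then \<psi> y else 0)" for y z
  \<comment> \<open>The kept grain may sit at the end of smaller weight, so an edge inside the
    toppled set guarantees only the minimum of the two weights. Replacing it by their mean costs
    half of their difference; this is the source of the gradient term.\<close>
  have gg: "(if y \<in> ?T then \<psi> y - \<bar>\<psi> y - \<psi> z\<bar> else 0) + (if z \<in> ?T then \<psi> z - \<bar>\<psi> y - \<psi> z\<bar> else 0) \<le> 2 * (g y z + g z y)"
    if "z \<in> nbrs d y" for y z
    using that nbrs_neq[OF that] later_total[of y xs z] psi[of y] psi[of z] unfolding g_def
    by (auto simp: abs_if)
  have "(\<Sum>y\<in>F. real_of_int H * (if y \<in> ?T then \<psi> y else 0) + (\<Sum>z\<in>nbrs d y \<inter> F. g y z)) \<le> (\<Sum>y\<in>F. \<psi> y * A y)"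
  proof (rule sum_mono)
    fix y assume y: "y \<in> F"
    show "real_of_int H * (if y \<in> ?T then \<psi> y else 0) + (\<Sum>z\<in>nbrs d y \<inter> F. g y z) \<le> \<psi> y * A y"
    proof (cases "y \<in> ?T")
      case True
      have "(\<Sum>z\<in>nbrs d y \<inter> F. g y z) = (\<Sum>z\<in>nbrs d y \<inter> ?T. \<psi> y * (if z \<in> later y xs then 1 else 0))"
        by (rule sum.mono_neutral_cong_right) (use F True in \<open>auto simp: g_def\<close>)
      then show ?thesis using mult_left_mono[OF AT[OF True] psi[of y]] True
        by (simp add: sum_distrib_left algebra_simps)
    next
      case False
      have "(\<Sum>z\<in>nbrs d y \<inter> F. g y z) = (\<Sum>z\<in>nbrs d y \<inter> ?T. \<psi> y * 1)"
        by (rule sum.mono_neutral_cong_right) (use F False in \<open>auto simp: g_def\<close>)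
      then show ?thesis using mult_left_mono[OF AN[OF y False] psi[of y]] False
        by (simp add: sum_distrib_left algebra_simps)
    qed
  qed
  moreover have "(\<Sum>y\<in>F. real_of_int H * (if y \<in> ?T then \<psi> y else 0)) = real_of_int H * (\<Sum>y\<in>?T. \<psi> y)"
    unfolding sum_distrib_left by (rule sum.mono_neutral_cong_right) (use F in auto)
  ultimately have 1: "real_of_int H * (\<Sum>y\<in>?T. \<psi> y) + (\<Sum>y\<in>F. \<Sum>z\<in>nbrs d y \<inter> F. g y z) \<le> (\<Sum>y\<in>F. \<psi> y * A y)"
    by (simp add: sum.distrib)
  define k where "k y z = (if y \<in> ?T then \<psi> y - \<bar>\<psi> y - \<psi> z\<bar> else 0)" for y z
  have "(\<Sum>y\<in>F. \<Sum>z\<in>nbrs d y \<inter> F. k y z) + (\<Sum>y\<in>F. \<Sum>z\<in>nbrs d y \<inter> F. k z y)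
      \<le> 2 * ((\<Sum>y\<in>F. \<Sum>z\<in>nbrs d y \<inter> F. g y z) + (\<Sum>y\<in>F. \<Sum>z\<in>nbrs d y \<inter> F. g z y))"
    unfolding sum.distrib[symmetric] sum_distrib_left
  proof (intro sum_mono)
    fix y z assume "z \<in> nbrs d y \<inter> F"
    then show "k y z + k z y \<le> 2 * (g y z + g z y)"
      using gg[of z y] by (auto simp: k_def abs_minus_commute split: if_splits)
  qed
  then have 2: "(\<Sum>y\<in>F. \<Sum>z\<in>nbrs d y \<inter> F. k y z) \<le> 2 * (\<Sum>y\<in>F. \<Sum>z\<in>nbrs d y \<inter> F. g y z)"
    using sum_nbrs_swap[OF F(1), where d = d and h = k] sum_nbrs_swap[OF F(1), where d = d and h = g] by simp
  have "(\<Sum>y\<in>F. \<Sum>z\<in>nbrs d y \<inter> F. k y z) = (\<Sum>y\<in>?T. \<Sum>z\<in>nbrs d y. \<psi> y - \<bar>\<psi> y - \<psi> z\<bar>)"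
  proof (rule sum.mono_neutral_cong_right[OF F(1) F(3)])
    show "\<forall>i\<in>F - set xs. (\<Sum>z\<in>nbrs d i \<inter> F. k i z) = 0" by (simp add: k_def)
    show "(\<Sum>z\<in>nbrs d y \<inter> F. k y z) = (\<Sum>z\<in>nbrs d y. \<psi> y - \<bar>\<psi> y - \<psi> z\<bar>)" if "y \<in> ?T" for y
    proof -
      have "nbrs d y \<inter> F = nbrs d y" using that F by blast
      then show ?thesis using that by (simp add: k_def)
    qed
  qed
  \<comment> \<open>Each toppled site has \<open>2 * d\<close> edges and each edge is counted from
    both ends, hence the density \<open>d\<close>.\<close>
  also have "\<dots> = (\<Sum>y\<in>?T. 2 * real d * \<psi> y - (\<Sum>z\<in>nbrs d y. \<bar>\<psi> y - \<psi> z\<bar>))"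
    by (rule sum.cong) (use F card_nbrs in \<open>auto simp: sum_subtractf\<close>)
  also have "\<dots> = 2 * real d * (\<Sum>y\<in>?T. \<psi> y) - (\<Sum>y\<in>?T. \<Sum>z\<in>nbrs d y. \<bar>\<psi> y - \<psi> z\<bar>)"
    by (simp add: sum_subtractf sum_distrib_left)
  finally have 3: "2 * real d * (\<Sum>y\<in>?T. \<psi> y) - (\<Sum>y\<in>?T. \<Sum>z\<in>nbrs d y. \<bar>\<psi> y - \<psi> z\<bar>)
    \<le> 2 * (\<Sum>y\<in>F. \<Sum>z\<in>nbrs d y \<inter> F. g y z)" using 2 by simp
  show ?thesis using 1 3 unfolding A_def[symmetric] by (simp add: algebra_simps)
qed


section \<open>The ambient space\<close>

text \<open>Sites become points of the function space that carries the product measure. Coordinates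
  from \<open>d\<close> on are unspecified, so whatever is applied to them must look at indices
  below \<open>d\<close> only.\<close>

definition emb :: "int list \<Rightarrow> nat \<Rightarrow> real" where
  "emb y = (\<lambda>i. real_of_int (y ! i))"

definition nsq :: "nat \<Rightarrow> (nat \<Rightarrow> real) \<Rightarrow> real" where
  "nsq d z = (\<Sum>i<d. (z i)\<^sup>2)"

definition nrm :: "nat \<Rightarrow> (nat \<Rightarrow> real) \<Rightarrow> real" where
  "nrm d z = sqrt (nsq d z)"

text \<open>Unit steps from arbitrary real points, because the test function of the inner bound is
  evaluated on a shifted lattice.\<close>

definition dlap :: "nat \<Rightarrow> ((nat \<Rightarrow> real) \<Rightarrow> real) \<Rightarrow> (nat \<Rightarrow> real) \<Rightarrow> real" where
  "dlap d \<Psi> z = (\<Sum>i<d. \<Psi> (z(i := z i + 1)) + \<Psi> (z(i := z i - 1)) - 2 * \<Psi> z)"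

lemma nsq_nonneg [simp]: "0 \<le> nsq d z"
  by (simp add: nsq_def sum_nonneg)

lemma nrm_nonneg [simp]: "0 \<le> nrm d z"
  by (simp add: nrm_def)

lemma nrm_L2: "nrm d z = L2_set z {..<d}"
  by (simp add: nrm_def nsq_def L2_set_def)

lemma nrm_power2: "(nrm d z)\<^sup>2 = nsq d z"
  by (simp add: nrm_def)

lemma nsq_cong: "(\<And>i. i < d \<Longrightarrow> z i = w i) \<Longrightarrow> nsq d z = nsq d w"
  by (simp add: nsq_def)

lemma nrm_cong: "(\<And>i. i < d \<Longrightarrow> z i = w i) \<Longrightarrow> nrm d z = nrm d w"
  unfolding nrm_def using nsq_cong by metis

lemma nsq_upd: "i < d \<Longrightarrow> nsq d (z(i := t)) = nsq d z - (z i)\<^sup>2 + t\<^sup>2"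
  unfolding nsq_def by (subst (1 2) sum.remove[of _ i]) auto

lemma nrm_triangle: "nrm d (\<lambda>i. z i + w i) \<le> nrm d z + nrm d w"
  unfolding nrm_L2 by (rule L2_set_triangle_ineq)

lemma nrm_minus: "nrm d (\<lambda>i. z i - w i) = nrm d (\<lambda>i. w i - z i)"
  by (simp add: nrm_def nsq_def power2_commute)

lemma nrm_diff_triangle: "nrm d (\<lambda>i. z i - x i) \<le> nrm d (\<lambda>i. z i - y i) + nrm d (\<lambda>i. y i - x i)"
  using nrm_triangle[of d "\<lambda>i. z i - y i" "\<lambda>i. y i - x i"] by simp

lemma coord_le_nrm: "i < d \<Longrightarrow> \<bar>z i\<bar> \<le> nrm d z"
  unfolding nrm_L2 using member_le_L2_set[of "{..<d}" i "\<lambda>i. \<bar>z i\<bar>"] by (simp add: L2_set_def)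

lemma nrm_upd_diff:
  assumes "i < d"
  shows "\<bar>nrm d (z(i := t)) - nrm d z\<bar> \<le> \<bar>t - z i\<bar>"
proof -
  define e where "e = (\<lambda>k. if k = i then t - z i else 0)"
  have ne: "nrm d e = \<bar>t - z i\<bar>" and ne': "nrm d (\<lambda>k. - e k) = \<bar>t - z i\<bar>"
    using assms unfolding nrm_def nsq_def e_def by (simp_all add: if_distrib[of "\<lambda>x. x\<^sup>2"] cong: if_cong)
  have "nrm d (z(i := t)) = nrm d (\<lambda>k. z k + e k)" by (rule nrm_cong) (simp add: e_def)
  moreover have "nrm d z = nrm d (\<lambda>k. (z(i := t)) k + - e k)" by (rule nrm_cong) (simp add: e_def)
  ultimately show ?thesis
    using nrm_triangle[of d z e] nrm_triangle[of d "z(i := t)" "\<lambda>k. - e k"] ne ne' by linarith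
qed

lemma emb_upd: "i < length y \<Longrightarrow> emb (y[i := c]) = (emb y)(i := real_of_int c)"
  by (rule ext) (simp add: emb_def)

lemma lnorm_nrm: "site d y \<Longrightarrow> lnorm y = nrm d (emb y)"
  by (simp add: lnorm_def nrm_def nsq_def emb_def site_def sum_list_sum_nth atLeast0LessThan)

lemma emb_origin: "i < d \<Longrightarrow> emb (origin d) i = 0"
  by (simp add: emb_def origin_def)

lemma lap_emb:
  assumes "site d y"
  shows "lap d (\<lambda>y. \<Psi> (\<lambda>i. emb y i + \<theta> i)) y = dlap d \<Psi> (\<lambda>i. emb y i + \<theta> i)"
proof -
  have "(\<lambda>k. emb (y[i := y ! i + c]) k + \<theta> k) = (\<lambda>k. emb y k + \<theta> k)(i := emb y i + \<theta> i + real_of_int c)"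
    if "i < d" for i c
    using that assms by (auto simp: emb_upd site_def fun_eq_iff) (simp add: emb_def)
  from this[of _ 1] this[of _ "-1"] show ?thesis
    unfolding lap_coord[OF assms] dlap_def by simp
qed

lemma dlap_shift: "dlap d (\<lambda>z. \<Psi> (\<lambda>k. z k - c k)) z = dlap d \<Psi> (\<lambda>k. z k - c k)"
proof -
  have "(\<lambda>k. (z(i := z i + t)) k - c k) = (\<lambda>k. z k - c k)(i := z i - c i + t)" for i t
    by (auto simp: fun_eq_iff)
  from this[of _ 1] this[of _ "-1"] show ?thesis unfolding dlap_def by simp
qed

lemma lap_emb_diff:
  assumes "site d y"
  shows "lap d (\<lambda>y. \<Psi> (\<lambda>i. emb y i - c i)) y = dlap d \<Psi> (\<lambda>i. emb y i - c i)"
  using lap_emb[OF assms, of \<Psi> "\<lambda>i. - c i"] by simp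

lemma dlap_nsq: "dlap d (nsq d) z = 2 * real d"
proof -
  have "dlap d (nsq d) z = (\<Sum>i<d. 2)"
    unfolding dlap_def by (rule sum.cong) (simp_all add: nsq_upd power2_eq_square algebra_simps)
  then show ?thesis by simp
qed

lemma lap_nsq_emb: "site d y \<Longrightarrow> lap d (\<lambda>y. nsq d (emb y)) y = 2 * real d"
  using lap_emb_diff[of d y "nsq d" "\<lambda>_. 0"] by (simp add: dlap_nsq)

lemma finite_lball: "finite (lball d \<rho>)"
proof -
  have "lball d \<rho> \<subseteq> {xs. set xs \<subseteq> {- \<lceil>\<rho>\<rceil> .. \<lceil>\<rho>\<rceil>} \<and> length xs = d}"
  proof
    fix y assume y: "y \<in> lball d \<rho>"
    then have s: "length y = d" "nrm d (emb y) < \<rho>" by (auto simp: lball_def site_def lnorm_nrm)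
    have "y ! i \<in> {- \<lceil>\<rho>\<rceil> .. \<lceil>\<rho>\<rceil>}" if "i < d" for i
    proof -
      have "\<bar>real_of_int (y ! i)\<bar> \<le> \<rho>" using coord_le_nrm[OF that, of "emb y"] s by (simp add: emb_def)
      then have "\<bar>real_of_int (y ! i)\<bar> \<le> real_of_int \<lceil>\<rho>\<rceil>" by (meson le_of_int_ceiling order_trans)
      then show ?thesis by (auto simp: abs_le_iff)
    qed
    then show "y \<in> {xs. set xs \<subseteq> {- \<lceil>\<rho>\<rceil> .. \<lceil>\<rho>\<rceil>} \<and> length xs = d}"
      using s by (auto simp: in_set_conv_nth)
  qed
  moreover have "finite {xs. set xs \<subseteq> {- \<lceil>\<rho>\<rceil> .. \<lceil>\<rho>\<rceil>} \<and> length xs = d}"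
    by (rule finite_lists_length_eq) simp
  ultimately show ?thesis by (rule finite_subset)
qed

lemma nrm_nbr:
  assumes "z \<in> nbrs d y"
  shows "\<bar>nrm d (\<lambda>i. emb z i - c i) - nrm d (\<lambda>i. emb y i - c i)\<bar> \<le> 1"
proof -
  from assms obtain i e where i: "i < d" "length y = d" "z = y[i := y ! i + e]" "\<bar>e\<bar> = 1"
    unfolding nbrs_def adjacent_def site_def
    by simp (metis abs_1 abs_minus uminus_add_conv_diff add.commute)
  have "(\<lambda>k. emb z k - c k) = (\<lambda>k. emb y k - c k)(i := emb y i - c i + real_of_int e)"
    using i by (auto simp: emb_upd fun_eq_iff) (simp add: emb_def)
  then show ?thesis using nrm_upd_diff[OF i(1), of "\<lambda>k. emb y k - c k" "emb y i - c i + real_of_int e"] i(4)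
    by simp
qed

lemma nrm_nbr0: "z \<in> nbrs d y \<Longrightarrow> \<bar>nrm d (emb z) - nrm d (emb y)\<bar> \<le> 1"
  using nrm_nbr[of z d y "\<lambda>_. 0"] by simp

lemma in_lball: "y \<in> lball d \<rho> \<longleftrightarrow> site d y \<and> nrm d (emb y) < \<rho>"
  by (auto simp: lball_def lnorm_nrm)

section \<open>Maximal legal sequences\<close>

text \<open>Pairing the odometer with |y|^2, whose Laplacian is \<open>2 * d\<close>, turns the
  number of topplings into a sum of |y|^2 times the Laplacian of the odometer. That Laplacian is at
  least \<open>- B\<close> on \<open>F\<close> and sums to zero, so it is bounded above as
  well.\<close>

lemma legal_length_bound:
  assumes L: "finite L" and d: "0 < d"
  obtains N where "\<And>xs. legal d (init_config d n H) xs \<Longrightarrow> set xs \<subseteq> L \<Longrightarrow> length xs \<le> N"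
proof
  define F where "F = {y \<in> L. site d y} \<union> (\<Union>y\<in>{y \<in> L. site d y}. nbrs d y)"
  define B where "B = real n + \<bar>real_of_int H\<bar>"
  fix xs assume leg: "legal d (init_config d n H) xs" and sub: "set xs \<subseteq> L"
  let ?u = "odo xs"
  have F: "finite F" "\<And>y. y \<in> F \<Longrightarrow> site d y" "set xs \<subseteq> F" "\<And>y. y \<in> set xs \<Longrightarrow> nbrs d y \<subseteq> F"
    using L sub legal_sites[OF leg] nbrs_site unfolding F_def by auto
  have lower: "- B \<le> lap d ?u y" if "y \<in> F" for y
  proof (cases "y \<in> set xs")
    case True
    then show ?thesis using lap_odo[OF leg F(2)[OF that]] legal_config_nonneg[OF leg True]
      unfolding B_def src_def by (auto split: if_splits)
  next
    case False
    then have "0 \<le> lap d ?u y" using F(2)[OF that] by (simp add: lap_eq odo_eq_0[THEN iffD2] sum_nonneg)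
    then show ?thesis unfolding B_def by simp
  qed
  have sum0: "(\<Sum>y\<in>F. lap d ?u y) = 0"
    using sum_by_parts[OF F(1) F(2) F(3) F(4), of ?u "\<lambda>_. 1"] by (simp add: odo_eq_0 lap_def)
  have upper: "lap d ?u y \<le> B * real (card F)" if "y \<in> F" for y
  proof -
    have "(\<Sum>z\<in>F - {y}. - B) \<le> (\<Sum>z\<in>F - {y}. lap d ?u z)" by (rule sum_mono) (use lower in auto)
    moreover have "lap d ?u y = - (\<Sum>z\<in>F - {y}. lap d ?u z)"
      using sum0 sum.remove[OF F(1) that, of "lap d ?u"] by simp
    ultimately have "lap d ?u y \<le> real (card (F - {y})) * B" by simp
    also have "\<dots> \<le> B * real (card F)"
      unfolding mult.commute[of "real _" B] using F(1)
      by (intro mult_left_mono) (auto simp: B_def card_mono)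
    finally show ?thesis .
  qed
  have "2 * real d * (\<Sum>y\<in>F. ?u y) = (\<Sum>y\<in>F. ?u y * lap d (\<lambda>y. nsq d (emb y)) y)"
    unfolding sum_distrib_left by (rule sum.cong) (use F in \<open>auto simp: lap_nsq_emb\<close>)
  also have "\<dots> = (\<Sum>y\<in>F. nsq d (emb y) * lap d ?u y)"
    using sum_by_parts[OF F(1) F(2) F(3) F(4), of ?u "\<lambda>y. nsq d (emb y)"] by (simp add: odo_eq_0)
  also have "\<dots> \<le> (\<Sum>y\<in>F. nsq d (emb y) * (B * real (card F)))"
    by (intro sum_mono mult_left_mono upper) auto
  finally have "2 * real d * (\<Sum>y\<in>F. ?u y) \<le> (\<Sum>y\<in>F. nsq d (emb y) * (B * real (card F)))" .
  moreover have "(\<Sum>y\<in>F. ?u y) = real (length xs)"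
    unfolding odo_def using sum_count_set[OF F(3) F(1)] by (metis of_nat_sum)
  moreover have "real (length xs) \<le> 2 * real d * real (length xs)"
    using d by (simp add: mult_le_cancel_right1)
  ultimately have "real (length xs) \<le> (\<Sum>y\<in>F. nsq d (emb y) * (B * real (card F)))" by simp
  then show "length xs \<le> nat \<lceil>\<Sum>y\<in>F. nsq d (emb y) * (B * real (card F))\<rceil>" by linarith
qed

text \<open>In a longest legal sequence inside \<open>L\<close> no site of \<open>L\<close> can be
  left unstable, as it could be toppled once more. Only the set of toppled sites of
  \<open>xs0\<close> is kept, not \<open>xs0\<close> as a prefix.\<close>

lemma maximal_legal:
  assumes L: "finite L" and d: "0 < d"
    and xs0: "legal d (init_config d n H) xs0" "set xs0 \<subseteq> L"
  obtains xs where "legal d (init_config d n H) xs" "set xs0 \<subseteq> set xs" "set xs \<subseteq> L"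
    "\<And>y. y \<in> L \<Longrightarrow> site d y \<Longrightarrow> foldl (topple d) (init_config d n H) xs y < 2 * int d"
proof -
  let ?P = "\<lambda>xs. legal d (init_config d n H) xs \<and> set xs0 \<subseteq> set xs \<and> set xs \<subseteq> L"
  obtain N where N: "\<And>xs. legal d (init_config d n H) xs \<Longrightarrow> set xs \<subseteq> L \<Longrightarrow> length xs \<le> N"
    using legal_length_bound[OF L d] by blast
  have "\<exists>xs. ?P xs \<and> (\<forall>ys. ?P ys \<longrightarrow> length ys \<le> length xs)"
    by (rule ex_has_greatest_nat[of ?P xs0 length "Suc N"]) (use xs0 N in \<open>auto simp: less_Suc_eq_le\<close>)
  then obtain xs where xs: "?P xs" and mx: "\<And>ys. ?P ys \<Longrightarrow> length ys \<le> length xs" by blast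
  show ?thesis
  proof
    fix y assume y: "y \<in> L" "site d y"
    show "foldl (topple d) (init_config d n H) xs y < 2 * int d"
    proof (rule ccontr)
      assume "\<not> ?thesis"
      then have "?P (xs @ [y])" using xs y by (auto simp: legal_append)
      from mx[OF this] show False by simp
    qed
  qed (use xs in auto)
qed

text \<open>A site other than the origin starts with \<open>- H\<close> grains beyond its absorbed
  ones, at most \<open>2 * d - 2\<close>, so it has to receive grains before its first
  toppling.\<close>

lemma toppled_nbr_first:
  assumes leg: "legal d (init_config d n H) (ys @ x # zs)" and x: "x \<notin> set ys" "x \<noteq> origin d"
    and H: "2 - 2 * int d \<le> H"
  shows "\<exists>z\<in>nbrs d x. z \<in> set ys"
proof (rule ccontr)
  assume n: "\<not> ?thesis"
  from leg have l: "legal d (init_config d n H) ys" "site d x"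
    "2 * int d \<le> foldl (topple d) (init_config d n H) ys x" by (auto simp: legal_append)
  have "(\<Sum>z\<in>nbrs d x. odo ys z) = 0" by (rule sum.neutral) (use n in \<open>auto simp: odo_eq_0\<close>)
  then have "lap d (odo ys) x = 0" using x(1) l(2) by (simp add: lap_eq odo_eq_0[THEN iffD2])
  then have "real_of_int (foldl (topple d) (init_config d n H) ys x) = real_of_int (- H)"
    using final_config[OF l(1,2)] x(2) by (simp add: init_config_def)
  then show False using l(3) H by linarith
qed

lemma toppled_visited:
  assumes leg: "legal d (init_config d n H) xs" and x: "x \<in> set xs" and H: "2 - 2 * int d \<le> H"
  shows "x \<in> visited d n H"
proof (cases "x = origin d")
  case False
  obtain ys zs where xs: "xs = ys @ x # zs" "x \<notin> set ys" using split_list_first[OF x] by blast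
  then obtain z where "z \<in> nbrs d x" "z \<in> set ys" using toppled_nbr_first leg False H by blast
  then have "z \<in> set xs" "adjacent d z x" using xs nbrs_sym[of z d x] by (auto simp: nbrs_def)
  then show ?thesis using leg unfolding visited_def by blast
qed (simp add: visited_def)

text \<open>Every newly toppled site other than the origin is adjacent to an earlier one, so the
  largest norm grows by at most one with each new site.\<close>

lemma toppled_nrm:
  assumes "legal d (init_config d n H) xs" "x \<in> set xs" "2 - 2 * int d \<le> H"
  shows "nrm d (emb x) + 1 \<le> real (card (set xs))"
  using assms
proof (induction xs arbitrary: x rule: rev_induct)
  case (snoc y xs)
  have leg: "legal d (init_config d n H) xs" using snoc.prems by (simp add: legal_append)
  show ?case
  proof (cases "x \<in> set xs")
    case True
    have "real (card (set xs)) \<le> real (card (set (xs @ [y])))" by (simp add: card_mono subset_insertI)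
    then show ?thesis using snoc.IH[OF leg True snoc.prems(3)] by linarith
  next
    case False
    then have xy: "x = y" using snoc.prems by simp
    have c: "real (card (set (xs @ [y]))) = real (card (set xs)) + 1" using False xy by simp
    show ?thesis
    proof (cases "x = origin d")
      case True
      then have "nrm d (emb x) = 0" by (simp add: nrm_def nsq_def emb_origin)
      then show ?thesis using c by simp
    next
      case no: False
      then obtain z where z: "z \<in> nbrs d x" "z \<in> set xs"
        using toppled_nbr_first[of d n H xs x "[]"] snoc.prems xy False by auto
      have "nrm d (emb z) + 1 \<le> real (card (set xs))" using snoc.IH[OF leg z(2) snoc.prems(3)] .
      then show ?thesis using nrm_nbr0[OF z(1)] c by linarith
    qed
  qed
qed simp

text \<open>With constant weight the gradient term of \<open>weighted_mass_lower\<close> vanishes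
  and the total mass is at most \<open>n\<close>, while each toppled site carries at least
  \<open>d + H \<ge> 1\<close> on average.\<close>

lemma card_toppled_le:
  assumes leg: "legal d (init_config d n H) xs" and H: "1 - int d \<le> H"
  shows "card (set xs) \<le> n"
proof -
  define F where "F = set xs \<union> (\<Union>y\<in>set xs. nbrs d y)"
  have F: "finite F" "\<And>y. y \<in> F \<Longrightarrow> site d y" "set xs \<subseteq> F" "\<And>y. y \<in> set xs \<Longrightarrow> nbrs d y \<subseteq> F"
    using legal_sites[OF leg] nbrs_site unfolding F_def by auto
  have "(real d + real_of_int H) * (\<Sum>y\<in>set xs. 1) - (\<Sum>y\<in>set xs. \<Sum>z\<in>nbrs d y. \<bar>1 - 1\<bar>) / 2
      \<le> (\<Sum>y\<in>F. 1 * (lap d (odo xs) y + src d n y))"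
    by (rule weighted_mass_lower[OF leg F]) auto
  moreover have "(\<Sum>y\<in>F. lap d (odo xs) y) = 0"
    using sum_by_parts[OF F(1) F(2) F(3) F(4), of "odo xs" "\<lambda>_. 1"] by (simp add: odo_eq_0 lap_def)
  moreover have "(\<Sum>y\<in>F. src d n y) \<le> real n"
    unfolding src_def using F(1) by (simp add: sum.delta)
  ultimately have "(real d + real_of_int H) * real (card (set xs)) \<le> real n" by (simp add: sum.distrib)
  moreover have "1 * real (card (set xs)) \<le> (real d + real_of_int H) * real (card (set xs))"
    by (rule mult_right_mono) (use H in linarith, simp)
  ultimately show ?thesis by linarith
qed

section \<open>Growth of a function away from a zero\<close>

definition l1 :: "nat \<Rightarrow> int list \<Rightarrow> int list \<Rightarrow> nat" where
  "l1 d y x = (\<Sum>i<d. nat \<bar>y ! i - x ! i\<bar>)"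

lemma l1_step:
  assumes "site d y" "site d x" "0 < l1 d y x"
  shows "\<exists>z\<in>nbrs d y. l1 d y x = Suc (l1 d z x)"
proof -
  from assms(3) obtain i where i: "i < d" "y ! i \<noteq> x ! i"
    unfolding l1_def by (metis (no_types, lifting) abs_0 cancel_comm_monoid_add_class.diff_cancel lessThan_iff less_irrefl nat_0 sum.neutral)
  define e :: int where "e = (if y ! i < x ! i then 1 else - 1)"
  define z where "z = y[i := y ! i + e]"
  have l: "length y = d" using assms by (simp add: site_def)
  have "z \<in> nbrs d y" using i assms unfolding nbrs_def adjacent_def z_def e_def by auto
  moreover have "l1 d y x = nat \<bar>y ! i - x ! i\<bar> + (\<Sum>k\<in>{..<d} - {i}. nat \<bar>y ! k - x ! k\<bar>)"
    unfolding l1_def using i by (intro sum.remove) auto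
  moreover have "l1 d z x = nat \<bar>z ! i - x ! i\<bar> + (\<Sum>k\<in>{..<d} - {i}. nat \<bar>z ! k - x ! k\<bar>)"
    unfolding l1_def using i by (intro sum.remove) auto
  moreover have "(\<Sum>k\<in>{..<d} - {i}. nat \<bar>z ! k - x ! k\<bar>) = (\<Sum>k\<in>{..<d} - {i}. nat \<bar>y ! k - x ! k\<bar>)"
    by (rule sum.cong) (auto simp: z_def)
  moreover have "nat \<bar>y ! i - x ! i\<bar> = Suc (nat \<bar>z ! i - x ! i\<bar>)"
    using i l by (auto simp: z_def e_def)
  ultimately have "l1 d y x = Suc (l1 d z x)" by simp
  with \<open>z \<in> nbrs d y\<close> show ?thesis by blast
qed

lemma l1_le_nrm:
  assumes "nrm d (\<lambda>i. emb y i - emb x i) \<le> r"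
  shows "real (l1 d y x) \<le> real d * r"
proof -
  have "real (l1 d y x) = (\<Sum>i<d. \<bar>emb y i - emb x i\<bar>)"
    unfolding l1_def of_nat_sum by (rule sum.cong) (auto simp: emb_def)
  also have "\<dots> \<le> (\<Sum>i<d. r)"
    by (rule sum_mono) (use coord_le_nrm[of _ d "\<lambda>i. emb y i - emb x i"] assms in force)
  finally show ?thesis by simp
qed

text \<open>From \<open>lap d u z \<le> m\<close> the sum of \<open>u\<close> over the neighbours of
  \<open>z\<close> is at most \<open>m + 2 * d * u z\<close>, and nonnegativity passes this bound to
  each single neighbour. It is iterated along a shortest lattice path from \<open>x\<close>.
  Linearity in \<open>m\<close> matters for the inner constant.\<close>

lemma growth_from_zero:
  assumes u: "\<And>y. 0 \<le> u y" "u x = 0" "site d x" "0 \<le> m"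
    and lap: "\<And>z. site d z \<Longrightarrow> l1 d z x < L \<Longrightarrow> lap d u z \<le> m"
    and y: "site d y" "l1 d y x \<le> L"
  shows "u y \<le> m * (2 * real d + 1) ^ l1 d y x"
  using y
proof (induction "l1 d y x" arbitrary: y)
  case 0
  then have "\<forall>i<d. y ! i = x ! i" unfolding l1_def by auto
  then have "y = x" using 0 u(3) by (auto simp: site_def list_eq_iff_nth_eq)
  then show ?case using u by simp
next
  case (Suc l)
  then obtain z where z: "z \<in> nbrs d y" "l1 d y x = Suc (l1 d z x)" using l1_step[of d y x] u(3) by auto
  have sz: "site d z" using nbrs_site z by blast
  have IH: "u z \<le> m * (2 * real d + 1) ^ l1 d z x" using Suc.hyps z sz Suc.prems by auto
  have "u y \<le> (\<Sum>w\<in>nbrs d z. u w)"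
    by (rule member_le_sum) (use z nbrs_sym u in auto)
  also have "\<dots> \<le> m + 2 * real d * u z" using lap[OF sz] Suc.prems z lap_eq[OF sz, of u] by auto
  also have "\<dots> \<le> m * (2 * real d + 1) ^ l1 d z x + 2 * real d * (m * (2 * real d + 1) ^ l1 d z x)"
    by (intro add_mono mult_left_mono IH) (use u(4) in \<open>auto simp: mult_le_cancel_left1\<close>)
  finally show ?case using z(2) by (simp add: algebra_simps)
qed

section \<open>Discrete Laplacians of radial and dipole functions\<close>

definition dot :: "nat \<Rightarrow> (nat \<Rightarrow> real) \<Rightarrow> (nat \<Rightarrow> real) \<Rightarrow> real" where
  "dot d X z = (\<Sum>i<d. X i * z i)"

lemma dot_upd: "i < d \<Longrightarrow> dot d X (z(i := t)) = dot d X z + X i * (t - z i)"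
  unfolding dot_def by (subst (1 2) sum.remove[of _ i]) (auto simp: algebra_simps)

lemma abs_dot_le: "\<bar>dot d X z\<bar> \<le> nrm d X * nrm d z"
proof -
  have "\<bar>dot d X z\<bar> \<le> (\<Sum>i<d. \<bar>X i\<bar> * \<bar>z i\<bar>)"
    unfolding dot_def by (rule order_trans[OF sum_abs]) (simp add: abs_mult)
  also have "\<dots> \<le> nrm d X * nrm d z" unfolding nrm_L2 by (rule L2_set_mult_ineq)
  finally show ?thesis .
qed

text \<open>Fourth-order Taylor expansion at 0, taken at 1 and at -1: the odd terms cancel and each
  remainder contributes at most \<open>B / 24\<close>.\<close>

lemma second_difference_bound:
  fixes f f1 f2 f3 f4 :: "real \<Rightarrow> real"
  assumes "\<And>t. \<bar>t\<bar> \<le> 1 \<Longrightarrow> (f has_real_derivative f1 t) (at t)"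
    and "\<And>t. \<bar>t\<bar> \<le> 1 \<Longrightarrow> (f1 has_real_derivative f2 t) (at t)"
    and "\<And>t. \<bar>t\<bar> \<le> 1 \<Longrightarrow> (f2 has_real_derivative f3 t) (at t)"
    and "\<And>t. \<bar>t\<bar> \<le> 1 \<Longrightarrow> (f3 has_real_derivative f4 t) (at t)"
    and B: "\<And>t. \<bar>t\<bar> \<le> 1 \<Longrightarrow> \<bar>f4 t\<bar> \<le> B"
  shows "\<bar>f 1 + f (- 1) - 2 * f 0 - f2 0\<bar> \<le> B / 12"
proof -
  define D where "D = (\<lambda>m::nat. if m = 0 then f else if m = 1 then f1 else if m = 2 then f2 else if m = 3 then f3 else f4)"
  have der: "\<forall>m t. m < 4 \<and> \<bar>t\<bar> \<le> \<bar>x\<bar> \<longrightarrow> DERIV (D m) t :> D (Suc m) t" if "\<bar>x\<bar> = 1" for x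
  proof (intro allI impI)
    fix m :: nat and t :: real assume "m < 4 \<and> \<bar>t\<bar> \<le> \<bar>x\<bar>"
    then have "m = 0 \<or> m = 1 \<or> m = 2 \<or> m = 3" "\<bar>t\<bar> \<le> 1" using that by auto
    then show "DERIV (D m) t :> D (Suc m) t" using assms by (auto simp: D_def)
  qed
  have ex: "\<exists>t. \<bar>t\<bar> \<le> 1 \<and> f x = f 0 + f1 0 * x + f2 0 / 2 * x^2 + f3 0 / 6 * x^3 + f4 t / 24 * x^4"
    if x: "\<bar>x\<bar> = 1" for x
  proof -
    have "D 0 = f" by (simp add: D_def)
    from Maclaurin_bi_le[OF this der[OF x]] obtain t where t: "\<bar>t\<bar> \<le> \<bar>x\<bar>"
      "f x = (\<Sum>m<4. D m 0 / fact m * x ^ m) + D 4 t / fact 4 * x ^ 4" by blast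
    have "(\<Sum>m<4. D m 0 / fact m * x ^ m) = f 0 + f1 0 * x + f2 0 / 2 * x^2 + f3 0 / 6 * x^3"
      by (simp add: D_def numeral_eq_Suc)
    moreover have "D 4 t / fact 4 * x ^ 4 = f4 t / 24 * x^4" by (simp add: D_def fact_numeral)
    ultimately show ?thesis using t x by auto
  qed
  obtain t where t: "\<bar>t\<bar> \<le> 1" "f 1 = f 0 + f1 0 + f2 0 / 2 + f3 0 / 6 + f4 t / 24" using ex[of 1] by auto
  obtain s where s: "\<bar>s\<bar> \<le> 1" "f (-1) = f 0 - f1 0 + f2 0 / 2 - f3 0 / 6 + f4 s / 24" using ex[of "-1"] by auto
  have "f 1 + f (- 1) - 2 * f 0 - f2 0 = f4 t / 24 + f4 s / 24" using t s by simp
  then show ?thesis using B[OF t(1)] B[OF s(1)] by linarith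
qed

text \<open>Here \<open>q0\<close> is |z|^2 and \<open>a\<close> a coordinate of z. A step of length
  at most 1 along that coordinate leaves the norm at least |z| - 1, hence at least |z| / 2 since |z|
  \<ge> 2.\<close>

lemma shifted_square_bounds:
  fixes q0 a t :: real
  assumes "4 \<le> q0" "a\<^sup>2 \<le> q0" "\<bar>t\<bar> \<le> 1"
  shows "q0 / 4 \<le> q0 + 2 * a * t + t\<^sup>2" "(a + t)\<^sup>2 \<le> q0 + 2 * a * t + t\<^sup>2"
proof -
  have s: "2 \<le> sqrt q0" "(sqrt q0)\<^sup>2 = q0" using assms real_le_rsqrt[of 2 q0] by auto
  have "\<bar>a * t\<bar> \<le> sqrt q0 * \<bar>t\<bar>"
    unfolding abs_mult by (rule mult_right_mono) (use assms in \<open>auto intro: real_le_rsqrt\<close>)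
  then have "(sqrt q0 - \<bar>t\<bar>)\<^sup>2 \<le> q0 + 2 * a * t + t\<^sup>2" using s by (simp add: power2_diff abs_le_iff algebra_simps)
  moreover have "(sqrt q0 / 2)\<^sup>2 \<le> (sqrt q0 - \<bar>t\<bar>)\<^sup>2" by (rule power_mono) (use s assms in auto)
  ultimately show "q0 / 4 \<le> q0 + 2 * a * t + t\<^sup>2" using s by (simp add: power_divide)
  show "(a + t)\<^sup>2 \<le> q0 + 2 * a * t + t\<^sup>2" using assms by (simp add: power2_sum)
qed

text \<open>Second difference of (X . z) h(|z|^2) along one coordinate, with \<beta> = X . z,
  \<gamma> the coordinate of X and \<open>a\<close> that of z; \<beta> = 1, \<gamma> = 0 is the
  radial case. The hypotheses say that the derivatives of \<open>h\<close> decay like those of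
  s^(-\<alpha>). They bound derivatives of order two to four only, so that a logarithm is covered by
  \<alpha> = 0.\<close>

lemma radial_second_difference:
  fixes h h1 h2 h3 h4 :: "real \<Rightarrow> real"
  assumes h: "\<And>s. 0 < s \<Longrightarrow> (h has_real_derivative h1 s) (at s)"
    "\<And>s. 0 < s \<Longrightarrow> (h1 has_real_derivative h2 s) (at s)"
    "\<And>s. 0 < s \<Longrightarrow> (h2 has_real_derivative h3 s) (at s)"
    "\<And>s. 0 < s \<Longrightarrow> (h3 has_real_derivative h4 s) (at s)"
    and b: "\<And>s. 0 < s \<Longrightarrow> \<bar>h2 s\<bar> \<le> M * s powr (- \<alpha> - 2)"
    "\<And>s. 0 < s \<Longrightarrow> \<bar>h3 s\<bar> \<le> M * s powr (- \<alpha> - 3)"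
    "\<And>s. 0 < s \<Longrightarrow> \<bar>h4 s\<bar> \<le> M * s powr (- \<alpha> - 4)"
    and pos: "0 \<le> \<alpha>" "0 \<le> M"
    and q0: "4 \<le> q0" "a\<^sup>2 \<le> q0"
  shows "\<bar>(\<beta> + \<gamma>) * h (q0 + 2 * a + 1) + (\<beta> - \<gamma>) * h (q0 - 2 * a + 1) - 2 * (\<beta> * h q0)
      - (4 * \<gamma> * a * h1 q0 + \<beta> * (2 * h1 q0 + 4 * a\<^sup>2 * h2 q0))\<bar>
    \<le> M * 4 powr (\<alpha> + 2) * (13 * \<bar>\<gamma>\<bar> * q0 powr (- \<alpha> - 3/2) + 7 * \<bar>\<beta>\<bar> * q0 powr (- \<alpha> - 2))"
proof -
  define q where "q t = q0 + 2 * a * t + t\<^sup>2" for t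
  define p where "p t = a + t" for t
  define b where "b t = \<beta> + \<gamma> * t" for t
  define H1 where "H1 t = 2 * p t * h1 (q t)" for t
  define H2 where "H2 t = 2 * h1 (q t) + 4 * (p t)^2 * h2 (q t)" for t
  define H3 where "H3 t = 12 * p t * h2 (q t) + 8 * (p t)^3 * h3 (q t)" for t
  define H4 where "H4 t = 12 * h2 (q t) + 48 * (p t)^2 * h3 (q t) + 16 * (p t)^4 * h4 (q t)" for t
  let ?B = "12 * (M * 4 powr (\<alpha> + 2) * (13 * \<bar>\<gamma>\<bar> * q0 powr (- \<alpha> - 3/2) + 7 * \<bar>\<beta>\<bar> * q0 powr (- \<alpha> - 2)))"
  have q: "0 < q t" "q0 / 4 \<le> q t" "(p t)\<^sup>2 \<le> q t" if "\<bar>t\<bar> \<le> 1" for t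
    using shifted_square_bounds[OF q0 that] q0 unfolding q_def p_def by auto
  have dq: "(q has_real_derivative 2 * p t) (at t)" for t
    unfolding q_def p_def by (auto intro!: derivative_eq_intros simp: algebra_simps)
  have dp: "(p has_real_derivative 1) (at t)" for t
    unfolding p_def by (auto intro!: derivative_eq_intros)
  have db: "(b has_real_derivative \<gamma>) (at t)" for t
    unfolding b_def by (auto intro!: derivative_eq_intros)
  have dh: "((\<lambda>t. k (q t)) has_real_derivative k' (q t) * (2 * p t)) (at t)"
    if "\<bar>t\<bar> \<le> 1" "\<And>s. 0 < s \<Longrightarrow> (k has_real_derivative k' s) (at s)" for t k k'
    by (rule DERIV_chain2[OF that(2)[OF q(1)[OF that(1)]] dq])
  have d1: "((\<lambda>t. b t * h (q t)) has_real_derivative \<gamma> * h (q t) + b t * H1 t) (at t)" if "\<bar>t\<bar> \<le> 1" for t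
    by (rule derivative_eq_intros dh[OF that h(1)] db | simp)+ (simp add: H1_def algebra_simps)
  have d2: "((\<lambda>t. \<gamma> * h (q t) + b t * H1 t) has_real_derivative 2 * \<gamma> * H1 t + b t * H2 t) (at t)" if "\<bar>t\<bar> \<le> 1" for t
    unfolding H1_def
    by (rule derivative_eq_intros dh[OF that h(1)] dh[OF that h(2)] db dp | simp)+
      (simp add: H1_def H2_def algebra_simps power2_eq_square)
  have d3: "((\<lambda>t. 2 * \<gamma> * H1 t + b t * H2 t) has_real_derivative 3 * \<gamma> * H2 t + b t * H3 t) (at t)" if "\<bar>t\<bar> \<le> 1" for t
    unfolding H1_def H2_def
    by (rule derivative_eq_intros dh[OF that h(2)] dh[OF that h(3)] db dp | simp)+
      (simp add: H2_def H3_def algebra_simps power2_eq_square power3_eq_cube)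
  have d4: "((\<lambda>t. 3 * \<gamma> * H2 t + b t * H3 t) has_real_derivative 4 * \<gamma> * H3 t + b t * H4 t) (at t)" if "\<bar>t\<bar> \<le> 1" for t
    unfolding H2_def H3_def
    by (rule derivative_eq_intros dh[OF that h(2)] dh[OF that h(3)] dh[OF that h(4)] db dp | simp)+
      (simp add: H3_def H4_def algebra_simps power2_eq_square power3_eq_cube power4_eq_xxxx)
  \<comment> \<open>Since |p| \<le> q^(1/2), \<open>H3\<close> is of order q^(-\<alpha>-3/2) and
    \<open>H4\<close> of order q^(-\<alpha>-2). In the fourth derivative of the product \<gamma>
    meets both of them, \<beta> only \<open>H4\<close>.\<close>
  have bound: "\<bar>4 * \<gamma> * H3 t + b t * H4 t\<bar> \<le> ?B" if t: "\<bar>t\<bar> \<le> 1" for t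
  proof -
    have qp: "0 < q t" by (rule q(1)[OF t])
    define P where "P = \<bar>p t\<bar>"
    have P2: "P\<^sup>2 \<le> q t" "0 \<le> P" using q(3)[OF t] by (auto simp: P_def)
    have P1: "P \<le> q t powr (1/2)" using P2 qp by (simp add: powr_half_sqrt real_le_rsqrt)
    have P4: "P^4 \<le> q t powr 2"
    proof -
      have "(P\<^sup>2)\<^sup>2 \<le> (q t)\<^sup>2" by (rule power_mono) (use P2 in auto)
      then show ?thesis using qp by (simp add: powr_numeral)
    qed
    have P3: "P^3 \<le> q t powr (3/2)"
    proof -
      have "P * P\<^sup>2 \<le> q t powr (1/2) * q t powr 1"
        by (rule mult_mono) (use P1 P2 qp in auto)
      also have "q t powr (1/2) * q t powr 1 = q t powr (3/2)"
        unfolding powr_add[symmetric] by simp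
      finally show ?thesis by (simp add: power3_eq_cube power2_eq_square)
    qed
    have P2': "P\<^sup>2 \<le> q t powr 1" using P2 qp by simp
    have m: "P' * \<bar>k\<bar> \<le> M * q t powr (e + f)" if "P' \<le> q t powr e" "0 \<le> P'" "\<bar>k\<bar> \<le> M * q t powr f" for P' k e f
    proof -
      have "P' * \<bar>k\<bar> \<le> q t powr e * (M * q t powr f)" by (rule mult_mono) (use that in auto)
      then show ?thesis by (simp add: powr_add mult.left_commute)
    qed
    have "\<bar>H3 t\<bar> \<le> 12 * (P * \<bar>h2 (q t)\<bar>) + 8 * (P^3 * \<bar>h3 (q t)\<bar>)"
      unfolding H3_def P_def by (rule order_trans[OF abs_triangle_ineq]) (simp add: abs_mult power_abs)
    also have "\<dots> \<le> 20 * (M * q t powr (- \<alpha> - 3/2))"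
      using m[OF P1 P2(2) b(1)[OF qp]] m[OF P3 _ b(2)[OF qp]] P2(2) by (simp add: add.commute)
    finally have H3b: "\<bar>H3 t\<bar> \<le> 20 * (M * q t powr (- \<alpha> - 3/2))" .
    have "\<bar>H4 t\<bar> \<le> 12 * \<bar>h2 (q t)\<bar> + 48 * (P^2 * \<bar>h3 (q t)\<bar>) + 16 * (P^4 * \<bar>h4 (q t)\<bar>)"
    proof -
      have "\<bar>H4 t\<bar> \<le> \<bar>12 * h2 (q t)\<bar> + \<bar>48 * (p t)^2 * h3 (q t)\<bar> + \<bar>16 * (p t)^4 * h4 (q t)\<bar>"
        unfolding H4_def by linarith
      then show ?thesis unfolding P_def by (simp add: abs_mult power_abs)
    qed
    also have "\<dots> \<le> 76 * (M * q t powr (- \<alpha> - 2))"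
      using b(1)[OF qp] m[OF P2' _ b(2)[OF qp]] m[OF P4 _ b(3)[OF qp]] by (simp add: add.commute)
    finally have H4b: "\<bar>H4 t\<bar> \<le> 76 * (M * q t powr (- \<alpha> - 2))" .
    have qe: "q t powr (- e) \<le> 4 powr (\<alpha> + 2) * q0 powr (- e)" if "0 \<le> e" "e \<le> \<alpha> + 2" for e
    proof -
      have "q t powr (- e) \<le> (q0 / 4) powr (- e)" by (rule powr_mono2') (use that q0 q(2)[OF t] in auto)
      also have "\<dots> = 4 powr e * q0 powr (- e)" using q0 by (simp add: powr_divide powr_minus_divide)
      also have "\<dots> \<le> 4 powr (\<alpha> + 2) * q0 powr (- e)" by (rule mult_right_mono) (use that in auto)
      finally show ?thesis .
    qed
    have q32: "q t powr (- \<alpha> - 3/2) \<le> 4 powr (\<alpha> + 2) * q0 powr (- \<alpha> - 3/2)" using qe[of "\<alpha> + 3/2"] pos by simp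
    have q2: "q t powr (- \<alpha> - 2) \<le> 4 powr (\<alpha> + 2) * q0 powr (- \<alpha> - 2)" using qe[of "\<alpha> + 2"] pos by simp
    have q23: "q0 powr (- \<alpha> - 2) \<le> q0 powr (- \<alpha> - 3/2)" by (rule powr_mono) (use q0 in auto)
    have bt: "\<bar>b t\<bar> \<le> \<bar>\<beta>\<bar> + \<bar>\<gamma>\<bar>"
    proof -
      have "\<bar>\<gamma> * t\<bar> \<le> \<bar>\<gamma>\<bar>" unfolding abs_mult using t by (simp add: mult_left_le)
      then show ?thesis unfolding b_def by linarith
    qed
    have "\<bar>4 * \<gamma> * H3 t + b t * H4 t\<bar> \<le> 4 * \<bar>\<gamma>\<bar> * \<bar>H3 t\<bar> + \<bar>b t\<bar> * \<bar>H4 t\<bar>"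
      by (rule order_trans[OF abs_triangle_ineq]) (simp add: abs_mult)
    also have "\<dots> \<le> 4 * \<bar>\<gamma>\<bar> * (20 * (M * q t powr (- \<alpha> - 3/2))) + (\<bar>\<beta>\<bar> + \<bar>\<gamma>\<bar>) * (76 * (M * q t powr (- \<alpha> - 2)))"
      by (intro add_mono mult_mono mult_left_mono H3b H4b bt) auto
    also have "\<dots> \<le> 4 * \<bar>\<gamma>\<bar> * (20 * (M * (4 powr (\<alpha> + 2) * q0 powr (- \<alpha> - 3/2)))) + (\<bar>\<beta>\<bar> + \<bar>\<gamma>\<bar>) * (76 * (M * (4 powr (\<alpha> + 2) * q0 powr (- \<alpha> - 2))))"
      by (intro add_mono mult_left_mono q32 q2) (use pos in auto)
    also have "\<dots> = M * 4 powr (\<alpha> + 2) * (80 * \<bar>\<gamma>\<bar> * q0 powr (- \<alpha> - 3/2) + 76 * \<bar>\<beta>\<bar> * q0 powr (- \<alpha> - 2) + 76 * \<bar>\<gamma>\<bar> * q0 powr (- \<alpha> - 2))"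
      by (simp add: algebra_simps)
    \<comment> \<open>The \<gamma> term with exponent -\<alpha>-2 is absorbed into the weaker one:
      80 + 76 = 12 * 13, and 76 is rounded up to 84 = 12 * 7. After division by 12 these are the 13
      and 7 of the statement.\<close>
    also have "\<dots> \<le> M * 4 powr (\<alpha> + 2) * (80 * \<bar>\<gamma>\<bar> * q0 powr (- \<alpha> - 3/2) + 84 * \<bar>\<beta>\<bar> * q0 powr (- \<alpha> - 2) + 76 * \<bar>\<gamma>\<bar> * q0 powr (- \<alpha> - 3/2))"
      by (intro mult_left_mono add_mono q23 order_refl mult_right_mono) (use pos in auto)
    also have "\<dots> = ?B" by (simp add: algebra_simps)
    finally show ?thesis .
  qed
  from second_difference_bound[OF d1 d2 d3 d4 bound]
  have "\<bar>b 1 * h (q 1) + b (- 1) * h (q (- 1)) - 2 * (b 0 * h (q 0)) - (2 * \<gamma> * H1 0 + b 0 * H2 0)\<bar> \<le> ?B / 12"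
    by simp
  then show ?thesis by (simp add: b_def q_def H1_def H2_def p_def algebra_simps)
qed

context
  fixes h h1 h2 h3 h4 :: "real \<Rightarrow> real" and M \<alpha> :: real
  assumes h: "\<And>s. 0 < s \<Longrightarrow> (h has_real_derivative h1 s) (at s)"
    "\<And>s. 0 < s \<Longrightarrow> (h1 has_real_derivative h2 s) (at s)"
    "\<And>s. 0 < s \<Longrightarrow> (h2 has_real_derivative h3 s) (at s)"
    "\<And>s. 0 < s \<Longrightarrow> (h3 has_real_derivative h4 s) (at s)"
    and b: "\<And>s. 0 < s \<Longrightarrow> \<bar>h2 s\<bar> \<le> M * s powr (- \<alpha> - 2)"
    "\<And>s. 0 < s \<Longrightarrow> \<bar>h3 s\<bar> \<le> M * s powr (- \<alpha> - 3)"
    "\<And>s. 0 < s \<Longrightarrow> \<bar>h4 s\<bar> \<le> M * s powr (- \<alpha> - 4)"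
    and pos: "0 \<le> \<alpha>" "0 \<le> M"
begin

lemma coord_sq_le_nsq: "i < d \<Longrightarrow> (z i)\<^sup>2 \<le> nsq d z"
  unfolding nsq_def by (rule member_le_sum) auto

lemma nsq_shift: "i < d \<Longrightarrow> nsq d (z(i := z i + 1)) = nsq d z + 2 * z i + 1"
  "i < d \<Longrightarrow> nsq d (z(i := z i - 1)) = nsq d z - 2 * z i + 1"
  by (simp_all add: nsq_upd power2_eq_square algebra_simps)

text \<open>The subtracted main term is the continuum Laplacian of h(|z|^2); the error is smaller by
  a factor |z|^(-2).\<close>

lemma dlap_radial:
  assumes "4 \<le> nsq d z"
  shows "\<bar>dlap d (\<lambda>z. h (nsq d z)) z - (2 * real d * h1 (nsq d z) + 4 * nsq d z * h2 (nsq d z))\<bar>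
    \<le> real d * (M * 4 powr (\<alpha> + 2) * 7 * nsq d z powr (- \<alpha> - 2))"
proof -
  let ?q = "nsq d z"
  have "2 * real d * h1 ?q + 4 * ?q * h2 ?q = (\<Sum>i<d. 2 * h1 ?q + 4 * (z i)\<^sup>2 * h2 ?q)"
    by (simp add: nsq_def sum.distrib sum_distrib_left sum_distrib_right)
  then have "\<bar>dlap d (\<lambda>z. h (nsq d z)) z - (2 * real d * h1 ?q + 4 * ?q * h2 ?q)\<bar>
    = \<bar>\<Sum>i<d. h (nsq d (z(i := z i + 1))) + h (nsq d (z(i := z i - 1))) - 2 * h ?q - (2 * h1 ?q + 4 * (z i)\<^sup>2 * h2 ?q)\<bar>"
    by (simp add: dlap_def sum_subtractf)
  also have "\<dots> \<le> (\<Sum>i<d. \<bar>h (nsq d (z(i := z i + 1))) + h (nsq d (z(i := z i - 1))) - 2 * h ?q - (2 * h1 ?q + 4 * (z i)\<^sup>2 * h2 ?q)\<bar>)"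
    by (rule sum_abs)
  also have "\<dots> \<le> (\<Sum>i<d. M * 4 powr (\<alpha> + 2) * 7 * ?q powr (- \<alpha> - 2))"
  proof (rule sum_mono)
    fix i assume "i \<in> {..<d}"
    then show "\<bar>h (nsq d (z(i := z i + 1))) + h (nsq d (z(i := z i - 1))) - 2 * h ?q - (2 * h1 ?q + 4 * (z i)\<^sup>2 * h2 ?q)\<bar>
      \<le> M * 4 powr (\<alpha> + 2) * 7 * ?q powr (- \<alpha> - 2)"
      using radial_second_difference[of h h1 h2 h3 h4 M \<alpha> ?q "z i" 1 0, OF h b pos assms coord_sq_le_nsq]
      by (simp add: nsq_shift)
  qed
  finally show ?thesis by simp
qed

text \<open>The subtracted main term is the continuum Laplacian of (X . z) h(|z|^2). In the error X
  . z is estimated by Cauchy-Schwarz, so that 13 + 7 = 20 appears.\<close>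

lemma dlap_dipole:
  assumes "4 \<le> nsq d z"
  shows "\<bar>dlap d (\<lambda>z. dot d X z * h (nsq d z)) z
      - dot d X z * ((2 * real d + 4) * h1 (nsq d z) + 4 * nsq d z * h2 (nsq d z))\<bar>
    \<le> real d * (M * 4 powr (\<alpha> + 2) * 20 * nrm d X * nsq d z powr (- \<alpha> - 3/2))"
proof -
  let ?q = "nsq d z" and ?b = "dot d X z"
  let ?t = "\<lambda>i. 4 * X i * z i * h1 ?q + ?b * (2 * h1 ?q + 4 * (z i)\<^sup>2 * h2 ?q)"
  have "(\<Sum>i<d. ?t i) = 4 * ?b * h1 ?q + ?b * (2 * real d * h1 ?q + 4 * ?q * h2 ?q)"
    by (simp add: dot_def nsq_def sum.distrib sum_distrib_left sum_distrib_right algebra_simps)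
  then have e: "?b * ((2 * real d + 4) * h1 ?q + 4 * ?q * h2 ?q) = (\<Sum>i<d. ?t i)"
    by (simp add: algebra_simps)
  have "dlap d (\<lambda>z. dot d X z * h (nsq d z)) z
    = (\<Sum>i<d. (?b + X i) * h (?q + 2 * z i + 1) + (?b - X i) * h (?q - 2 * z i + 1) - 2 * (?b * h ?q))"
    unfolding dlap_def by (rule sum.cong) (simp_all add: dot_upd nsq_shift)
  then have "\<bar>dlap d (\<lambda>z. dot d X z * h (nsq d z)) z - ?b * ((2 * real d + 4) * h1 ?q + 4 * ?q * h2 ?q)\<bar>
    = \<bar>\<Sum>i<d. (?b + X i) * h (?q + 2 * z i + 1) + (?b - X i) * h (?q - 2 * z i + 1) - 2 * (?b * h ?q) - ?t i\<bar>"
    unfolding e by (simp only: sum_subtractf)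
  also have "\<dots> \<le> (\<Sum>i<d. \<bar>(?b + X i) * h (?q + 2 * z i + 1) + (?b - X i) * h (?q - 2 * z i + 1) - 2 * (?b * h ?q) - ?t i\<bar>)"
    by (rule sum_abs)
  also have "\<dots> \<le> (\<Sum>i<d. M * 4 powr (\<alpha> + 2) * 20 * nrm d X * ?q powr (- \<alpha> - 3/2))"
  proof (rule sum_mono)
    fix i assume "i \<in> {..<d}"
    then have i: "i < d" by simp
    have "\<bar>(?b + X i) * h (?q + 2 * z i + 1) + (?b - X i) * h (?q - 2 * z i + 1) - 2 * (?b * h ?q) - ?t i\<bar>
      \<le> M * 4 powr (\<alpha> + 2) * (13 * \<bar>X i\<bar> * ?q powr (- \<alpha> - 3/2) + 7 * \<bar>?b\<bar> * ?q powr (- \<alpha> - 2))"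
      using radial_second_difference[of h h1 h2 h3 h4 M \<alpha> ?q "z i" ?b "X i", OF h b pos assms coord_sq_le_nsq[OF i]]
      by (simp add: algebra_simps)
    also have "\<dots> \<le> M * 4 powr (\<alpha> + 2) * (13 * nrm d X * ?q powr (- \<alpha> - 3/2) + 7 * (nrm d X * ?q powr (- \<alpha> - 3/2)))"
    proof -
      have "\<bar>?b\<bar> * ?q powr (- \<alpha> - 2) \<le> nrm d X * nrm d z * ?q powr (- \<alpha> - 2)"
        by (rule mult_right_mono[OF abs_dot_le]) auto
      also have "nrm d z = ?q powr (1/2)" by (simp add: nrm_def powr_half_sqrt)
      also have "nrm d X * ?q powr (1/2) * ?q powr (- \<alpha> - 2) = nrm d X * ?q powr (1/2 + (- \<alpha> - 2))"
        unfolding powr_add by simp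
      also have "1/2 + (- \<alpha> - 2) = - \<alpha> - 3/2" by simp
      finally have "7 * \<bar>?b\<bar> * ?q powr (- \<alpha> - 2) \<le> 7 * (nrm d X * ?q powr (- \<alpha> - 3/2))" by simp
      then show ?thesis
        using coord_le_nrm[OF i, of X] pos by (intro mult_left_mono add_mono mult_right_mono) auto
    qed
    finally show "\<bar>(?b + X i) * h (?q + 2 * z i + 1) + (?b - X i) * h (?q - 2 * z i + 1) - 2 * (?b * h ?q) - ?t i\<bar>
      \<le> M * 4 powr (\<alpha> + 2) * 20 * nrm d X * ?q powr (- \<alpha> - 3/2)"
      by (simp add: algebra_simps)
  qed
  finally show ?thesis by simp
qed

end

lemma powr_derivs:
  fixes \<kappa> :: real
  assumes "0 < s"
  shows "((\<lambda>s. c * s powr (- \<kappa>)) has_real_derivative (c * (- \<kappa>)) * s powr (- \<kappa> - 1)) (at s)"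
    "((\<lambda>s. c * s powr (- \<kappa> - 1)) has_real_derivative (c * (- \<kappa> - 1)) * s powr (- \<kappa> - 2)) (at s)"
    "((\<lambda>s. c * s powr (- \<kappa> - 2)) has_real_derivative (c * (- \<kappa> - 2)) * s powr (- \<kappa> - 3)) (at s)"
    "((\<lambda>s. c * s powr (- \<kappa> - 3)) has_real_derivative (c * (- \<kappa> - 3)) * s powr (- \<kappa> - 4)) (at s)"
proof -
  have "((\<lambda>s. c * s powr r) has_real_derivative (c * r) * s powr (r - 1)) (at s)" for r c :: real
    using DERIV_cmult[OF has_real_derivative_powr[OF assms, of r], of c] by (simp add: mult.assoc)
  from this[of c "- \<kappa>"] this[of c "- \<kappa> - 1"] this[of c "- \<kappa> - 2"] this[of c "- \<kappa> - 3"]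
  show "((\<lambda>s. c * s powr (- \<kappa>)) has_real_derivative (c * (- \<kappa>)) * s powr (- \<kappa> - 1)) (at s)"
    "((\<lambda>s. c * s powr (- \<kappa> - 1)) has_real_derivative (c * (- \<kappa> - 1)) * s powr (- \<kappa> - 2)) (at s)"
    "((\<lambda>s. c * s powr (- \<kappa> - 2)) has_real_derivative (c * (- \<kappa> - 2)) * s powr (- \<kappa> - 3)) (at s)"
    "((\<lambda>s. c * s powr (- \<kappa> - 3)) has_real_derivative (c * (- \<kappa> - 3)) * s powr (- \<kappa> - 4)) (at s)"
    by (simp_all add: algebra_simps)
qed

text \<open>The leading coefficient vanishes for \<kappa> = d/2 - 1 in the radial case and for
  \<kappa> = d/2 in the dipole case. These are the two terms of the Poisson kernel, and only the
  error term remains for them.\<close>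

lemma dlap_powr:
  assumes "0 \<le> \<kappa>"
  obtains C where "0 \<le> C" "\<And>z. 4 \<le> nsq d z \<Longrightarrow>
    \<bar>dlap d (\<lambda>z. nsq d z powr (- \<kappa>)) z - 2 * \<kappa> * (2 * \<kappa> + 2 - real d) * nsq d z powr (- \<kappa> - 1)\<bar>
      \<le> C * nsq d z powr (- \<kappa> - 2)"
    "\<And>X z. 4 \<le> nsq d z \<Longrightarrow>
    \<bar>dlap d (\<lambda>z. dot d X z * nsq d z powr (- \<kappa>)) z
        - 2 * \<kappa> * (2 * \<kappa> - real d) * dot d X z * nsq d z powr (- \<kappa> - 1)\<bar>
      \<le> C * nrm d X * nsq d z powr (- \<kappa> - 3/2)"
proof -
  \<comment> \<open>A common bound for the coefficients of the second to fourth derivatives of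
    s^(-\<kappa>).\<close>
  define M where "M = (\<kappa> + 4) ^ 4"
  have M0: "0 \<le> M" using assms by (simp add: M_def)
  define c2 where "c2 = (1 * (- \<kappa>)) * (- \<kappa> - 1)"
  define c3 where "c3 = c2 * (- \<kappa> - 2)"
  define c4 where "c4 = c3 * (- \<kappa> - 3)"
  have "c2 = \<kappa> * (\<kappa> + 1)" "c3 = - (\<kappa> * (\<kappa> + 1) * (\<kappa> + 2))" "c4 = \<kappa> * (\<kappa> + 1) * (\<kappa> + 2) * (\<kappa> + 3)"
    unfolding c2_def c3_def c4_def by (simp_all add: algebra_simps)
  then have "\<bar>c2\<bar> = \<kappa> * (\<kappa> + 1)" "\<bar>c3\<bar> = \<kappa> * (\<kappa> + 1) * (\<kappa> + 2)" "\<bar>c4\<bar> = \<kappa> * (\<kappa> + 1) * (\<kappa> + 2) * (\<kappa> + 3)"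
    using assms by (simp_all add: abs_mult)
  moreover have "\<kappa> * (\<kappa> + 1) * 1 * 1 \<le> M" "\<kappa> * (\<kappa> + 1) * (\<kappa> + 2) * 1 \<le> M" "\<kappa> * (\<kappa> + 1) * (\<kappa> + 2) * (\<kappa> + 3) \<le> M"
    unfolding M_def power4_eq_xxxx by (intro mult_mono; use assms in simp)+
  ultimately have c: "\<bar>c2\<bar> \<le> M" "\<bar>c3\<bar> \<le> M" "\<bar>c4\<bar> \<le> M" by auto
  define C where "C = real d * (M * 4 powr (\<kappa> + 2) * 20)"
  have C0: "0 \<le> C" using M0 by (simp add: C_def)
  have bnd: "\<bar>c * s powr e\<bar> \<le> M * s powr e" if "\<bar>c\<bar> \<le> M" for c s e :: real
    using that by (simp add: abs_mult mult_right_mono)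
  have d: "((\<lambda>s. s powr (- \<kappa>)) has_real_derivative (1 * (- \<kappa>)) * s powr (- \<kappa> - 1)) (at s)"
    "((\<lambda>s. (1 * (- \<kappa>)) * s powr (- \<kappa> - 1)) has_real_derivative c2 * s powr (- \<kappa> - 2)) (at s)"
    "((\<lambda>s. c2 * s powr (- \<kappa> - 2)) has_real_derivative c3 * s powr (- \<kappa> - 3)) (at s)"
    "((\<lambda>s. c3 * s powr (- \<kappa> - 3)) has_real_derivative c4 * s powr (- \<kappa> - 4)) (at s)"
    if "0 < s" for s
    using powr_derivs(1)[OF that, of 1 \<kappa>] unfolding c2_def c3_def c4_def
    by simp (rule powr_derivs[OF that])+
  note rad = dlap_radial[of "\<lambda>s. s powr (- \<kappa>)", OF d bnd[OF c(1)] bnd[OF c(2)] bnd[OF c(3)] assms M0]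
  note dip = dlap_dipole[of "\<lambda>s. s powr (- \<kappa>)", OF d bnd[OF c(1)] bnd[OF c(2)] bnd[OF c(3)] assms M0]
  have q: "nsq d z * nsq d z powr (- \<kappa> - 2) = nsq d z powr (- \<kappa> - 1)" if "4 \<le> nsq d z" for z
  proof -
    have "nsq d z powr 1 * nsq d z powr (- \<kappa> - 2) = nsq d z powr (1 + (- \<kappa> - 2))"
      by (rule powr_add[symmetric])
    also have "1 + (- \<kappa> - 2) = - \<kappa> - 1" by simp
    finally show ?thesis using that by simp
  qed
  show ?thesis
  proof (rule that[OF C0])
    fix z assume z: "4 \<le> nsq d z"
    have R: "\<bar>dlap d (\<lambda>z. nsq d z powr (- \<kappa>)) z - (2 * real d * ((1 * (- \<kappa>)) * nsq d z powr (- \<kappa> - 1)) + 4 * nsq d z * (c2 * nsq d z powr (- \<kappa> - 2)))\<bar>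
      \<le> real d * (M * 4 powr (\<kappa> + 2) * 7 * nsq d z powr (- \<kappa> - 2))"
      by (rule rad[OF _ _ _ _ z])
    have "2 * real d * ((1 * (- \<kappa>)) * nsq d z powr (- \<kappa> - 1)) + 4 * nsq d z * (c2 * nsq d z powr (- \<kappa> - 2))
      = 2 * real d * ((1 * (- \<kappa>)) * nsq d z powr (- \<kappa> - 1)) + 4 * c2 * (nsq d z * nsq d z powr (- \<kappa> - 2))"
      by simp
    also have "\<dots> = 2 * \<kappa> * (2 * \<kappa> + 2 - real d) * nsq d z powr (- \<kappa> - 1)"
      unfolding q[OF z] c2_def by (simp add: algebra_simps)
    finally show "\<bar>dlap d (\<lambda>z. nsq d z powr (- \<kappa>)) z - 2 * \<kappa> * (2 * \<kappa> + 2 - real d) * nsq d z powr (- \<kappa> - 1)\<bar>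
      \<le> C * nsq d z powr (- \<kappa> - 2)"
      using R M0 unfolding C_def
      by (simp only:)
  next
    fix X z assume z: "4 \<le> nsq d z"
    have R: "\<bar>dlap d (\<lambda>z. dot d X z * nsq d z powr (- \<kappa>)) z
        - dot d X z * ((2 * real d + 4) * ((1 * (- \<kappa>)) * nsq d z powr (- \<kappa> - 1)) + 4 * nsq d z * (c2 * nsq d z powr (- \<kappa> - 2)))\<bar>
      \<le> real d * (M * 4 powr (\<kappa> + 2) * 20 * nrm d X * nsq d z powr (- \<kappa> - 3/2))"
      by (rule dip[OF _ _ _ _ z])
    have "dot d X z * ((2 * real d + 4) * ((1 * (- \<kappa>)) * nsq d z powr (- \<kappa> - 1)) + 4 * nsq d z * (c2 * nsq d z powr (- \<kappa> - 2)))
      = dot d X z * ((2 * real d + 4) * ((1 * (- \<kappa>)) * nsq d z powr (- \<kappa> - 1)) + 4 * c2 * (nsq d z * nsq d z powr (- \<kappa> - 2)))"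
      by simp
    also have "\<dots> = 2 * \<kappa> * (2 * \<kappa> - real d) * dot d X z * nsq d z powr (- \<kappa> - 1)"
      unfolding q[OF z] c2_def by (simp add: algebra_simps)
    finally have eq: "dot d X z * ((2 * real d + 4) * ((1 * (- \<kappa>)) * nsq d z powr (- \<kappa> - 1)) + 4 * nsq d z * (c2 * nsq d z powr (- \<kappa> - 2)))
      = 2 * \<kappa> * (2 * \<kappa> - real d) * dot d X z * nsq d z powr (- \<kappa> - 1)" .
    show "\<bar>dlap d (\<lambda>z. dot d X z * nsq d z powr (- \<kappa>)) z
        - 2 * \<kappa> * (2 * \<kappa> - real d) * dot d X z * nsq d z powr (- \<kappa> - 1)\<bar>
      \<le> C * nrm d X * nsq d z powr (- \<kappa> - 3/2)"
      using R unfolding eq C_def by (simp only: mult.assoc)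
  qed
qed

section \<open>Lebesgue measure on the ambient space\<close>

text \<open>A product measure over the index set \<open>{..<d}\<close>, since the dimension is a
  variable and not a type.\<close>

abbreviation leb :: "nat \<Rightarrow> (nat \<Rightarrow> real) measure" where
  "leb d \<equiv> Pi\<^sub>M {..<d} (\<lambda>_. lborel)"

interpretation lebp: product_sigma_finite "\<lambda>_::nat. lborel :: real measure"
  by standard

lemma sigma_finite_leb: "sigma_finite_measure (leb d)"
  by (rule lebp.sigma_finite) simp

lemma measurable_coord [measurable]: "i < d \<Longrightarrow> (\<lambda>z. z i) \<in> borel_measurable (leb d)"
  using measurable_component_singleton[of i "{..<d}" "\<lambda>_. lborel"] by simp

lemma nsq_measurable [measurable]: "nsq d \<in> borel_measurable (leb d)"
  unfolding nsq_def by measurable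

lemma nrm_measurable [measurable]: "nrm d \<in> borel_measurable (leb d)"
  unfolding nrm_def by measurable

lemma nsq_diff_measurable [measurable]: "(\<lambda>z. nsq d (\<lambda>k. z k - X k)) \<in> borel_measurable (leb d)"
  unfolding nsq_def by measurable

lemma dot_diff_measurable [measurable]: "(\<lambda>z. dot d X (\<lambda>k. z k - Y k)) \<in> borel_measurable (leb d)"
  unfolding dot_def by measurable

lemma emeasure_ball:
  assumes "0 < r"
  shows "emeasure (leb d) {z \<in> space (leb d). nrm d z \<le> r} = ennreal (unit_ball_vol (real d) * r ^ d)"
  using emeasure_cball_aux[of "{..<d}" r] assms
  by (simp add: nrm_def nsq_def Int_def conj_commute)

lemma nn_integral_ball:
  assumes "0 < r"
  shows "(\<integral>\<^sup>+z. indicator {z. nrm d z \<le> r} z \<partial>leb d) = ennreal (unit_ball_vol (real d) * r ^ d)"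
proof -
  have "(\<integral>\<^sup>+z. indicator {z. nrm d z \<le> r} z \<partial>leb d) = (\<integral>\<^sup>+z. indicator {z \<in> space (leb d). nrm d z \<le> r} z \<partial>leb d)"
    by (rule nn_integral_cong) (auto split: split_indicator)
  also have "\<dots> = emeasure (leb d) {z \<in> space (leb d). nrm d z \<le> r}"
    by (rule nn_integral_indicator) measurable
  finally show ?thesis using emeasure_ball[OF assms] by simp
qed

text \<open>Points of \<open>leb d\<close> are extensional functions, while \<open>emb\<close> and
  pointwise sums are not. Functions that read only coordinates below \<open>d\<close> do not see the
  difference.\<close>

definition local :: "nat \<Rightarrow> ((nat \<Rightarrow> real) \<Rightarrow> 'a) \<Rightarrow> bool" where
  "local d f \<longleftrightarrow> (\<forall>z w. (\<forall>i<d. z i = w i) \<longrightarrow> f z = f w)"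

lemma localD: "local d f \<Longrightarrow> (\<And>i. i < d \<Longrightarrow> z i = w i) \<Longrightarrow> f z = f w"
  by (simp add: local_def)

lemma leb_translate:
  "distr (leb d) (leb d) (\<lambda>z. \<lambda>i\<in>{..<d}. z i + c i) = leb d"
proof (rule lebp.PiM_eqI)
  fix A :: "nat \<Rightarrow> real set" assume A: "\<And>i. i \<in> {..<d} \<Longrightarrow> A i \<in> sets lborel"
  have [measurable]: "(\<lambda>z. \<lambda>i\<in>{..<d}. z i + c i) \<in> measurable (leb d) (leb d)"
    by (rule measurable_restrict) measurable
  have B: "(\<lambda>x. x + c i) -` A i \<in> sets lborel" if "i < d" for i
    using A[of i] that measurable_sets[of "\<lambda>x. x + c i" lborel lborel "A i"] by simp
  have "emeasure (distr (leb d) (leb d) (\<lambda>z. \<lambda>i\<in>{..<d}. z i + c i)) (Pi\<^sub>E {..<d} A)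
    = emeasure (leb d) ((\<lambda>z. \<lambda>i\<in>{..<d}. z i + c i) -` Pi\<^sub>E {..<d} A \<inter> space (leb d))"
    by (rule emeasure_distr) (use A in \<open>auto intro!: sets_PiM_I_finite\<close>)
  also have "(\<lambda>z. \<lambda>i\<in>{..<d}. z i + c i) -` Pi\<^sub>E {..<d} A \<inter> space (leb d)
      = Pi\<^sub>E {..<d} (\<lambda>i. (\<lambda>x. x + c i) -` A i)"
    by (auto simp: space_PiM PiE_iff)
  also have "emeasure (leb d) \<dots> = (\<Prod>i<d. emeasure lborel ((\<lambda>x. x + c i) -` A i))"
    by (rule lebp.emeasure_PiM) (use B in auto)
  also have "\<dots> = (\<Prod>i<d. emeasure lborel (A i))"
  proof (rule prod.cong)
    fix i assume i: "i \<in> {..<d}"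
    have "emeasure lborel (A i) = emeasure (distr lborel borel ((+) (c i))) (A i)"
      by (simp add: lborel_distr_plus)
    also have "\<dots> = emeasure lborel ((+) (c i) -` A i \<inter> space lborel)"
      by (rule emeasure_distr) (use A[OF i] in auto)
    also have "(+) (c i) -` A i \<inter> space lborel = (\<lambda>x. x + c i) -` A i" by (auto simp: add.commute)
    finally show "emeasure lborel ((\<lambda>x. x + c i) -` A i) = emeasure lborel (A i)" by simp
  qed simp
  finally show "emeasure (distr (leb d) (leb d) (\<lambda>z. \<lambda>i\<in>{..<d}. z i + c i)) (Pi\<^sub>E {..<d} A) = (\<Prod>i\<in>{..<d}. emeasure lborel (A i))" .
qed simp_all

lemma nn_integral_translate:
  fixes f :: "(nat \<Rightarrow> real) \<Rightarrow> ennreal"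
  assumes f [measurable]: "f \<in> borel_measurable (leb d)" and loc: "local d f"
  shows "(\<integral>\<^sup>+z. f (\<lambda>i. c i + z i) \<partial>leb d) = (\<integral>\<^sup>+z. f z \<partial>leb d)"
proof -
  have [measurable]: "(\<lambda>z. \<lambda>i\<in>{..<d}. z i + c i) \<in> measurable (leb d) (leb d)"
    by (rule measurable_restrict) measurable
  have "(\<integral>\<^sup>+z. f z \<partial>leb d) = (\<integral>\<^sup>+z. f z \<partial>distr (leb d) (leb d) (\<lambda>z. \<lambda>i\<in>{..<d}. z i + c i))"
    by (simp only: leb_translate)
  also have "\<dots> = (\<integral>\<^sup>+z. f (\<lambda>i\<in>{..<d}. z i + c i) \<partial>leb d)"
    by (rule nn_integral_distr) measurable
  also have "\<dots> = (\<integral>\<^sup>+z. f (\<lambda>i. c i + z i) \<partial>leb d)"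
    by (rule nn_integral_cong) (auto intro!: localD[OF loc])
  finally show ?thesis by simp
qed

section \<open>Unit cubes: lattice sums against integrals, and lattice point counts\<close>

definition cube :: "nat \<Rightarrow> (nat \<Rightarrow> real) set" where
  "cube d = {z. \<forall>i<d. 0 \<le> z i \<and> z i < 1}"

lemma cube_measurable [measurable]: "indicator (cube d) \<in> borel_measurable (leb d)"
  unfolding cube_def by measurable

lemma local_cube: "local d (\<lambda>z. indicator (cube d) (\<lambda>i. z i - c i))"
  unfolding local_def
proof (intro allI impI)
  fix z w :: "nat \<Rightarrow> real" assume "\<forall>i<d. z i = w i"
  then have "(\<lambda>i. z i - c i) \<in> cube d \<longleftrightarrow> (\<lambda>i. w i - c i) \<in> cube d" unfolding cube_def by simp
  then show "indicator (cube d) (\<lambda>i. z i - c i) = indicator (cube d) (\<lambda>i. w i - c i)"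
    unfolding indicator_def by (rule arg_cong)
qed

lemma nn_integral_cube: "(\<integral>\<^sup>+z. indicator (cube d) z \<partial>leb d) = 1"
proof -
  have "(\<integral>\<^sup>+z. indicator (cube d) z \<partial>leb d) = (\<integral>\<^sup>+z. indicator (Pi\<^sub>E {..<d} (\<lambda>_. {0..<1})) z \<partial>leb d)"
    by (rule nn_integral_cong) (auto simp: cube_def space_PiM PiE_iff split: split_indicator)
  also have "\<dots> = emeasure (leb d) (Pi\<^sub>E {..<d} (\<lambda>_. {0..<1}))"
    by (rule nn_integral_indicator) (auto intro!: sets_PiM_I_finite)
  also have "\<dots> = (\<Prod>i<d. emeasure lborel {0..<1::real})"
    by (rule lebp.emeasure_PiM) auto
  finally show ?thesis by simp
qed

lemma cube_shift_measurable [measurable]: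
  "(\<lambda>z. indicator (cube d) (\<lambda>i. z i - c i)) \<in> borel_measurable (leb d)"
proof -
  have e: "(\<lambda>z. indicator (cube d) (\<lambda>i. z i - c i)) = indicator {z. \<forall>i<d. c i \<le> z i \<and> z i < 1 + c i}"
    by (rule ext) (auto simp: cube_def algebra_simps split: split_indicator)
  show ?thesis unfolding e by measurable
qed

lemma nn_integral_cube_shift: "(\<integral>\<^sup>+z. indicator (cube d) (\<lambda>i. z i - c i) \<partial>leb d) = 1"
  using nn_integral_translate[OF cube_shift_measurable local_cube, of d c c] nn_integral_cube by simp

lemma cube_disjoint:
  assumes "site d x" "site d y" "(\<lambda>i. z i - emb x i) \<in> cube d" "(\<lambda>i. z i - emb y i) \<in> cube d"
  shows "x = y"
proof -
  have "x ! i = y ! i" if "i < d" for i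
  proof -
    have "0 \<le> z i - real_of_int (x ! i)" "z i - real_of_int (x ! i) < 1"
      "0 \<le> z i - real_of_int (y ! i)" "z i - real_of_int (y ! i) < 1"
      using assms(3,4) that by (auto simp: cube_def emb_def)
    then show ?thesis by linarith
  qed
  then show ?thesis using assms by (auto simp: site_def list_eq_iff_nth_eq)
qed

lemma sum_cube_le_1:
  assumes "finite Y" "\<And>y. y \<in> Y \<Longrightarrow> site d y"
  shows "(\<Sum>y\<in>Y. indicator (cube d) (\<lambda>i. z i - emb y i)) \<le> (1 :: ennreal)"
proof (cases "\<exists>y\<in>Y. (\<lambda>i. z i - emb y i) \<in> cube d")
  case True
  then obtain y where y: "y \<in> Y" "(\<lambda>i. z i - emb y i) \<in> cube d" by blast
  have "(\<Sum>x\<in>Y. indicator (cube d) (\<lambda>i. z i - emb x i)) = (\<Sum>x\<in>Y. if x = y then 1 else (0::ennreal))"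
  proof (rule sum.cong[OF refl])
    fix x assume "x \<in> Y"
    then show "indicator (cube d) (\<lambda>i. z i - emb x i) = (if x = y then 1 else (0::ennreal))"
      using y assms(2) cube_disjoint[of d x y z] by (cases "x = y") (auto simp: indicator_def)
  qed
  then show ?thesis using assms y by simp
qed (simp add: indicator_def)

text \<open>The translates of the unit cube by sites are disjoint, so the integral of the shifted
  lattice sum over all shifts in the cube is at most the integral of \<Psi>. If every shift gave
  more than \<open>B + 1\<close>, the integral would exceed \<open>B\<close>. The spare 1 removes
  any question of attaining the mean.\<close>

lemma exists_shift_sum_le:
  fixes \<Psi> :: "(nat \<Rightarrow> real) \<Rightarrow> real"
  assumes Y: "finite Y" "\<And>y. y \<in> Y \<Longrightarrow> site d y"
    and m [measurable]: "\<Psi> \<in> borel_measurable (leb d)" and loc: "local d \<Psi>" and pos: "\<And>z. 0 \<le> \<Psi> z"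
    and int: "(\<integral>\<^sup>+z. ennreal (\<Psi> z) \<partial>leb d) \<le> ennreal B" and B: "0 \<le> B"
  shows "\<exists>\<theta>\<in>cube d. (\<Sum>y\<in>Y. \<Psi> (\<lambda>i. emb y i + \<theta> i)) \<le> B + 1"
proof (rule ccontr)
  assume "\<not> ?thesis"
  then have gt: "B + 1 \<le> (\<Sum>y\<in>Y. \<Psi> (\<lambda>i. emb y i + \<theta> i))" if "\<theta> \<in> cube d" for \<theta> using that by force
  define g where "g y z = ennreal (\<Psi> z) * indicator (cube d) (\<lambda>i. z i - emb y i)" for y z
  have gm [measurable]: "g y \<in> borel_measurable (leb d)" for y
    unfolding g_def by measurable
  have gl: "local d (g y)" for y
    using loc local_cube[of d "emb y", where 'a = ennreal] unfolding local_def g_def by metis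
  have tr: "(\<integral>\<^sup>+z. g y (\<lambda>i. emb y i + z i) \<partial>leb d) = (\<integral>\<^sup>+z. g y z \<partial>leb d)" for y
    by (rule nn_integral_translate[OF gm gl])
  have trm [measurable]: "(\<lambda>z. g y (\<lambda>i. emb y i + z i)) \<in> borel_measurable (leb d)" for y
  proof -
    have [measurable]: "(\<lambda>z. \<lambda>i\<in>{..<d}. emb y i + z i) \<in> measurable (leb d) (leb d)"
      by (rule measurable_restrict) measurable
    have "(\<lambda>z. g y (\<lambda>i\<in>{..<d}. emb y i + z i)) \<in> borel_measurable (leb d)" by measurable
    moreover have "g y (\<lambda>i\<in>{..<d}. emb y i + z i) = g y (\<lambda>i. emb y i + z i)" for z
      by (rule localD[OF gl]) auto
    ultimately show ?thesis by simp
  qed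
  have "ennreal (B + 1) = (\<integral>\<^sup>+z. ennreal (B + 1) * indicator (cube d) z \<partial>leb d)"
    using nn_integral_cube[of d] by (simp add: nn_integral_cmult)
  also have "\<dots> \<le> (\<integral>\<^sup>+z. (\<Sum>y\<in>Y. g y (\<lambda>i. emb y i + z i)) \<partial>leb d)"
  proof (rule nn_integral_mono)
    fix z :: "nat \<Rightarrow> real"
    show "ennreal (B + 1) * indicator (cube d) z \<le> (\<Sum>y\<in>Y. g y (\<lambda>i. emb y i + z i))"
    proof (cases "z \<in> cube d")
      case True
      have "ennreal (B + 1) \<le> ennreal (\<Sum>y\<in>Y. \<Psi> (\<lambda>i. emb y i + z i))"
        by (rule ennreal_leI[OF gt[OF True]])
      also have "\<dots> = (\<Sum>y\<in>Y. g y (\<lambda>i. emb y i + z i))"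
        using True pos unfolding g_def by (simp add: sum_ennreal)
      finally show ?thesis using True by simp
    qed simp
  qed
  also have "\<dots> = (\<Sum>y\<in>Y. \<integral>\<^sup>+z. g y (\<lambda>i. emb y i + z i) \<partial>leb d)"
    by (rule nn_integral_sum) measurable
  also have "\<dots> = (\<integral>\<^sup>+z. (\<Sum>y\<in>Y. g y z) \<partial>leb d)"
    unfolding tr by (rule nn_integral_sum[symmetric]) measurable
  also have "\<dots> \<le> (\<integral>\<^sup>+z. ennreal (\<Psi> z) \<partial>leb d)"
  proof (rule nn_integral_mono)
    fix z :: "nat \<Rightarrow> real"
    have "(\<Sum>y\<in>Y. g y z) = ennreal (\<Psi> z) * (\<Sum>y\<in>Y. indicator (cube d) (\<lambda>i. z i - emb y i))"
      unfolding g_def by (simp add: sum_distrib_left)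
    also have "\<dots> \<le> ennreal (\<Psi> z) * 1" by (rule mult_left_mono[OF sum_cube_le_1[OF Y]]) auto
    finally show "(\<Sum>y\<in>Y. g y z) \<le> ennreal (\<Psi> z)" by simp
  qed
  finally have "ennreal (B + 1) \<le> ennreal B" using int by (meson order_trans)
  then show False using B by (simp add: ennreal_le_iff)
qed

lemma nrm_cube:
  assumes "z \<in> cube d" "0 < d"
  shows "nrm d z < real d"
proof -
  have "nsq d z < (\<Sum>i<d. 1)"
    unfolding nsq_def using assms by (intro sum_strict_mono) (auto simp: cube_def power_strict_mono abs_square_less_1)
  also have "\<dots> \<le> (real d)\<^sup>2" using assms(2) by (simp add: power2_eq_square mult_le_cancel_left1)
  finally show ?thesis unfolding nrm_def using real_less_lsqrt[of "real d" "nsq d z"] by simp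
qed

text \<open>Each site stands for a unit cube whose points are at distance less than \<open>d\<close>
  from it. These cubes cover the ball of radius \<rho> - d and stay inside the ball of radius \<rho>
  + d.\<close>

lemma card_lball_bounds:
  assumes d: "0 < d"
  shows "real d < \<rho> \<Longrightarrow> unit_ball_vol (real d) * (\<rho> - real d) ^ d \<le> real (card (lball d \<rho>))"
    and "0 < \<rho> \<Longrightarrow> real (card (lball d \<rho>)) \<le> unit_ball_vol (real d) * (\<rho> + real d) ^ d"
proof -
  have site: "site d y" if "y \<in> lball d \<rho>" for y using that by (simp add: in_lball)
  have card: "ennreal (real (card (lball d \<rho>))) = (\<integral>\<^sup>+z. (\<Sum>y\<in>lball d \<rho>. indicator (cube d) (\<lambda>i. z i - emb y i)) \<partial>leb d)"
    by (subst nn_integral_sum) (auto simp: nn_integral_cube_shift ennreal_of_nat_eq_real_of_nat)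
  have v: "0 \<le> unit_ball_vol (real d)" by simp
  {
    assume r: "real d < \<rho>"
    have "ennreal (unit_ball_vol (real d) * (\<rho> - real d) ^ d) = (\<integral>\<^sup>+z. indicator {z. nrm d z \<le> \<rho> - real d} z \<partial>leb d)"
      by (rule nn_integral_ball[symmetric]) (use r in simp)
    also have "\<dots> \<le> ennreal (real (card (lball d \<rho>)))"
      unfolding card
    proof (rule nn_integral_mono)
      fix z :: "nat \<Rightarrow> real"
      show "indicator {z. nrm d z \<le> \<rho> - real d} z \<le> (\<Sum>y\<in>lball d \<rho>. indicator (cube d) (\<lambda>i. z i - emb y i) :: ennreal)"
      proof (cases "nrm d z \<le> \<rho> - real d")
        case True
        define y where "y = map (\<lambda>i. \<lfloor>z i\<rfloor>) [0..<d]"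
        have s: "site d y" by (simp add: y_def site_def)
        have c: "(\<lambda>i. z i - emb y i) \<in> cube d"
          by (auto simp: cube_def emb_def y_def) linarith
        have "nrm d (emb y) \<le> nrm d z + nrm d (\<lambda>i. z i - emb y i)"
          using nrm_diff_triangle[of d "emb y" "\<lambda>_. 0" z] nrm_minus[of d "emb y" z] by simp
        then have "y \<in> lball d \<rho>" using True nrm_cube[OF c d] s unfolding in_lball by linarith
        then have "indicator (cube d) (\<lambda>i. z i - emb y i) \<le> (\<Sum>y\<in>lball d \<rho>. indicator (cube d) (\<lambda>i. z i - emb y i) :: ennreal)"
          by (intro member_le_sum) (auto simp: finite_lball)
        then show ?thesis using c True by simp
      qed simp
    qed
    finally show "unit_ball_vol (real d) * (\<rho> - real d) ^ d \<le> real (card (lball d \<rho>))"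
      by (simp add: ennreal_le_iff)
  }
  {
    assume r: "0 < \<rho>"
    have "ennreal (real (card (lball d \<rho>))) \<le> (\<integral>\<^sup>+z. indicator {z. nrm d z \<le> \<rho> + real d} z \<partial>leb d)"
      unfolding card
    proof (rule nn_integral_mono)
      fix z :: "nat \<Rightarrow> real"
      show "(\<Sum>y\<in>lball d \<rho>. indicator (cube d) (\<lambda>i. z i - emb y i)) \<le> (indicator {z. nrm d z \<le> \<rho> + real d} z :: ennreal)"
      proof (cases "nrm d z \<le> \<rho> + real d")
        case True
        then show ?thesis using sum_cube_le_1[OF finite_lball site] by simp
      next
        case False
        have "(\<lambda>i. z i - emb y i) \<notin> cube d" if "y \<in> lball d \<rho>" for y
        proof
          assume "(\<lambda>i. z i - emb y i) \<in> cube d"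
          then show False
            using False nrm_cube[of "\<lambda>i. z i - emb y i" d, OF _ d] that nrm_triangle[of d "\<lambda>i. z i - emb y i" "emb y"]
            by (simp add: in_lball)
        qed
        then have "(\<Sum>y\<in>lball d \<rho>. indicator (cube d) (\<lambda>i. z i - emb y i)) = (0::ennreal)"
          by (intro sum.neutral) (auto simp: indicator_def)
        then show ?thesis by simp
      qed
    qed
    also have "\<dots> = ennreal (unit_ball_vol (real d) * (\<rho> + real d) ^ d)"
      by (rule nn_integral_ball) (use r in simp)
    finally show "real (card (lball d \<rho>)) \<le> unit_ball_vol (real d) * (\<rho> + real d) ^ d"
      using ennreal_le_iff[of "unit_ball_vol (real d) * (\<rho> + real d) ^ d" "real (card (lball d \<rho>))"] r v by simp
  }
qed

section \<open>Integrals of the Poisson kernel\<close>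

lemma nn_integral_abs_powr:
  assumes a: "1 < (a::real)"
  shows "(\<integral>\<^sup>+t. ennreal ((1 + \<bar>t\<bar>) powr (- a)) \<partial>lborel) \<le> ennreal (2 / (a - 1))"
proof -
  define f where "f t = ennreal ((1 + t) powr (- a)) * indicator {0..} t" for t :: real
  have [measurable]: "f \<in> borel_measurable borel" unfolding f_def by measurable
  have lim: "((\<lambda>t::real. (1 + t) powr (1 - a) / (1 - a)) \<longlongrightarrow> 0) at_top"
  proof -
    have "LIM t at_top. 1 + t :: real :> at_top"
      by (rule filterlim_tendsto_add_at_top[OF tendsto_const filterlim_ident])
    from tendsto_neg_powr[OF _ this, of "1 - a"] a have "((\<lambda>t::real. (1 + t) powr (1 - a)) \<longlongrightarrow> 0) at_top" by simp
    from tendsto_divide[OF this tendsto_const, of "1 - a"] a show ?thesis by simp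
  qed
  have "(\<integral>\<^sup>+t. ennreal ((1 + t) powr (- a)) * indicator {0..} t \<partial>lborel)
      = 0 - (1 + 0) powr (1 - a) / (1 - a)"
  proof (rule nn_integral_FTC_atLeast[OF _ _ _ lim])
    fix x :: real assume "0 \<le> x"
    then show "((\<lambda>t. (1 + t) powr (1 - a) / (1 - a)) has_real_derivative (1 + x) powr (- a)) (at x)"
      using a by (auto intro!: derivative_eq_intros)
  qed auto
  also have "0 - (1 + 0) powr (1 - a) / (1 - a) = 1 / (a - 1)" using a by (simp add: field_simps)
  finally have f1: "(\<integral>\<^sup>+t. f t \<partial>lborel) = ennreal (1 / (a - 1))" unfolding f_def .
  have f2: "(\<integral>\<^sup>+t. f (- t) \<partial>lborel) = ennreal (1 / (a - 1))"
    using nn_integral_real_affine[of f "-1" 0] f1 by simp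
  have "(\<integral>\<^sup>+t. ennreal ((1 + \<bar>t\<bar>) powr (- a)) \<partial>lborel) \<le> (\<integral>\<^sup>+t. f t + f (- t) \<partial>lborel)"
    by (rule nn_integral_mono) (auto simp: f_def split: split_indicator)
  also have "\<dots> = ennreal (1 / (a - 1)) + ennreal (1 / (a - 1))"
    by (subst nn_integral_add) (auto simp: f1 f2)
  also have "\<dots> = ennreal (2 / (a - 1))"
    using a by (subst ennreal_plus[symmetric]) auto
  finally show ?thesis .
qed

text \<open>The decay |w|^(-d-1) of the correction term of the test function, with the
  non-integrable part near 0 removed.\<close>

definition tail :: "nat \<Rightarrow> (nat \<Rightarrow> real) \<Rightarrow> real" where
  "tail d w = (if 1 \<le> nsq d w then nsq d w powr (- ((real d + 1) / 2)) else 0)"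

text \<open>Each factor 1 + |w_i| is at most 2 |w|, and \<open>d\<close> factors with exponent 1 +
  1/d multiply to |w|^(-d-1) up to a power of 2. Integrability thus reduces to one variable, without
  polar coordinates.\<close>

lemma tail_le_prod:
  assumes d: "0 < d"
  shows "tail d w \<le> 2 ^ (d + 1) * (\<Prod>i<d. (1 + \<bar>w i\<bar>) powr (- (1 + 1 / real d)))"
proof (cases "1 \<le> nsq d w")
  case True
  define N where "N = nrm d w"
  have N: "1 \<le> N" using True by (simp add: N_def nrm_def)
  let ?a = "1 + 1 / real d"
  have "(2 * N) powr (- ?a) \<le> (1 + \<bar>w i\<bar>) powr (- ?a)" if "i < d" for i
  proof (rule powr_mono2')
    have "0 \<le> 1 / real d" by simp
    then show "- ?a \<le> 0" by linarith
  qed (use coord_le_nrm[OF that, of w] N in \<open>auto simp: N_def\<close>)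
  then have "(\<Prod>i<d. (2 * N) powr (- ?a)) \<le> (\<Prod>i<d. (1 + \<bar>w i\<bar>) powr (- ?a))"
    by (intro prod_mono) auto
  moreover have "(\<Prod>i<d. (2 * N) powr (- ?a)) = (2 * N) powr (- (real d + 1))"
  proof -
    have "(\<Prod>i<d. (2 * N) powr (- ?a)) = (2 * N) powr (- ?a * real d)" using N by (simp add: powr_powr[symmetric] powr_realpow)
    also have "- ?a * real d = - (real d + 1)" using d by (simp add: field_simps)
    finally show ?thesis .
  qed
  moreover have "(2 * N) powr (- (real d + 1)) = 2 powr (- (real d + 1)) * N powr (- (real d + 1))"
    using N by (simp add: powr_mult)
  moreover have "N powr (- (real d + 1)) = nsq d w powr (- ((real d + 1) / 2))"
  proof -
    have e: "1/2 * (- (real d + 1)) = - ((real d + 1) / 2)" by (simp add: field_simps)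
    have "N = nsq d w powr (1/2)" using True by (simp add: N_def nrm_def powr_half_sqrt)
    then show ?thesis by (simp only: powr_powr e)
  qed
  ultimately have l: "2 powr (- (real d + 1)) * nsq d w powr (- ((real d + 1) / 2)) \<le> (\<Prod>i<d. (1 + \<bar>w i\<bar>) powr (- ?a))"
    by simp
  have c: "(2::real) ^ (d + 1) * 2 powr (- (real d + 1)) = 1"
  proof -
    have "(2::real) ^ (d + 1) = 2 powr (real d + 1)" by (simp add: powr_add powr_realpow)
    then show ?thesis unfolding powr_add[symmetric] by (simp only: powr_add[symmetric]) simp
  qed
  have "2 ^ (d + 1) * (2 powr (- (real d + 1)) * nsq d w powr (- ((real d + 1) / 2))) \<le> 2 ^ (d + 1) * (\<Prod>i<d. (1 + \<bar>w i\<bar>) powr (- ?a))"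
    by (rule mult_left_mono[OF l]) simp
  then show ?thesis using True unfolding mult.assoc[symmetric] c tail_def by simp
next
  case False
  then show ?thesis by (simp add: tail_def prod_nonneg)
qed

lemma tail_measurable [measurable]: "tail d \<in> borel_measurable (leb d)"
  unfolding tail_def by measurable

lemma local_nsq: "local d (nsq d)"
  by (auto simp: local_def intro: nsq_cong)

lemma local_tail: "local d (\<lambda>w. ennreal (tail d w))"
  using local_nsq unfolding local_def tail_def by metis

lemma nn_integral_tail:
  assumes d: "0 < d"
  shows "(\<integral>\<^sup>+z. ennreal (tail d (\<lambda>k. z k - X k)) \<partial>leb d) \<le> ennreal (2 ^ (d + 1) * (2 * real d) ^ d)"
proof -
  let ?a = "1 + 1 / real d"
  have "(\<integral>\<^sup>+z. ennreal (tail d (\<lambda>k. z k - X k)) \<partial>leb d) = (\<integral>\<^sup>+z. ennreal (tail d z) \<partial>leb d)"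
    using nn_integral_translate[OF _ local_tail, of d "\<lambda>k. - X k"] by simp
  also have "\<dots> \<le> (\<integral>\<^sup>+z. ennreal (2 ^ (d + 1)) * (\<Prod>i<d. ennreal ((1 + \<bar>z i\<bar>) powr (- ?a))) \<partial>leb d)"
  proof (rule nn_integral_mono)
    fix z :: "nat \<Rightarrow> real"
    have "ennreal (tail d z) \<le> ennreal (2 ^ (d + 1) * (\<Prod>i<d. (1 + \<bar>z i\<bar>) powr (- ?a)))"
      by (rule ennreal_leI[OF tail_le_prod[OF d]])
    also have "\<dots> = ennreal (2 ^ (d + 1)) * (\<Prod>i<d. ennreal ((1 + \<bar>z i\<bar>) powr (- ?a)))"
      by (simp add: ennreal_mult' prod_ennreal prod_nonneg)
    finally show "ennreal (tail d z) \<le> ennreal (2 ^ (d + 1)) * (\<Prod>i<d. ennreal ((1 + \<bar>z i\<bar>) powr (- ?a)))" .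
  qed
  also have "\<dots> = ennreal (2 ^ (d + 1)) * (\<integral>\<^sup>+z. (\<Prod>i<d. ennreal ((1 + \<bar>z i\<bar>) powr (- ?a))) \<partial>leb d)"
    by (rule nn_integral_cmult) measurable
  also have "(\<integral>\<^sup>+z. (\<Prod>i<d. ennreal ((1 + \<bar>z i\<bar>) powr (- ?a))) \<partial>leb d)
      = (\<Prod>i<d. \<integral>\<^sup>+t. ennreal ((1 + \<bar>t\<bar>) powr (- ?a)) \<partial>lborel)"
    by (rule lebp.product_nn_integral_prod) auto
  also have "\<dots> \<le> ennreal ((2 * real d) ^ d)"
  proof -
    have J: "(\<integral>\<^sup>+t. ennreal ((1 + \<bar>t\<bar>) powr (- ?a)) \<partial>lborel) \<le> ennreal (2 * real d)"
      using nn_integral_abs_powr[of ?a] d by simp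
    then obtain j where j: "(\<integral>\<^sup>+t. ennreal ((1 + \<bar>t\<bar>) powr (- ?a)) \<partial>lborel) = ennreal j" "0 \<le> j"
      by (cases "\<integral>\<^sup>+t. ennreal ((1 + \<bar>t\<bar>) powr (- ?a)) \<partial>lborel") (auto simp: top_unique)
    then have "j \<le> 2 * real d" using J by (simp add: ennreal_le_iff)
    then show ?thesis using power_mono[of j "2 * real d" d] j by (simp add: ennreal_power ennreal_leI)
  qed
  finally show ?thesis by (simp add: ennreal_mult' mult_left_mono)
qed


section \<open>Mean value property of the Poisson kernel over solid balls\<close>

lemma integral_zero_of_slices:
  fixes f :: "(nat \<Rightarrow> real) \<Rightarrow> real"
  assumes i: "i < d" and f: "integrable (leb d) f"
    and z: "\<And>y. (\<integral>t. f (y(i := t)) \<partial>lborel) = 0"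
  shows "(\<integral>y. f y \<partial>leb d) = 0"
proof -
  have e: "{..<d} = insert i ({..<d} - {i})" using i by auto
  have "(\<integral>y. f y \<partial>leb d) = (\<integral>y. f y \<partial>Pi\<^sub>M (insert i ({..<d} - {i})) (\<lambda>_. lborel))"
    using e by simp
  also have "\<dots> = (\<integral>y. (\<integral>t. f (y(i := t)) \<partial>lborel) \<partial>Pi\<^sub>M ({..<d} - {i}) (\<lambda>_. lborel))"
    by (rule lebp.product_integral_insert) (use f e in auto)
  finally show ?thesis by (simp add: z)
qed

text \<open>In the coordinate \<open>w = z - X\<close> around the pole \<open>X\<close>, the Poisson kernel
  \<open>(|X|\<^sup>2 - |z|\<^sup>2) / |w|^d\<close> equals \<open>- 2 X \<bullet> w |w|^(-d) - |w|^(2-d)\<close>.\<close>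

definition pois :: "nat \<Rightarrow> (nat \<Rightarrow> real) \<Rightarrow> (nat \<Rightarrow> real) \<Rightarrow> real" where
  "pois d X w = - 2 * dot d X w * nsq d w powr (- (real d / 2)) - nsq d w powr (1 - real d / 2)"

text \<open>Closed forms of the partial derivatives of \<open>pois d X\<close> in coordinate
  \<open>i\<close>: \<open>poisD\<close> is the first and \<open>poisDD\<close> the second.\<close>

definition poisD :: "nat \<Rightarrow> (nat \<Rightarrow> real) \<Rightarrow> nat \<Rightarrow> (nat \<Rightarrow> real) \<Rightarrow> real" where
  "poisD d X i w = - 2 * X i * nsq d w powr (- (real d / 2))
    + 2 * real d * dot d X w * w i * nsq d w powr (- (real d / 2) - 1)
    + (real d - 2) * w i * nsq d w powr (- (real d / 2))"

definition poisDD :: "nat \<Rightarrow> (nat \<Rightarrow> real) \<Rightarrow> nat \<Rightarrow> (nat \<Rightarrow> real) \<Rightarrow> real" where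
  "poisDD d X i w = 4 * real d * X i * w i * nsq d w powr (- (real d / 2) - 1)
    + 2 * real d * dot d X w * nsq d w powr (- (real d / 2) - 1)
    - 2 * real d * (real d + 2) * dot d X w * (w i)\<^sup>2 * nsq d w powr (- (real d / 2) - 2)
    + (real d - 2) * nsq d w powr (- (real d / 2))
    - (real d - 2) * real d * (w i)\<^sup>2 * nsq d w powr (- (real d / 2) - 1)"

lemma powr_shift: "0 < q \<Longrightarrow> q * q powr (e - 1) = (q::real) powr e"
  using powr_add[of q 1 "e - 1"] by simp

text \<open>Harmonicity of the Poisson kernel away from its pole.\<close>

lemma poisDD_sum_zero:
  assumes "0 < nsq d w"
  shows "(\<Sum>i<d. poisDD d X i w) = 0"
proof -
  let ?q = "nsq d w" and ?e = "- (real d / 2)"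
  have s: "?q * ?q powr (?e - 1) = ?q powr ?e" "?q * ?q powr (?e - 2) = ?q powr (?e - 1)"
  proof -
    have two: "?e - 1 - 1 = ?e - 2" by simp
    show "?q * ?q powr (?e - 1) = ?q powr ?e" by (rule powr_shift[OF assms])
    show "?q * ?q powr (?e - 2) = ?q powr (?e - 1)" using powr_shift[OF assms, of "?e - 1"] unfolding two .
  qed
  have "(\<Sum>i<d. poisDD d X i w) = 4 * real d * dot d X w * ?q powr (?e - 1)
    + 2 * real d * real d * dot d X w * ?q powr (?e - 1)
    - 2 * real d * (real d + 2) * dot d X w * (?q * ?q powr (?e - 2))
    + real d * (real d - 2) * ?q powr ?e - (real d - 2) * real d * (?q * ?q powr (?e - 1))"
    unfolding poisDD_def
    by (simp add: sum.distrib sum_subtractf dot_def[of d X w] nsq_def[of d w]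
        sum_distrib_left[symmetric] sum_distrib_right[symmetric] mult.assoc)
      (simp add: sum_distrib_left sum_distrib_right mult_ac)
  also have "\<dots> = 0" unfolding s by (simp add: algebra_simps)
  finally show ?thesis .
qed


text \<open>Closed under sums and products, so that integrability of the long expressions in
  \<open>poisD\<close> and \<open>poisDD\<close> follows from their syntax.\<close>

definition bdd_on :: "'a set \<Rightarrow> ('a \<Rightarrow> real) \<Rightarrow> bool" where
  "bdd_on S f \<longleftrightarrow> (\<exists>B. \<forall>x\<in>S. \<bar>f x\<bar> \<le> B)"

lemma bdd_on_const: "bdd_on S (\<lambda>_. c)"
  by (auto simp: bdd_on_def)

lemma bdd_on_add: "bdd_on S f \<Longrightarrow> bdd_on S g \<Longrightarrow> bdd_on S (\<lambda>x. f x + g x)"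
proof -
  assume "bdd_on S f" "bdd_on S g"
  then obtain A B where "\<forall>x\<in>S. \<bar>f x\<bar> \<le> A" "\<forall>x\<in>S. \<bar>g x\<bar> \<le> B" by (auto simp: bdd_on_def)
  then have "\<forall>x\<in>S. \<bar>f x + g x\<bar> \<le> A + B" by force
  then show ?thesis by (auto simp: bdd_on_def)
qed

lemma bdd_on_mult: "bdd_on S f \<Longrightarrow> bdd_on S g \<Longrightarrow> bdd_on S (\<lambda>x. f x * g x)"
proof -
  assume "bdd_on S f" "bdd_on S g"
  then obtain A B where "\<forall>x\<in>S. \<bar>f x\<bar> \<le> A" "\<forall>x\<in>S. \<bar>g x\<bar> \<le> B" by (auto simp: bdd_on_def)
  then have "\<forall>x\<in>S. \<bar>f x * g x\<bar> \<le> A * B" unfolding abs_mult by (auto intro!: mult_mono order_trans[OF abs_ge_zero])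
  then show ?thesis by (auto simp: bdd_on_def)
qed

lemma bdd_on_diff: "bdd_on S f \<Longrightarrow> bdd_on S g \<Longrightarrow> bdd_on S (\<lambda>x. f x - g x)"
  using bdd_on_add[of S f "\<lambda>x. - 1 * g x"] bdd_on_mult[OF bdd_on_const[of S "-1"], of g] by simp

lemma bdd_on_sum: "(\<And>i. i \<in> I \<Longrightarrow> bdd_on S (f i)) \<Longrightarrow> bdd_on S (\<lambda>x. \<Sum>i\<in>I. f i x)"
  by (induction I rule: infinite_finite_induct) (auto intro: bdd_on_const bdd_on_add)

context
  fixes d :: nat and X :: "nat \<Rightarrow> real" and \<sigma> \<rho> :: real
  assumes rho: "nrm d X = \<rho>" and sig: "0 < \<sigma>" "\<sigma> < \<rho>"
begin

abbreviation dom :: "(real \<times> (nat \<Rightarrow> real)) set" where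
  "dom \<equiv> {p. 0 \<le> fst p \<and> fst p \<le> 1 \<and> nrm d (snd p) \<le> \<sigma>}"

text \<open>The point \<open>s * y\<close> on the ray from the origin, seen from the pole. For
  \<open>(s, y)\<close> in \<open>dom\<close> its distance from the pole is at least \<rho> -
  \<sigma>.\<close>

abbreviation pt :: "real \<Rightarrow> (nat \<Rightarrow> real) \<Rightarrow> nat \<Rightarrow> real" where
  "pt s y \<equiv> (\<lambda>k. s * y k - X k)"

lemma nrm_scale: "0 \<le> s \<Longrightarrow> nrm d (\<lambda>k. s * y k) = s * nrm d y"
  unfolding nrm_L2 by (rule L2_set_right_distrib[symmetric])

lemma nrm_pt:
  assumes "(s, y) \<in> dom"
  shows "\<rho> - \<sigma> \<le> nrm d (pt s y)" "nrm d (pt s y) \<le> 2 * \<rho>"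
proof -
  have "s * nrm d y \<le> 1 * \<sigma>" by (rule mult_mono) (use assms in auto)
  then have a: "nrm d (\<lambda>k. s * y k) \<le> \<sigma>" using assms nrm_scale[of s y] by simp
  have "nrm d (\<lambda>k. X k - 0) \<le> nrm d (\<lambda>k. X k - s * y k) + nrm d (\<lambda>k. s * y k - 0)"
    by (rule nrm_diff_triangle)
  then show "\<rho> - \<sigma> \<le> nrm d (pt s y)" using a rho nrm_minus[of d X "\<lambda>k. s * y k"] by simp
  have "nrm d (\<lambda>k. s * y k - X k) \<le> nrm d (\<lambda>k. s * y k - 0) + nrm d (\<lambda>k. 0 - X k)"
    by (rule nrm_diff_triangle)
  then show "nrm d (pt s y) \<le> 2 * \<rho>" using a rho sig nrm_minus[of d X "\<lambda>_. 0"] by simp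
qed

lemma nsq_pt: "(s, y) \<in> dom \<Longrightarrow> (\<rho> - \<sigma>)\<^sup>2 \<le> nsq d (pt s y)"
  unfolding nrm_power2[symmetric] by (rule power_mono[OF nrm_pt(1)]) (use sig in auto)

lemma nsq_pt_pos: "(s, y) \<in> dom \<Longrightarrow> 0 < nsq d (pt s y)"
  using nsq_pt[of s y] sig by (smt (verit) zero_less_power)

lemma bdd_powr: "0 \<le> e \<Longrightarrow> bdd_on dom (\<lambda>p. nsq d (pt (fst p) (snd p)) powr (- e))"
proof -
  assume e: "0 \<le> e"
  have "nsq d (pt (fst p) (snd p)) powr (- e) \<le> ((\<rho> - \<sigma>)\<^sup>2) powr (- e)" if "p \<in> dom" for p
    by (rule powr_mono2') (use e sig nsq_pt[of "fst p" "snd p"] that in auto)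
  then show ?thesis unfolding bdd_on_def by (intro exI[of _ "((\<rho> - \<sigma>)\<^sup>2) powr (- e)"]) auto
qed

lemma bdd_coord: "i < d \<Longrightarrow> bdd_on dom (\<lambda>p. fst p * snd p i - X i)"
  unfolding bdd_on_def
proof (intro exI[of _ "2 * \<rho>"] ballI)
  fix p assume "i < d" "p \<in> dom"
  then show "\<bar>fst p * snd p i - X i\<bar> \<le> 2 * \<rho>"
    using coord_le_nrm[of i d "pt (fst p) (snd p)"] nrm_pt(2)[of "fst p" "snd p"] by simp
qed

lemma bdd_y: "i < d \<Longrightarrow> bdd_on dom (\<lambda>p. snd p i)"
  unfolding bdd_on_def
proof (intro exI[of _ \<sigma>] ballI)
  fix p assume "i < d" "p \<in> dom"
  then show "\<bar>snd p i\<bar> \<le> \<sigma>" using coord_le_nrm[of i d "snd p"] by simp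
qed

lemma bdd_dot: "bdd_on dom (\<lambda>p. dot d X (pt (fst p) (snd p)))"
  unfolding dot_def by (intro bdd_on_sum bdd_on_mult bdd_on_const bdd_coord) simp

lemma bdd_powr': "bdd_on dom (\<lambda>p. nsq d (pt (fst p) (snd p)) powr (- (real d / 2)))"
    "bdd_on dom (\<lambda>p. nsq d (pt (fst p) (snd p)) powr (- (real d / 2) - 1))"
    "bdd_on dom (\<lambda>p. nsq d (pt (fst p) (snd p)) powr (- (real d / 2) - 2))"
  using bdd_powr[of "real d / 2"] bdd_powr[of "real d / 2 + 1"] bdd_powr[of "real d / 2 + 2"] by simp_all

lemma bdd_poisD: "i < d \<Longrightarrow> bdd_on dom (\<lambda>p. poisD d X i (pt (fst p) (snd p)))"
  unfolding poisD_def
  by (rule bdd_on_const bdd_powr' bdd_dot bdd_coord bdd_on_add bdd_on_diff bdd_on_mult | assumption)+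

lemma bdd_poisDD: "i < d \<Longrightarrow> bdd_on dom (\<lambda>p. poisDD d X i (pt (fst p) (snd p)))"
  unfolding poisDD_def power2_eq_square
  by (rule bdd_on_const bdd_powr' bdd_dot bdd_coord bdd_on_add bdd_on_diff bdd_on_mult | assumption)+

lemma pt_measurable [measurable]:
  "(\<lambda>y. nsq d (pt s y)) \<in> borel_measurable (leb d)"
  "(\<lambda>y. dot d X (pt s y)) \<in> borel_measurable (leb d)"
  unfolding nsq_def dot_def by measurable

lemma poisD_measurable [measurable]:
  "i < d \<Longrightarrow> (\<lambda>y. poisD d X i (pt s y)) \<in> borel_measurable (leb d)"
  unfolding poisD_def by measurable

lemma poisDD_measurable [measurable]:
  "i < d \<Longrightarrow> (\<lambda>y. poisDD d X i (pt s y)) \<in> borel_measurable (leb d)"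
  unfolding poisDD_def by measurable

lemma DERIV_pt:
  assumes i: "i < d" and pos: "0 < nsq d (pt s (y(i := t)))"
  shows "((\<lambda>t. poisD d X i (pt s (y(i := t)))) has_real_derivative s * poisDD d X i (pt s (y(i := t)))) (at t)"
    "isCont (\<lambda>t. poisDD d X i (pt s (y(i := t)))) t"
proof -
  define q where "q t = nsq d (pt s (y(i := t)))" for t
  define b where "b t = dot d X (pt s (y(i := t)))" for t
  have pe: "pt s (y(i := t)) = (pt s y)(i := s * t - X i)" for t by (auto simp: fun_eq_iff)
  have qe: "q t = nsq d (pt s y) - (pt s y i)\<^sup>2 + (s * t - X i)\<^sup>2" for t
    unfolding q_def pe nsq_upd[OF i] ..
  have be: "b t = dot d X (pt s y) + X i * ((s * t - X i) - pt s y i)" for t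
    unfolding b_def pe dot_upd[OF i] ..
  have dq: "(q has_real_derivative 2 * (s * t - X i) * s) (at t)" for t
    unfolding qe[abs_def] by (auto intro!: derivative_eq_intros)
  have db: "(b has_real_derivative X i * s) (at t)" for t
    unfolding be[abs_def] by (auto intro!: derivative_eq_intros)
  have q0: "0 < q t" using pos by (simp add: q_def)
  have dp: "((\<lambda>t. q t powr e) has_real_derivative e * q t powr (e - 1) * (2 * (s * t - X i) * s)) (at t)" for e
    using DERIV_chain2[OF has_real_derivative_powr[OF q0, of e] dq] .
  have D: "poisD d X i (pt s (y(i := t))) = - 2 * X i * q t powr (- (real d / 2))
    + 2 * real d * b t * (s * t - X i) * q t powr (- (real d / 2) - 1)
    + (real d - 2) * (s * t - X i) * q t powr (- (real d / 2))" for t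
    unfolding poisD_def q_def b_def by simp
  have DD: "poisDD d X i (pt s (y(i := t))) = 4 * real d * X i * (s * t - X i) * q t powr (- (real d / 2) - 1)
    + 2 * real d * b t * q t powr (- (real d / 2) - 1)
    - 2 * real d * (real d + 2) * b t * (s * t - X i)\<^sup>2 * q t powr (- (real d / 2) - 2)
    + (real d - 2) * q t powr (- (real d / 2))
    - (real d - 2) * real d * (s * t - X i)\<^sup>2 * q t powr (- (real d / 2) - 1)" for t
    unfolding poisDD_def q_def b_def by simp
  have two: "- (real d / 2) - 1 - 1 = - (real d / 2) - 2" by simp
  show "((\<lambda>t. poisD d X i (pt s (y(i := t)))) has_real_derivative s * poisDD d X i (pt s (y(i := t)))) (at t)"
    unfolding D DD
    by (rule dp db derivative_eq_intros refl)+ (simp add: two, simp add: field_simps power2_eq_square)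
  show "isCont (\<lambda>t. poisDD d X i (pt s (y(i := t)))) t"
    unfolding DD using DERIV_isCont[OF dq[of t]] DERIV_isCont[OF db[of t]] q0
    by (intro continuous_intros) auto
qed

text \<open>With P(z) = \<open>pois d X\<close> at z - X, the integrand is the derivative in
  coordinate \<open>i\<close> of (|y|^2 - \<sigma>^2)/2 times the partial derivative of P at
  \<open>s * y\<close>. The first factor vanishes on the sphere, so the divergence theorem needs no
  surface measure.\<close>

lemma integral_divergence_zero:
  assumes s: "0 \<le> s" "s \<le> 1" and i: "i < d"
  defines "f \<equiv> \<lambda>y. indicator {y. nrm d y \<le> \<sigma>} y *
      (y i * poisD d X i (pt s y) + (nsq d y - \<sigma>\<^sup>2) / 2 * (s * poisDD d X i (pt s y)))"
  shows "integrable (leb d) f" "(\<integral>y. f y \<partial>leb d) = 0"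
proof -
  have n: "bdd_on dom (\<lambda>p. nsq d (snd p))" unfolding bdd_on_def
    by (intro exI[of _ "\<sigma>\<^sup>2"]) (auto simp: nrm_power2[symmetric] power_mono)
  have ss: "bdd_on dom fst" unfolding bdd_on_def by (intro exI[of _ 1]) auto
  have "bdd_on dom (\<lambda>p. snd p i * poisD d X i (pt (fst p) (snd p))
      + (nsq d (snd p) - \<sigma>\<^sup>2) * inverse 2 * (fst p * poisDD d X i (pt (fst p) (snd p))))"
    by (rule bdd_on_const n ss bdd_y[OF i] bdd_poisD[OF i] bdd_poisDD[OF i] bdd_on_add bdd_on_diff bdd_on_mult)+
  then obtain B where B: "\<And>p. p \<in> dom \<Longrightarrow> \<bar>snd p i * poisD d X i (pt (fst p) (snd p))
      + (nsq d (snd p) - \<sigma>\<^sup>2) / 2 * (fst p * poisDD d X i (pt (fst p) (snd p)))\<bar> \<le> B"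
    unfolding bdd_on_def divide_inverse by blast
  show int: "integrable (leb d) f"
  proof (rule integrableI_bounded_set[where A = "{y \<in> space (leb d). nrm d y \<le> \<sigma>}" and B = B])
    show "f \<in> borel_measurable (leb d)" unfolding f_def using i by measurable
    show "emeasure (leb d) {y \<in> space (leb d). nrm d y \<le> \<sigma>} < \<infinity>" using emeasure_ball[OF sig(1), of d] by simp
    show "AE y in leb d. y \<in> {y \<in> space (leb d). nrm d y \<le> \<sigma>} \<longrightarrow> norm (f y) \<le> B"
      using B[of "(s, _)"] s by (intro always_eventually) (auto simp: f_def)
    show "AE y in leb d. y \<notin> {y \<in> space (leb d). nrm d y \<le> \<sigma>} \<longrightarrow> f y = 0"
      by (rule AE_I2) (auto simp: f_def)
  qed measurable
  show "(\<integral>y. f y \<partial>leb d) = 0"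
  proof (rule integral_zero_of_slices[OF i int])
    fix y
    define r where "r = nsq d y - (y i)\<^sup>2"
    have nu: "nsq d (y(i := t)) = r + t\<^sup>2" for t by (simp add: r_def nsq_upd[OF i])
    have nr: "nrm d (y(i := t)) \<le> \<sigma> \<longleftrightarrow> r + t\<^sup>2 \<le> \<sigma>\<^sup>2" for t
      unfolding nu[symmetric] nrm_power2[symmetric] using sig by (simp add: abs_le_square_iff[symmetric])
    \<comment> \<open>Antiderivative along the chord of the ball in direction \<open>i\<close>; its
      first factor is zero at both ends \<open>a\<close> and \<open>- a\<close>.\<close>
    define F where "F t = (r + t\<^sup>2 - \<sigma>\<^sup>2) / 2 * poisD d X i (pt s (y(i := t)))" for t
    define F' where "F' t = t * poisD d X i (pt s (y(i := t))) + (r + t\<^sup>2 - \<sigma>\<^sup>2) / 2 * (s * poisDD d X i (pt s (y(i := t))))" for t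
    have fe: "f (y(i := t)) = F' t * indicator {t. r + t\<^sup>2 \<le> \<sigma>\<^sup>2} t" for t
      unfolding f_def F'_def by (simp add: nr nu indicator_def)
    show "(\<integral>t. f (y(i := t)) \<partial>lborel) = 0"
    proof (cases "r \<le> \<sigma>\<^sup>2")
      case False
      have "\<not> r + t\<^sup>2 \<le> \<sigma>\<^sup>2" for t using False zero_le_power2[of t] by linarith
      then have "{t. r + t\<^sup>2 \<le> \<sigma>\<^sup>2} = {}" by blast
      then show ?thesis unfolding fe by simp
    next
      case True
      define a where "a = sqrt (\<sigma>\<^sup>2 - r)"
      have a: "0 \<le> a" "a\<^sup>2 = \<sigma>\<^sup>2 - r" using True by (auto simp: a_def)
      have set: "r + t\<^sup>2 \<le> \<sigma>\<^sup>2 \<longleftrightarrow> - a \<le> t \<and> t \<le> a" for t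
      proof -
        have "r + t\<^sup>2 \<le> \<sigma>\<^sup>2 \<longleftrightarrow> t\<^sup>2 \<le> a\<^sup>2" using a by auto
        also have "\<dots> \<longleftrightarrow> \<bar>t\<bar> \<le> a" using a(1) by (simp add: abs_le_square_iff[symmetric])
        finally show ?thesis unfolding abs_le_iff by linarith
      qed
      have seteq: "{t. r + t\<^sup>2 \<le> \<sigma>\<^sup>2} = {- a..a}"
        unfolding set atLeastAtMost_def atLeast_def atMost_def by blast
      have pos: "0 < nsq d (pt s (y(i := t)))" if "- a \<le> t" "t \<le> a" for t
      proof (rule nsq_pt_pos)
        have "nrm d (y(i := t)) \<le> \<sigma>" using that nr set by blast
        then show "(s, y(i := t)) \<in> dom" using s by simp
      qed
      have "(\<integral>t. F' t * indicator {- a..a} t \<partial>lborel) = F a - F (- a)"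
      proof (rule integral_FTC_Icc_real)
        show "- a \<le> a" using a by simp
        fix t assume t: "- a \<le> t" "t \<le> a"
        show "(F has_real_derivative F' t) (at t)"
        proof -
          have "((\<lambda>t. (r + t\<^sup>2 - \<sigma>\<^sup>2) / 2) has_real_derivative t) (at t)"
            by (auto intro!: derivative_eq_intros)
          from DERIV_mult[OF this DERIV_pt(1)[OF i pos[OF t]]] show ?thesis
            unfolding F_def F'_def by (simp add: mult.commute)
        qed
        show "isCont F' t"
          unfolding F'_def using DERIV_isCont[OF DERIV_pt(1)[OF i pos[OF t]]] DERIV_pt(2)[OF i pos[OF t]]
          by (intro continuous_intros) auto
      qed
      also have "\<dots> = 0" using a by (simp add: F_def)
      finally show ?thesis unfolding fe seteq .
    qed
  qed
qed

text \<open>Summed over \<open>i\<close>, the second-derivative part of the divergence identity is a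
  Laplacian and drops out by harmonicity. What is left says that the integral of P(s y) over the
  ball has zero derivative in \<open>s\<close>.\<close>

lemma integral_radial_zero:
  assumes s: "0 \<le> s" "s \<le> 1"
  shows "(\<integral>y. indicator {y. nrm d y \<le> \<sigma>} y * (\<Sum>i<d. y i * poisD d X i (pt s y)) \<partial>leb d) = 0"
proof -
  let ?I = "\<lambda>y. indicator {y. nrm d y \<le> \<sigma>} y :: real"
  let ?f = "\<lambda>i y. ?I y * (y i * poisD d X i (pt s y) + (nsq d y - \<sigma>\<^sup>2) / 2 * (s * poisDD d X i (pt s y)))"
  have "?I y * (\<Sum>i<d. y i * poisD d X i (pt s y)) = (\<Sum>i<d. ?f i y)" for y
  proof (cases "nrm d y \<le> \<sigma>")
    case True
    then have "(\<Sum>i<d. poisDD d X i (pt s y)) = 0" using poisDD_sum_zero nsq_pt_pos[of s y] s by auto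
    moreover have "(\<Sum>i<d. (nsq d y - \<sigma>\<^sup>2) / 2 * (s * poisDD d X i (pt s y)))
        = (nsq d y - \<sigma>\<^sup>2) / 2 * s * (\<Sum>i<d. poisDD d X i (pt s y))"
      by (simp add: sum_distrib_left mult.assoc)
    ultimately show ?thesis using True by (simp add: sum.distrib)
  qed simp
  then have "(\<integral>y. ?I y * (\<Sum>i<d. y i * poisD d X i (pt s y)) \<partial>leb d) = (\<integral>y. (\<Sum>i<d. ?f i y) \<partial>leb d)" by simp
  also have "\<dots> = (\<Sum>i<d. \<integral>y. ?f i y \<partial>leb d)"
    by (rule Bochner_Integration.integral_sum) (use integral_divergence_zero(1)[OF s] in auto)
  also have "\<dots> = 0" using integral_divergence_zero(2)[OF s] by simp
  finally show ?thesis .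
qed

lemma DERIV_pois_ray:
  assumes pos: "0 < nsq d (pt s y)"
  shows "((\<lambda>s. pois d X (pt s y)) has_real_derivative (\<Sum>i<d. y i * poisD d X i (pt s y))) (at s)"
proof -
  define q where "q s = nsq d (pt s y)" for s
  define b where "b s = dot d X (pt s y)" for s
  define q' where "q' = (\<Sum>i<d. 2 * (pt s y i * y i))"
  define b' where "b' = (\<Sum>i<d. X i * y i)"
  have dq: "(q has_real_derivative q') (at s)"
    unfolding q_def[abs_def] nsq_def q'_def
    by (auto intro!: derivative_eq_intros sum.cong)
  have db: "(b has_real_derivative b') (at s)"
    unfolding b_def[abs_def] dot_def b'_def by (auto intro!: derivative_eq_intros sum.cong)
  have q0: "0 < q s" using pos by (simp add: q_def)
  have dp: "((\<lambda>t. q t powr e) has_real_derivative e * q s powr (e - 1) * q') (at s)" for e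
    using DERIV_chain2[OF has_real_derivative_powr[OF q0, of e] dq] .
  have one: "1 - real d / 2 - 1 = - (real d / 2)" by simp
  have "((\<lambda>s. - 2 * b s * q s powr (- (real d / 2)) - q s powr (1 - real d / 2)) has_real_derivative
      - 2 * b' * q s powr (- (real d / 2)) + real d * b s * q' * q s powr (- (real d / 2) - 1)
      + (real d - 2) / 2 * q' * q s powr (- (real d / 2))) (at s)"
    by (rule dp db derivative_eq_intros refl)+ (simp add: one, simp add: field_simps)
  also have "- 2 * b' * q s powr (- (real d / 2)) + real d * b s * q' * q s powr (- (real d / 2) - 1)
      + (real d - 2) / 2 * q' * q s powr (- (real d / 2)) = (\<Sum>i<d. y i * poisD d X i (pt s y))"
    unfolding poisD_def b'_def q'_def q_def[symmetric] b_def[symmetric]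
    unfolding sum_distrib_left sum_distrib_right sum.distrib[symmetric]
    by (rule sum.cong) (simp_all add: field_simps)
  finally show ?thesis unfolding pois_def q_def b_def .
qed

lemma pois_origin: "pois d X (pt 0 y) = \<rho> powr (2 - real d)"
proof -
  have r: "0 < \<rho>" using sig by simp
  have n: "nsq d (pt 0 y) = \<rho> powr 2"
  proof -
    have "nsq d (pt 0 y) = nsq d X" by (simp add: nsq_def)
    then show ?thesis using r nrm_power2[of d X] rho by (simp add: powr_numeral)
  qed
  have dt: "dot d X (pt 0 y) = - (\<rho> powr 2)"
  proof -
    have "dot d X (pt 0 y) = - nsq d X" by (simp add: dot_def nsq_def sum_negf power2_eq_square)
    then show ?thesis using r nrm_power2[of d X] rho by (simp add: powr_numeral)
  qed
  have "pois d X (pt 0 y) = 2 * (\<rho> powr 2 * \<rho> powr (2 * (- (real d / 2)))) - \<rho> powr (2 * (1 - real d / 2))"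
    unfolding pois_def n dt powr_powr by simp
  also have "\<rho> powr 2 * \<rho> powr (2 * (- (real d / 2))) = \<rho> powr (2 - real d)"
    unfolding powr_add[symmetric] by simp
  also have "2 * (1 - real d / 2) = 2 - real d" by simp
  finally show ?thesis by simp
qed

lemma pair_measurable:
  "(\<lambda>p. nsq d (pt (snd p) (fst p))) \<in> borel_measurable (leb d \<Otimes>\<^sub>M lborel)"
  "(\<lambda>p. dot d X (pt (snd p) (fst p))) \<in> borel_measurable (leb d \<Otimes>\<^sub>M lborel)"
  unfolding nsq_def dot_def by measurable

text \<open>The radial derivative is integrated over \<open>s\<close> from 0 to 1 and over the ball;
  Fubini and \<open>integral_radial_zero\<close> make the result zero. Hence the integral of the
  kernel is the volume times its value at the centre.\<close>

lemma mean_value_ball: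
  shows "integrable (leb d) (\<lambda>y. indicator {y. nrm d y \<le> \<sigma>} y * pois d X (pt 1 y))"
    "(\<integral>y. indicator {y. nrm d y \<le> \<sigma>} y * pois d X (pt 1 y) \<partial>leb d)
      = unit_ball_vol (real d) * \<sigma> ^ d * \<rho> powr (2 - real d)"
proof -
  let ?I = "\<lambda>y. indicator {y. nrm d y \<le> \<sigma>} y :: real"
  define R where "R s y = (\<Sum>i<d. y i * poisD d X i (pt s y))" for s y
  define h where "h y s = ?I y * (indicator {0..1} s * R s y)" for y s
  interpret pair_sigma_finite "leb d" "lborel :: real measure"
    by (simp add: pair_sigma_finite_def sigma_finite_leb lborel.sigma_finite_measure_axioms)
  note pair_measurable[measurable]
  have hm: "case_prod h \<in> borel_measurable (leb d \<Otimes>\<^sub>M lborel)"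
    unfolding h_def R_def poisD_def case_prod_beta by measurable
  have "bdd_on dom (\<lambda>p. \<Sum>i<d. snd p i * poisD d X i (pt (fst p) (snd p)))"
    by (intro bdd_on_sum bdd_on_mult bdd_y bdd_poisD) auto
  then obtain B where B: "\<And>p. p \<in> dom \<Longrightarrow> \<bar>R (fst p) (snd p)\<bar> \<le> B"
    unfolding bdd_on_def R_def by blast
  have hint: "integrable (leb d \<Otimes>\<^sub>M lborel) (case_prod h)"
  proof (rule integrableI_bounded_set[where A = "{y \<in> space (leb d). nrm d y \<le> \<sigma>} \<times> {0..1::real}" and B = B])
    show "emeasure (leb d \<Otimes>\<^sub>M lborel) ({y \<in> space (leb d). nrm d y \<le> \<sigma>} \<times> {0..1::real}) < \<infinity>"
      by (subst lborel.emeasure_pair_measure_Times) (use emeasure_ball[OF sig(1), of d] in \<open>auto simp: ennreal_mult_less_top\<close>)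
    show "AE p in leb d \<Otimes>\<^sub>M lborel. p \<in> {y \<in> space (leb d). nrm d y \<le> \<sigma>} \<times> {0..1::real} \<longrightarrow> norm (case_prod h p) \<le> B"
      using B[of "(_, _)"] by (intro always_eventually) (auto simp: h_def)
    show "AE p in leb d \<Otimes>\<^sub>M lborel. p \<notin> {y \<in> space (leb d). nrm d y \<le> \<sigma>} \<times> {0..1::real} \<longrightarrow> case_prod h p = 0"
      by (rule AE_I2) (auto simp: h_def space_pair_measure indicator_def)
  qed (use hm in measurable)
  have ray: "(\<integral>s. h y s \<partial>lborel) = ?I y * pois d X (pt 1 y) - ?I y * \<rho> powr (2 - real d)" for y
  proof (cases "nrm d y \<le> \<sigma>")
    case True
    have pos: "0 < nsq d (pt s y)" if "0 \<le> s" "s \<le> 1" for s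
      by (rule nsq_pt_pos) (use that True in simp)
    have "(\<integral>s. R s y * indicator {0..1} s \<partial>lborel) = pois d X (pt 1 y) - pois d X (pt 0 y)"
    proof (rule integral_FTC_Icc_real)
      fix s :: real assume s: "0 \<le> s" "s \<le> 1"
      show "((\<lambda>s. pois d X (pt s y)) has_real_derivative R s y) (at s)"
        unfolding R_def by (rule DERIV_pois_ray[OF pos[OF s]])
      show "isCont (\<lambda>s. R s y) s"
      proof -
        have cont: "isCont (\<lambda>s. nsq d (pt s y)) s" "isCont (\<lambda>s. dot d X (pt s y)) s"
          unfolding nsq_def dot_def by (intro continuous_intros)+
        show ?thesis unfolding R_def poisD_def
          by (intro continuous_intros cont) (use pos[OF s] in auto)
      qed
    qed simp
    then show ?thesis using True unfolding h_def pois_origin by (simp add: mult.commute)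
  qed (simp add: h_def)
  have "(\<integral>s. (\<integral>y. h y s \<partial>leb d) \<partial>lborel) = (\<integral>y. (\<integral>s. h y s \<partial>lborel) \<partial>leb d)"
    by (rule Fubini_integral[OF hint])
  moreover have "(\<integral>y. h y s \<partial>leb d) = 0" for s
  proof (cases "0 \<le> s \<and> s \<le> 1")
    case True
    then have "h y s = ?I y * (\<Sum>i<d. y i * poisD d X i (pt s y))" for y by (simp add: h_def R_def)
    then show ?thesis using integral_radial_zero[of s] True by simp
  qed (simp add: h_def)
  ultimately have z: "(\<integral>y. ?I y * pois d X (pt 1 y) - ?I y * \<rho> powr (2 - real d) \<partial>leb d) = 0"
    unfolding ray by simp
  have i1: "integrable (leb d) (\<lambda>y. ?I y * pois d X (pt 1 y) - ?I y * \<rho> powr (2 - real d))"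
    using integrable_fst'[OF hint] unfolding ray[symmetric] by (simp add: case_prod_beta)
  have I: "?I y = indicator {y \<in> space (leb d). nrm d y \<le> \<sigma>} y" if "y \<in> space (leb d)" for y
    using that by (simp add: indicator_def)
  have em: "emeasure (leb d) {y \<in> space (leb d). nrm d y \<le> \<sigma>} < \<infinity>"
    using emeasure_ball[OF sig(1), of d] by simp
  have i2: "integrable (leb d) (\<lambda>y. ?I y * \<rho> powr (2 - real d))"
    by (subst Bochner_Integration.integrable_cong[OF refl, where g = "\<lambda>y. indicator {y \<in> space (leb d). nrm d y \<le> \<sigma>} y * \<rho> powr (2 - real d)"])
      (use em in \<open>auto simp: I\<close>)
  have v: "(\<integral>y. ?I y * \<rho> powr (2 - real d) \<partial>leb d) = unit_ball_vol (real d) * \<sigma> ^ d * \<rho> powr (2 - real d)"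
  proof -
    have "(\<integral>y. ?I y * \<rho> powr (2 - real d) \<partial>leb d)
      = (\<integral>y. indicator {y \<in> space (leb d). nrm d y \<le> \<sigma>} y * \<rho> powr (2 - real d) \<partial>leb d)"
      by (rule Bochner_Integration.integral_cong) (auto simp: I)
    also have "\<dots> = measure (leb d) {y \<in> space (leb d). nrm d y \<le> \<sigma>} * \<rho> powr (2 - real d)"
      using em by simp
    also have "measure (leb d) {y \<in> space (leb d). nrm d y \<le> \<sigma>} = unit_ball_vol (real d) * \<sigma> ^ d"
      using emeasure_ball[OF sig(1), of d] sig by (simp add: measure_def)
    finally show ?thesis .
  qed
  show i3: "integrable (leb d) (\<lambda>y. ?I y * pois d X (pt 1 y))"
    using Bochner_Integration.integrable_add[OF i1 i2] by simp
  show "(\<integral>y. ?I y * pois d X (pt 1 y) \<partial>leb d) = unit_ball_vol (real d) * \<sigma> ^ d * \<rho> powr (2 - real d)"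
    using z v Bochner_Integration.integral_diff[OF i3 i2] by simp
qed

end

lemma nsq_diff: "nsq d (\<lambda>k. z k - X k) = nsq d z - 2 * dot d X z + nsq d X"
  by (simp add: nsq_def dot_def power2_diff sum.distrib sum_subtractf sum_distrib_left algebra_simps)

lemma dot_diff: "dot d X (\<lambda>k. z k - X k) = dot d X z - nsq d X"
  by (simp add: nsq_def dot_def power2_eq_square sum_subtractf algebra_simps)

lemma pois_eq:
  assumes "0 < nsq d (\<lambda>k. z k - X k)"
  shows "pois d X (\<lambda>k. z k - X k)
    = ((nrm d X)\<^sup>2 - (nrm d z)\<^sup>2) * nsq d (\<lambda>k. z k - X k) powr (- (real d / 2))"
proof -
  let ?q = "nsq d (\<lambda>k. z k - X k)"
  have p: "?q powr (1 - real d / 2) = ?q * ?q powr (- (real d / 2))"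
    using powr_shift[OF assms, of "1 - real d / 2"] by simp
  have "- 2 * dot d X (\<lambda>k. z k - X k) - ?q = (nrm d X)\<^sup>2 - (nrm d z)\<^sup>2"
    by (simp add: nsq_diff dot_diff nrm_power2)
  moreover have "pois d X (\<lambda>k. z k - X k) = (- 2 * dot d X (\<lambda>k. z k - X k) - ?q) * ?q powr (- (real d / 2))"
    unfolding pois_def p by (simp add: left_diff_distrib)
  ultimately show ?thesis by simp
qed

lemma pois_measurable [measurable]: "(\<lambda>z. pois d X (\<lambda>k. z k - X k)) \<in> borel_measurable (leb d)"
  unfolding pois_def by measurable

text \<open>By the convention that 0 \<open>powr\<close> anything is 0, the kernel is 0 at its own
  pole, so the sign statements hold there as well.\<close>

lemma pois_zero: "nsq d w = 0 \<Longrightarrow> pois d X w = 0"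
  by (simp add: pois_def)

lemma pois_sign:
  shows "nrm d z \<le> nrm d X \<Longrightarrow> 0 \<le> pois d X (\<lambda>k. z k - X k)"
    and "nrm d X \<le> nrm d z \<Longrightarrow> pois d X (\<lambda>k. z k - X k) \<le> 0"
proof -
  let ?q = "nsq d (\<lambda>k. z k - X k)"
  have q: "?q = 0 \<or> 0 < ?q" using nsq_nonneg[of d "\<lambda>k. z k - X k"] by linarith
  show "0 \<le> pois d X (\<lambda>k. z k - X k)" if "nrm d z \<le> nrm d X"
    using q pois_eq[of d z X] pois_zero[of d "\<lambda>k. z k - X k" X] power_mono[OF that nrm_nonneg, of 2]
    by (auto intro!: mult_nonneg_nonneg)
  show "pois d X (\<lambda>k. z k - X k) \<le> 0" if "nrm d X \<le> nrm d z"
    using q pois_eq[of d z X] pois_zero[of d "\<lambda>k. z k - X k" X] power_mono[OF that nrm_nonneg, of 2]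
    by (auto intro!: mult_nonpos_nonneg)
qed

text \<open>The pole lies on the boundary of the ball, so the mean value property is applied to
  smaller concentric balls, and monotone convergence is available because the kernel is nonnegative
  inside.\<close>

lemma nn_integral_pois:
  assumes rho: "nrm d X = \<rho>" "0 < \<rho>" and d: "0 < d"
  shows "(\<integral>\<^sup>+z. ennreal (indicator {z. nrm d z < \<rho>} z * pois d X (\<lambda>k. z k - X k)) \<partial>leb d)
    \<le> ennreal (unit_ball_vol (real d) * \<rho>\<^sup>2)"
proof -
  \<comment> \<open>Radii increasing to \<rho>; the 2 in the denominator makes the first one
    \<rho>/2 rather than 0.\<close>
  define s where "s n = \<rho> * (1 - 1 / (real n + 2))" for n
  have s: "0 < s n" "s n < \<rho>" for n
  proof -
    have "\<rho> * (1 / (real n + 2)) < \<rho> * 1" "0 < \<rho> * (1 / (real n + 2))"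
      by (rule mult_strict_left_mono) (use rho(2) in auto)
    then show "0 < s n" "s n < \<rho>" by (simp_all add: s_def right_diff_distrib)
  qed
  have sm: "mono s" unfolding s_def mono_def using rho(2)
    by (auto intro!: mult_left_mono divide_left_mono diff_left_mono)
  let ?P = "\<lambda>z. pois d X (\<lambda>k. z k - X k)"
  define f where "f n z = ennreal (indicator {z. nrm d z \<le> s n} z * ?P z)" for n z
  have fm: "f n \<in> borel_measurable (leb d)" for n unfolding f_def by measurable
  have inc: "incseq f"
  proof (intro incseq_SucI le_funI)
    fix n z
    have "s n \<le> s (Suc n)" using sm by (simp add: mono_def)
    moreover have "0 \<le> ?P z" if "nrm d z \<le> s (Suc n)" using pois_sign(1)[of d z X] s(2)[of "Suc n"] that rho by simp
    ultimately show "f n z \<le> f (Suc n) z" unfolding f_def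
      by (intro ennreal_leI) (auto split: split_indicator)
  qed
  have lim: "s \<longlonglongrightarrow> \<rho>"
  proof -
    have "(\<lambda>n. \<rho> * (1 - 1 / (real n + 2))) \<longlonglongrightarrow> \<rho> * (1 - 0)"
      by (intro tendsto_intros tendsto_divide_0[OF tendsto_const] filterlim_at_top_imp_at_infinity
          filterlim_tendsto_add_at_top[OF tendsto_const, of _ "_", simplified add.commute] filterlim_real_sequentially)
        (use filterlim_tendsto_add_at_top[OF tendsto_const filterlim_real_sequentially, of 2] in \<open>simp add: add.commute\<close>)
    then show ?thesis unfolding s_def by simp
  qed
  have le: "ennreal (indicator {z. nrm d z < \<rho>} z * ?P z) \<le> (SUP n. f n z)" for z
  proof (cases "nrm d z < \<rho>")
    case True
    have "eventually (\<lambda>n. nrm d z < s n) sequentially" by (rule order_tendstoD(1)[OF lim True])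
    then obtain n where "nrm d z < s n" by (auto simp: eventually_sequentially)
    then have "ennreal (indicator {z. nrm d z < \<rho>} z * ?P z) = f n z" using True by (simp add: f_def)
    then show ?thesis using SUP_upper[of n UNIV "\<lambda>n. f n z"] by simp
  qed simp
  have int: "(\<integral>\<^sup>+z. f n z \<partial>leb d) \<le> ennreal (unit_ball_vol (real d) * \<rho>\<^sup>2)" for n
  proof -
    have "(\<integral>\<^sup>+z. f n z \<partial>leb d) = ennreal (\<integral>z. indicator {z. nrm d z \<le> s n} z * ?P z \<partial>leb d)"
      unfolding f_def
    proof (rule nn_integral_eq_integral)
      show "integrable (leb d) (\<lambda>z. indicator {z. nrm d z \<le> s n} z * ?P z)"
        using mean_value_ball(1)[OF rho(1) s] by simp
      show "AE z in leb d. 0 \<le> indicator {z. nrm d z \<le> s n} z * ?P z"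
        using pois_sign(1)[of d _ X] s(2)[of n] rho by (intro always_eventually) (auto split: split_indicator)
    qed
    also have "(\<integral>z. indicator {z. nrm d z \<le> s n} z * ?P z \<partial>leb d) = unit_ball_vol (real d) * s n ^ d * \<rho> powr (2 - real d)"
      using mean_value_ball(2)[OF rho(1) s, of n] by simp
    also have "ennreal \<dots> \<le> ennreal (unit_ball_vol (real d) * \<rho>\<^sup>2)"
    proof (rule ennreal_leI)
      have "unit_ball_vol (real d) * s n ^ d * \<rho> powr (2 - real d) \<le> unit_ball_vol (real d) * \<rho> ^ d * \<rho> powr (2 - real d)"
        by (intro mult_right_mono mult_left_mono power_mono) (use s[of n] in auto)
      also have "\<dots> = unit_ball_vol (real d) * (\<rho> powr (real d) * \<rho> powr (2 - real d))"
        using rho by (simp add: powr_realpow)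
      also have "\<rho> powr (real d) * \<rho> powr (2 - real d) = \<rho>\<^sup>2"
        unfolding powr_add[symmetric] using rho by (simp add: powr_numeral)
      finally show "unit_ball_vol (real d) * s n ^ d * \<rho> powr (2 - real d) \<le> unit_ball_vol (real d) * \<rho>\<^sup>2" .
    qed
    finally show ?thesis .
  qed
  have "(\<integral>\<^sup>+z. ennreal (indicator {z. nrm d z < \<rho>} z * ?P z) \<partial>leb d) \<le> (\<integral>\<^sup>+z. (SUP n. f n z) \<partial>leb d)"
    by (rule nn_integral_mono[OF le])
  also have "\<dots> = (SUP n. \<integral>\<^sup>+z. f n z \<partial>leb d)"
    by (rule nn_integral_monotone_convergence_SUP[OF inc fm])
  also have "\<dots> \<le> ennreal (unit_ball_vol (real d) * \<rho>\<^sup>2)" by (rule SUP_least[OF int])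
  finally show ?thesis .
qed

section \<open>The inner bound\<close>

text \<open>The discrete Laplacian of |w|^(-d-1) is positive of order |w|^(-d-3). Times |X| this is
  the size of the discretisation error of the Poisson kernel, which the added term dominates for
  large \<open>K\<close>. Away from the pole its integral is of order |X|, against |X|^2 for the
  kernel.\<close>

definition corr :: "nat \<Rightarrow> real \<Rightarrow> (nat \<Rightarrow> real) \<Rightarrow> (nat \<Rightarrow> real) \<Rightarrow> real" where
  "corr d K X w = pois d X w + K * nrm d X * nsq d w powr (- ((real d + 1) / 2))"

text \<open>The positive part keeps subharmonicity, so the boundary of the ball needs no care;
  near the pole the function is simply cut off.\<close>

definition test :: "nat \<Rightarrow> real \<Rightarrow> real \<Rightarrow> (nat \<Rightarrow> real) \<Rightarrow> (nat \<Rightarrow> real) \<Rightarrow> real" where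
  "test d K k X z = (if nrm d (\<lambda>i. z i - X i) < k then 0 else max 0 (corr d K X (\<lambda>i. z i - X i)))"

lemma test_nonneg [simp]: "0 \<le> test d K k X z"
  by (simp add: test_def)

text \<open>At distance at least 2 |X| from the origin the kernel is at most -3 |X|^2 |w|^(-d),
  while the correction is at most |X|^2 |w|^(-d) because K \<le> |X|. The positive part hence has
  bounded support.\<close>

lemma corr_support:
  assumes K: "0 \<le> K" "K \<le> nrm d X" and w: "1 \<le> nrm d (\<lambda>i. z i - X i)"
    and pos: "0 < corr d K X (\<lambda>i. z i - X i)"
  shows "nrm d z < 2 * nrm d X"
proof (rule ccontr)
  assume "\<not> ?thesis"
  then have z: "2 * nrm d X \<le> nrm d z" by simp
  let ?\<rho> = "nrm d X" and ?q = "nsq d (\<lambda>i. z i - X i)"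
  have q: "1 \<le> ?q" using power_mono[OF w, of 2] by (simp add: nrm_power2)
  have "(2 * ?\<rho>)\<^sup>2 \<le> (nrm d z)\<^sup>2" by (rule power_mono[OF z]) simp
  then have z2: "?\<rho>\<^sup>2 - (nrm d z)\<^sup>2 \<le> - 3 * ?\<rho>\<^sup>2" by (simp add: power_mult_distrib)
  have "?q powr (- ((real d + 1) / 2)) \<le> ?q powr (- (real d / 2))"
    by (rule powr_mono) (use q in auto)
  then have "K * ?\<rho> * ?q powr (- ((real d + 1) / 2)) \<le> ?\<rho> * ?\<rho> * ?q powr (- (real d / 2))"
    using K by (intro mult_mono) auto
  moreover have "pois d X (\<lambda>i. z i - X i) \<le> (- 3 * ?\<rho>\<^sup>2) * ?q powr (- (real d / 2))"
    using pois_eq[of d z X] q mult_right_mono[OF z2, of "?q powr (- (real d / 2))"] by simp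
  ultimately have "corr d K X (\<lambda>i. z i - X i) \<le> - 2 * ?\<rho>\<^sup>2 * ?q powr (- (real d / 2))"
    unfolding corr_def by (simp add: power2_eq_square)
  also have "\<dots> \<le> 0" by simp
  finally show False using pos by simp
qed

lemma test_support:
  assumes "0 \<le> K" "K \<le> nrm d X" "1 \<le> k" "0 < test d K k X z"
  shows "nrm d z < 2 * nrm d X" "nrm d (\<lambda>i. z i - X i) \<le> 3 * nrm d X"
proof -
  have 1: "1 \<le> nrm d (\<lambda>i. z i - X i)" "0 < corr d K X (\<lambda>i. z i - X i)"
    using assms(3,4) by (auto simp: test_def split: if_splits)
  show a: "nrm d z < 2 * nrm d X" by (rule corr_support[OF assms(1,2) 1])
  have "nrm d (\<lambda>i. z i - X i) \<le> nrm d (\<lambda>i. z i - 0) + nrm d (\<lambda>i. 0 - X i)"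
    by (rule nrm_diff_triangle)
  then show "nrm d (\<lambda>i. z i - X i) \<le> 3 * nrm d X" using a nrm_minus[of d X "\<lambda>_. 0"] by simp
qed

text \<open>Controls the test function where it is cut off: a value of order |X| at boundedly many
  sites is one order below the total mass |X|^2.\<close>

lemma corr_le:
  assumes K: "0 \<le> K" and w: "1 \<le> nrm d w" and d: "1 \<le> d"
  shows "corr d K X w \<le> (2 + K) * nrm d X"
proof -
  let ?q = "nsq d w"
  have q: "1 \<le> ?q" using power_mono[OF w, of 2] by (simp add: nrm_power2)
  have n: "nrm d w = ?q powr (1/2)" by (simp add: nrm_def powr_half_sqrt)
  have le1: "?q powr e \<le> 1" if "e \<le> 0" for e using powr_mono[OF that q] q by simp
  have "- 2 * dot d X w * ?q powr (- (real d / 2)) \<le> 2 * (nrm d X * nrm d w) * ?q powr (- (real d / 2))"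
    using abs_dot_le[of d X w] by (intro mult_right_mono) auto
  also have "\<dots> = 2 * nrm d X * (?q powr (1/2) * ?q powr (- (real d / 2)))" by (simp add: n)
  also have "?q powr (1/2) * ?q powr (- (real d / 2)) = ?q powr (1/2 - real d / 2)"
    unfolding powr_add[symmetric] by simp
  also have "2 * nrm d X * ?q powr (1/2 - real d / 2) \<le> 2 * nrm d X * 1"
    by (intro mult_left_mono le1) (use d in auto)
  finally have a: "- 2 * dot d X w * ?q powr (- (real d / 2)) \<le> 2 * nrm d X" by simp
  have b: "K * nrm d X * ?q powr (- ((real d + 1) / 2)) \<le> K * nrm d X * 1"
    by (intro mult_left_mono le1) (use K in auto)
  have "0 \<le> ?q powr (1 - real d / 2)" by simp
  then show ?thesis using a b unfolding corr_def pois_def distrib_right by linarith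
qed

lemma dlap_lin: "dlap d (\<lambda>z. a * f z + b * g z + c * h z) z = a * dlap d f z + b * dlap d g z + c * dlap d h z"
  unfolding dlap_def sum_distrib_left sum.distrib[symmetric] by (rule sum.cong) (simp_all add: algebra_simps)

text \<open>The main terms of dipole and radial part vanish. Their errors are of orders |X|
  |w|^(-d-3) and |w|^(-d-2); on the support |w| \<le> 3 |X|, so the second is of the first order
  too, and the correction beats both. The margin \<open>k + 1\<close> keeps the neighbours clear of
  the cut-off.\<close>

lemma test_subharmonic:
  assumes d: "2 \<le> d"
  obtains K k where "0 \<le> K" "2 \<le> k" "\<And>X z. K \<le> nrm d X \<Longrightarrow> k + 1 \<le> nrm d (\<lambda>i. z i - X i)
    \<Longrightarrow> 0 \<le> dlap d (test d K k X) z"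
proof -
  obtain C1 where C1: "0 \<le> C1" "\<And>X z. 4 \<le> nsq d z \<Longrightarrow>
    \<bar>dlap d (\<lambda>z. dot d X z * nsq d z powr (- (real d / 2))) z
        - 2 * (real d / 2) * (2 * (real d / 2) - real d) * dot d X z * nsq d z powr (- (real d / 2) - 1)\<bar>
      \<le> C1 * nrm d X * nsq d z powr (- (real d / 2) - 3/2)"
    by (rule dlap_powr[of "real d / 2" d]) auto
  obtain C2 where C2: "0 \<le> C2" "\<And>z. 4 \<le> nsq d z \<Longrightarrow>
    \<bar>dlap d (\<lambda>z. nsq d z powr (- (real d / 2 - 1))) z
        - 2 * (real d / 2 - 1) * (2 * (real d / 2 - 1) + 2 - real d) * nsq d z powr (- (real d / 2 - 1) - 1)\<bar>
      \<le> C2 * nsq d z powr (- (real d / 2 - 1) - 2)"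
    by (rule dlap_powr[of "real d / 2 - 1" d]) (use d in auto)
  obtain C3 where C3: "0 \<le> C3" "\<And>z. 4 \<le> nsq d z \<Longrightarrow>
    \<bar>dlap d (\<lambda>z. nsq d z powr (- ((real d + 1) / 2))) z
        - 2 * ((real d + 1) / 2) * (2 * ((real d + 1) / 2) + 2 - real d) * nsq d z powr (- ((real d + 1) / 2) - 1)\<bar>
      \<le> C3 * nsq d z powr (- ((real d + 1) / 2) - 2)"
    by (rule dlap_powr[of "(real d + 1) / 2" d]) auto
  \<comment> \<open>In units of |X| |w|^(-d-3) the errors are \<open>2 * C1\<close> and
    \<open>3 * C2\<close> and the gain is \<open>2 * K\<close>, which leaves a surplus of
    \<open>C2\<close>.\<close>
  define K where "K = C1 + 2 * C2"
  \<comment> \<open>Large enough for |w|^2 \<ge> 4, required by the Taylor bounds, and for |w|^2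
    \<ge> \<open>C3\<close>, which absorbs the error of the correction term itself.\<close>
  define k where "k = 2 + C3"
  have K: "0 \<le> K" using C1 C2 by (simp add: K_def)
  have k: "2 \<le> k" using C3 by (simp add: k_def)
  have core: "0 \<le> dlap d (corr d K X) w" if w: "k \<le> nrm d w" "nrm d w \<le> 3 * nrm d X" for X w
  proof -
    let ?q = "nsq d w" and ?\<rho> = "nrm d X"
    have "2 * 2 \<le> nrm d w * nrm d w" by (rule mult_mono) (use w k in auto)
    then have q4: "4 \<le> ?q" unfolding nrm_power2[symmetric] power2_eq_square by simp
    have "C3 * 1 \<le> nrm d w * nrm d w" by (rule mult_mono) (use w k C3(1) in \<open>auto simp: k_def\<close>)
    then have qC: "C3 \<le> ?q" unfolding nrm_power2[symmetric] power2_eq_square by simp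
    define t where "t = ?q powr (- (real d + 3) / 2)"
    have t: "0 \<le> t" by (simp add: t_def)
    have e1: "?q powr (- (real d / 2) - 3/2) = t" unfolding t_def by (rule arg_cong[where f = "\<lambda>x. ?q powr x"]) (simp add: field_simps)
    have e2: "?q powr (- (real d / 2 - 1) - 2) = nrm d w * t"
    proof -
      have "nrm d w * t = ?q powr (1/2) * ?q powr (- (real d + 3) / 2)" by (simp add: nrm_def powr_half_sqrt t_def)
      also have "\<dots> = ?q powr (1/2 + - (real d + 3) / 2)" by (rule powr_add[symmetric])
      also have "1/2 + - (real d + 3) / 2 = - (real d / 2 - 1) - 2" by (simp add: field_simps)
      finally show ?thesis by simp
    qed
    have e3: "?q powr (- ((real d + 1) / 2) - 1) = t" unfolding t_def by (rule arg_cong[where f = "\<lambda>x. ?q powr x"]) (simp add: field_simps)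
    have e4: "C3 * ?q powr (- ((real d + 1) / 2) - 2) \<le> t"
    proof -
      have "- (real d + 3) / 2 - 1 = - ((real d + 1) / 2) - 2" by (simp add: field_simps)
      moreover have "?q * ?q powr (- (real d + 3) / 2 - 1) = t"
        unfolding t_def by (rule powr_shift) (use q4 in simp)
      ultimately have "?q * ?q powr (- ((real d + 1) / 2) - 2) = t" by (simp only:)
      moreover have "C3 * ?q powr (- ((real d + 1) / 2) - 2) \<le> ?q * ?q powr (- ((real d + 1) / 2) - 2)"
        by (rule mult_right_mono[OF qC]) simp
      ultimately show ?thesis by simp
    qed
    have l1: "dlap d (\<lambda>z. dot d X z * nsq d z powr (- (real d / 2))) w \<le> C1 * ?\<rho> * t"
      using C1(2)[OF q4, of X] unfolding e1 by (simp add: abs_le_iff)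
    have l2: "dlap d (\<lambda>z. nsq d z powr (1 - real d / 2)) w \<le> C2 * (3 * ?\<rho> * t)"
    proof -
      have "dlap d (\<lambda>z. nsq d z powr (- (real d / 2 - 1))) w \<le> C2 * (nrm d w * t)"
        using C2(2)[OF q4] unfolding e2 by (simp add: abs_le_iff)
      also have "\<dots> \<le> C2 * (3 * ?\<rho> * t)" using w C2 t by (intro mult_left_mono mult_right_mono) auto
      finally show ?thesis by simp
    qed
    have l3: "2 * t \<le> dlap d (\<lambda>z. nsq d z powr (- ((real d + 1) / 2))) w"
    proof -
      have m: "2 * ((real d + 1) / 2) * (2 * ((real d + 1) / 2) + 2 - real d) = 3 * (real d + 1)"
        by (simp add: field_simps)
      have "3 * (real d + 1) * t - dlap d (\<lambda>z. nsq d z powr (- ((real d + 1) / 2))) w \<le> t"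
        using C3(2)[OF q4] e4 unfolding e3 m by linarith
      moreover have "3 * 1 * t \<le> 3 * (real d + 1) * t" using t by (intro mult_right_mono mult_left_mono) auto
      ultimately show ?thesis by linarith
    qed
    have "corr d K X = (\<lambda>w. (- 2) * (dot d X w * nsq d w powr (- (real d / 2))) + (- 1) * nsq d w powr (1 - real d / 2)
        + K * ?\<rho> * nsq d w powr (- ((real d + 1) / 2)))"
      by (rule ext) (simp add: corr_def pois_def)
    then have eq: "dlap d (corr d K X) w = (- 2) * dlap d (\<lambda>z. dot d X z * nsq d z powr (- (real d / 2))) w
      + (- 1) * dlap d (\<lambda>z. nsq d z powr (1 - real d / 2)) w + K * ?\<rho> * dlap d (\<lambda>z. nsq d z powr (- ((real d + 1) / 2))) w"
      by (simp only: dlap_lin)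
    have "K * ?\<rho> * (2 * t) \<le> K * ?\<rho> * dlap d (\<lambda>z. nsq d z powr (- ((real d + 1) / 2))) w"
      by (rule mult_left_mono[OF l3]) (use K in auto)
    then have "- 2 * (C1 * ?\<rho> * t) - C2 * (3 * ?\<rho> * t) + K * ?\<rho> * (2 * t) \<le> dlap d (corr d K X) w"
      unfolding eq using l1 l2 by linarith
    moreover have "- 2 * (C1 * ?\<rho> * t) - C2 * (3 * ?\<rho> * t) + K * ?\<rho> * (2 * t) = C2 * ?\<rho> * t"
      by (simp add: K_def algebra_simps)
    moreover have "0 \<le> C2 * ?\<rho> * t" using C2 t by simp
    ultimately show ?thesis by linarith
  qed
  show ?thesis
  proof (rule that[OF K k])
    fix X z assume X: "K \<le> nrm d X" and z: "k + 1 \<le> nrm d (\<lambda>i. z i - X i)"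
    define \<phi> where "\<phi> w = (if nrm d w < k then 0 else max 0 (corr d K X w))" for w
    have te: "test d K k X = (\<lambda>z. \<phi> (\<lambda>i. z i - X i))" by (rule ext) (simp add: test_def \<phi>_def)
    let ?w = "\<lambda>i. z i - X i"
    have nb: "k \<le> nrm d (?w(i := ?w i + 1))" "k \<le> nrm d (?w(i := ?w i - 1))" if "i < d" for i
      using nrm_upd_diff[OF that, of ?w "?w i + 1"] nrm_upd_diff[OF that, of ?w "?w i - 1"] z by auto
    have ge: "corr d K X v \<le> \<phi> v" "0 \<le> \<phi> v" if "k \<le> nrm d v" for v using that by (auto simp: \<phi>_def)
    have "0 \<le> dlap d \<phi> ?w"
    \<comment> \<open>A nonnegative function has nonnegative Laplacian at its zeros; where
      \<open>\<phi>\<close> is positive it agrees with \<open>corr\<close> and lies above it at the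
      neighbours.\<close>
    proof (cases "0 < \<phi> ?w")
      case False
      then have "\<phi> ?w = 0" using z by (simp add: \<phi>_def)
      then show ?thesis unfolding dlap_def using ge(2) nb by (intro sum_nonneg) auto
    next
      case True
      then have "\<phi> ?w = corr d K X ?w" by (auto simp: \<phi>_def max_def split: if_splits)
      then have "dlap d (corr d K X) ?w \<le> dlap d \<phi> ?w"
        unfolding dlap_def using ge(1) nb by (intro sum_mono) (auto intro!: add_mono)
      moreover have "0 < test d K k X z" using True te by simp
      then have "nrm d ?w \<le> 3 * nrm d X" using test_support(2)[OF K X, of k z] k by simp
      ultimately show ?thesis using core[of ?w X] z by simp
    qed
    then show "0 \<le> dlap d (test d K k X) z" unfolding te dlap_shift .
  qed
qed


lemma test_measurable [measurable]: "test d K k X \<in> borel_measurable (leb d)"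
proof -
  have [measurable]: "(\<lambda>z. corr d K X (\<lambda>i. z i - X i)) \<in> borel_measurable (leb d)"
    unfolding corr_def by measurable
  have [measurable]: "(\<lambda>z. nrm d (\<lambda>i. z i - X i)) \<in> borel_measurable (leb d)"
    unfolding nrm_def by measurable
  show ?thesis unfolding test_def by measurable
qed

lemma local_test: "local d (test d K k X)"
  unfolding local_def
proof (intro allI impI)
  fix z w :: "nat \<Rightarrow> real" assume e: "\<forall>i<d. z i = w i"
  have "nsq d (\<lambda>i. z i - X i) = nsq d (\<lambda>i. w i - X i)" by (rule nsq_cong) (use e in auto)
  moreover have "dot d X (\<lambda>i. z i - X i) = dot d X (\<lambda>i. w i - X i)" unfolding dot_def by (rule sum.cong) (use e in auto)
  ultimately show "test d K k X z = test d K k X w" unfolding test_def corr_def pois_def nrm_def by simp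
qed

text \<open>Outside the ball the kernel is nonpositive and is dropped, inside it contributes at most
  the mean value; the correction is at most a multiple of \<open>tail\<close>.\<close>

lemma nn_integral_test:
  assumes d: "0 < d" and K: "0 \<le> K" and k: "1 \<le> k" and X: "0 < nrm d X"
  shows "(\<integral>\<^sup>+z. ennreal (test d K k X z) \<partial>leb d)
    \<le> ennreal (unit_ball_vol (real d) * (nrm d X)\<^sup>2 + K * nrm d X * (2 ^ (d + 1) * (2 * real d) ^ d))"
proof -
  let ?\<rho> = "nrm d X" and ?T = "2 ^ (d + 1) * (2 * real d) ^ d :: real"
  let ?A = "\<lambda>z. ennreal (indicator {z. nrm d z < ?\<rho>} z * pois d X (\<lambda>k. z k - X k))"
  let ?B = "\<lambda>z. ennreal (K * ?\<rho>) * ennreal (tail d (\<lambda>k. z k - X k))"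
  have tm [measurable]: "(\<lambda>z. tail d (\<lambda>k. z k - X k)) \<in> borel_measurable (leb d)"
    unfolding tail_def by measurable
  have "(\<integral>\<^sup>+z. ennreal (test d K k X z) \<partial>leb d) \<le> (\<integral>\<^sup>+z. ?A z + ?B z \<partial>leb d)"
  proof (rule nn_integral_mono)
    fix z :: "nat \<Rightarrow> real"
    let ?w = "\<lambda>i. z i - X i"
    have "test d K k X z \<le> indicator {z. nrm d z < ?\<rho>} z * pois d X ?w + K * ?\<rho> * tail d ?w"
    proof (cases "nrm d ?w < k")
      case True
      then show ?thesis using pois_sign(1)[of d z X] K
        by (auto simp: test_def tail_def split: split_indicator intro!: add_nonneg_nonneg mult_nonneg_nonneg)
    next
      case False
      then have w: "1 \<le> nrm d ?w" using k by simp
      have q: "1 \<le> nsq d ?w" using power_mono[OF w, of 2] by (simp add: nrm_power2)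
      then have t: "tail d ?w = nsq d ?w powr (- ((real d + 1) / 2))" by (simp add: tail_def)
      have "corr d K X ?w \<le> indicator {z. nrm d z < ?\<rho>} z * pois d X ?w + K * ?\<rho> * tail d ?w"
        unfolding corr_def t using pois_sign(2)[of d X z] by (auto split: split_indicator)
      moreover have "0 \<le> indicator {z. nrm d z < ?\<rho>} z * pois d X ?w + K * ?\<rho> * tail d ?w"
        using pois_sign(1)[of d z X] K unfolding t
        by (auto split: split_indicator intro!: add_nonneg_nonneg mult_nonneg_nonneg)
      ultimately show ?thesis unfolding test_def by auto
    qed
    moreover have "0 \<le> indicator {z. nrm d z < ?\<rho>} z * pois d X ?w"
      using pois_sign(1)[of d z X] by (auto split: split_indicator)
    moreover have "0 \<le> tail d ?w" by (simp add: tail_def)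
    ultimately have a: "test d K k X z \<le> indicator {z. nrm d z < ?\<rho>} z * pois d X ?w + K * ?\<rho> * tail d ?w"
      and b: "0 \<le> indicator {z. nrm d z < ?\<rho>} z * pois d X ?w" and c: "0 \<le> K * ?\<rho> * tail d ?w"
      using K X by simp_all
    have "ennreal (test d K k X z) \<le> ennreal (indicator {z. nrm d z < ?\<rho>} z * pois d X ?w) + ennreal (K * ?\<rho> * tail d ?w)"
      unfolding ennreal_plus[OF b c, symmetric] by (rule ennreal_leI[OF a])
    also have "ennreal (K * ?\<rho> * tail d ?w) = ?B z" using K X by (simp add: ennreal_mult')
    finally show "ennreal (test d K k X z) \<le> ?A z + ?B z" .
  qed
  also have "\<dots> = (\<integral>\<^sup>+z. ?A z \<partial>leb d) + (\<integral>\<^sup>+z. ?B z \<partial>leb d)"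
    by (rule nn_integral_add) measurable
  also have "(\<integral>\<^sup>+z. ?B z \<partial>leb d) = ennreal (K * ?\<rho>) * (\<integral>\<^sup>+z. ennreal (tail d (\<lambda>k. z k - X k)) \<partial>leb d)"
    by (rule nn_integral_cmult) measurable
  also have "(\<integral>\<^sup>+z. ?A z \<partial>leb d) + ennreal (K * ?\<rho>) * (\<integral>\<^sup>+z. ennreal (tail d (\<lambda>k. z k - X k)) \<partial>leb d)
    \<le> ennreal (unit_ball_vol (real d) * ?\<rho>\<^sup>2) + ennreal (K * ?\<rho>) * ennreal ?T"
    by (intro add_mono mult_left_mono nn_integral_pois nn_integral_tail) (use d X in auto)
  also have "\<dots> = ennreal (unit_ball_vol (real d) * ?\<rho>\<^sup>2 + K * ?\<rho> * ?T)"
    using K X by (simp add: ennreal_mult' ennreal_plus)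
  finally show ?thesis .
qed

section \<open>Pairing the odometer with the test function\<close>

lemma card_near_le:
  assumes F: "finite F" "\<And>y. y \<in> F \<Longrightarrow> site d y" and x: "site d x"
  shows "card {y \<in> F. nrm d (\<lambda>i. emb y i - emb x i) < r} \<le> card (lball d r)"
proof (rule card_inj_on_le)
  let ?f = "\<lambda>y. map (\<lambda>i. y ! i - x ! i) [0..<d]"
  show "inj_on ?f {y \<in> F. nrm d (\<lambda>i. emb y i - emb x i) < r}"
  proof (rule inj_onI)
    fix y z assume y: "y \<in> {y \<in> F. nrm d (\<lambda>i. emb y i - emb x i) < r}"
      and z: "z \<in> {y \<in> F. nrm d (\<lambda>i. emb y i - emb x i) < r}" and e: "?f y = ?f z"
    have "y ! i = z ! i" if "i < d" for i
      using arg_cong[OF e, of "\<lambda>l. l ! i"] that by simp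
    then show "y = z" using y z F(2) by (auto simp: site_def list_eq_iff_nth_eq)
  qed
  show "?f ` {y \<in> F. nrm d (\<lambda>i. emb y i - emb x i) < r} \<subseteq> lball d r"
  proof
    fix v assume "v \<in> ?f ` {y \<in> F. nrm d (\<lambda>i. emb y i - emb x i) < r}"
    then obtain y where y: "y \<in> F" "nrm d (\<lambda>i. emb y i - emb x i) < r" "v = ?f y" by blast
    have "nrm d (emb v) = nrm d (\<lambda>i. emb y i - emb x i)"
      by (rule nrm_cong) (simp add: y(3) emb_def)
    then show "v \<in> lball d r" using y by (simp add: in_lball site_def)
  qed
qed (rule finite_lball)

lemma nrm_le_l1: "nrm d (\<lambda>i. emb y i - emb x i) \<le> real (l1 d y x)"
proof -
  have "nrm d (\<lambda>i. emb y i - emb x i) \<le> (\<Sum>i<d. \<bar>emb y i - emb x i\<bar>)"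
    unfolding nrm_L2 by (rule L2_set_le_sum_abs)
  also have "\<dots> = real (l1 d y x)"
    unfolding l1_def of_nat_sum by (rule sum.cong) (auto simp: emb_def)
  finally show ?thesis .
qed

lemma lap_ge_neg: "site d y \<Longrightarrow> (\<And>z. 0 \<le> f z) \<Longrightarrow> - (2 * real d * f y) \<le> lap d f y"
  by (simp add: lap_eq sum_nonneg)

text \<open>The largest value that the configuration raised by \<open>H\<close> can take at a stable
  site.\<close>

abbreviation cap :: "nat \<Rightarrow> int \<Rightarrow> real" where
  "cap d H \<equiv> 2 * real d - 1 + real_of_int H"

context
  fixes d n :: nat and H :: int and x :: "int list" and N :: real
  assumes d2: "2 \<le> d" and H: "2 - 2 * int d \<le> H" and x: "site d x" "x \<notin> visited d n H"
begin

lemma cap_ge_1: "1 \<le> cap d H"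
  using H by linarith

text \<open>Any legal sequence may witness a visit, so toppling to exhaustion inside a finite ball
  suffices. The odometer vanishes at \<open>x\<close> because toppled sites are visited.\<close>

lemma stable_in_ball:
  obtains xs where "legal d (init_config d n H) xs" "set xs \<subseteq> lball d N" "odo xs x = 0"
    "\<And>y. y \<in> lball d N \<Longrightarrow> lap d (odo xs) y \<le> cap d H - src d n y"
proof -
  obtain xs where xs: "legal d (init_config d n H) xs" "set [] \<subseteq> set xs" "set xs \<subseteq> lball d N"
    "\<And>y. y \<in> lball d N \<Longrightarrow> site d y \<Longrightarrow> foldl (topple d) (init_config d n H) xs y < 2 * int d"
    by (rule maximal_legal[of "lball d N" d n H "[]"]) (use finite_lball d2 in auto)
  show ?thesis
  proof (rule that[OF xs(1,3)])
    show "odo xs x = 0" using toppled_visited[OF xs(1) _ H] x by (auto simp: odo_eq_0)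
    fix y assume y: "y \<in> lball d N"
    then have s: "site d y" by (simp add: in_lball)
    have "real_of_int (foldl (topple d) (init_config d n H) xs y) \<le> 2 * real d - 1"
      using xs(4)[OF y s] by linarith
    then show "lap d (odo xs) y \<le> cap d H - src d n y" using lap_odo[OF xs(1) s] by linarith
  qed
qed

lemma odo_near:
  assumes xs: "odo xs x = 0"
    "\<And>y. y \<in> lball d N \<Longrightarrow> lap d (odo xs) y \<le> cap d H - src d n y"
    and N: "nrm d (emb x) + real L < N" and y: "site d y" "l1 d y x \<le> L"
  shows "odo xs y \<le> cap d H * (2 * real d + 1) ^ L"
proof -
  have "odo xs y \<le> cap d H * (2 * real d + 1) ^ l1 d y x"
  proof (rule growth_from_zero[where u = "odo xs" and L = L, OF _ xs(1) x(1) _ _ y])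
    fix z assume z: "site d z" "l1 d z x < L"
    have "nrm d (emb z) \<le> nrm d (\<lambda>i. emb z i - emb x i) + nrm d (emb x)"
      using nrm_triangle[of d "\<lambda>i. emb z i - emb x i" "emb x"] by simp
    also have "\<dots> < N" using nrm_le_l1[of d z x] z N by linarith
    finally have "z \<in> lball d N" using z by (simp add: in_lball)
    then show "lap d (odo xs) z \<le> cap d H" using xs(2)[of z] by (auto simp: src_def split: if_splits)
  qed (use cap_ge_1 in auto)
  also have "\<dots> \<le> cap d H * (2 * real d + 1) ^ L"
    by (intro mult_left_mono power_increasing y) (use cap_ge_1 in auto)
  finally show ?thesis .
qed

text \<open>Replaces the pairing for \<open>x\<close> at bounded distance:
  \<open>growth_from_zero\<close> bounds the odometer at the origin, and that many topplings must
  dispose of \<open>n\<close> grains.\<close>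

lemma origin_lap:
  assumes N: "nrm d (emb x) + real (l1 d (origin d) x) < N" "0 < N"
  shows "real n \<le> cap d H * (1 + 2 * real d * (2 * real d + 1) ^ l1 d (origin d) x)"
proof -
  obtain xs where xs: "legal d (init_config d n H) xs" "set xs \<subseteq> lball d N" "odo xs x = 0"
    "\<And>y. y \<in> lball d N \<Longrightarrow> lap d (odo xs) y \<le> cap d H - src d n y"
    by (rule stable_in_ball) blast
  have n0: "nrm d (emb (origin d)) = 0" by (simp add: nrm_def nsq_def emb_origin)
  have o: "origin d \<in> lball d N" using N(2) n0 by (simp add: in_lball)
  have "odo xs (origin d) \<le> cap d H * (2 * real d + 1) ^ l1 d (origin d) x"
    by (rule odo_near[OF xs(3,4) N(1)]) auto
  then have "2 * real d * odo xs (origin d) \<le> 2 * real d * (cap d H * (2 * real d + 1) ^ l1 d (origin d) x)"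
    by (rule mult_left_mono) simp
  moreover have "- (2 * real d * odo xs (origin d)) \<le> cap d H - real n"
    using lap_ge_neg[of d "origin d" "odo xs"] xs(4)[OF o] by (simp add: src_def)
  ultimately show ?thesis by (simp add: algebra_simps)
qed

text \<open>Both the mass bound and the bound on the odometer near \<open>x\<close> are multiples of
  \<open>cap d H\<close>, so it factors out of the whole right-hand side and the other constants
  depend on \<open>d\<close>, \<open>K\<close>, \<open>k\<close>, \<open>L\<close> only.\<close>

lemma duality_bound:
  assumes K: "0 \<le> K" "2 \<le> k" "\<And>X z. K \<le> nrm d X \<Longrightarrow> k + 1 \<le> nrm d (\<lambda>i. z i - X i)
    \<Longrightarrow> 0 \<le> dlap d (test d K k X) z"
    and rho: "K \<le> nrm d (emb x)" "k + real d \<le> nrm d (emb x)"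
    and N: "2 * nrm d (emb x) + real d < N" "nrm d (emb x) + real L < N"
    and L: "real d * (k + 1 + real d) \<le> real L"
  shows "real n * ((nrm d (emb x))\<^sup>2 - (real d)\<^sup>2)
    \<le> cap d H * (unit_ball_vol (real d) * (nrm d (emb x))\<^sup>2 + (K * (2 ^ (d + 1) * (2 * real d) ^ d) + 1
        + real (card (lball d (k + 1 + real d))) * ((2 * real d + 1) ^ L * (2 * real d * (2 + K)))) * nrm d (emb x))
      * (nrm d (emb x) + real d) ^ d"
proof -
  let ?\<rho> = "nrm d (emb x)" and ?r = "k + 1 + real d" and ?T = "2 ^ (d + 1) * (2 * real d) ^ d :: real"
  have r0: "0 < ?\<rho>" "1 \<le> ?\<rho>" using rho K by linarith+
  obtain xs where xs: "legal d (init_config d n H) xs" "set xs \<subseteq> lball d N" "odo xs x = 0"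
    "\<And>y. y \<in> lball d N \<Longrightarrow> lap d (odo xs) y \<le> cap d H - src d n y"
    by (rule stable_in_ball) blast
  define Y where "Y = lball d N"
  have Y: "finite Y" "\<And>y. y \<in> Y \<Longrightarrow> site d y" by (auto simp: Y_def finite_lball in_lball)
  let ?\<Psi> = "test d K k (emb x)"
  let ?B = "unit_ball_vol (real d) * ?\<rho>\<^sup>2 + K * ?\<rho> * ?T"
  have B0: "0 \<le> ?B" using K r0 by simp
  have int: "(\<integral>\<^sup>+z. ennreal (?\<Psi> z) \<partial>leb d) \<le> ennreal ?B"
    by (rule nn_integral_test) (use K d2 r0 in auto)
  obtain \<theta> where th: "\<theta> \<in> cube d" and sum_le: "(\<Sum>y\<in>Y. ?\<Psi> (\<lambda>i. emb y i + \<theta> i)) \<le> ?B + 1"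
    using exists_shift_sum_le[OF Y test_measurable local_test test_nonneg int B0] by auto
  have thn: "nrm d \<theta> < real d" by (rule nrm_cube[OF th]) (use d2 in simp)
  define f where "f y = ?\<Psi> (\<lambda>i. emb y i + \<theta> i)" for y
  have f0: "0 \<le> f y" for y by (simp add: f_def)
  define F where "F = Y \<union> (\<Union>y\<in>Y. nbrs d y)"
  have F: "finite F" "\<And>y. y \<in> F \<Longrightarrow> site d y" "set xs \<subseteq> F" "\<And>y. y \<in> set xs \<Longrightarrow> nbrs d y \<subseteq> F" "Y \<subseteq> F"
    using Y nbrs_site xs(2) unfolding F_def Y_def by auto
  let ?u = "odo xs"
  \<comment> \<open>The support of the test function has radius twice that of \<open>x\<close>, the
    shift adds less than \<open>d\<close>, and \<open>N\<close> exceeds the sum.\<close>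
  have fz: "f y = 0" if "site d y" "y \<notin> Y" for y
  proof (rule ccontr)
    assume "f y \<noteq> 0"
    then have "0 < ?\<Psi> (\<lambda>i. emb y i + \<theta> i)" using f0[of y] unfolding f_def by linarith
    then have "nrm d (\<lambda>i. emb y i + \<theta> i) < 2 * ?\<rho>" by (intro test_support(1)[OF K(1) rho(1)]) (use K in auto)
    moreover have "nrm d (emb y) \<le> nrm d (\<lambda>i. emb y i + \<theta> i) + nrm d (\<lambda>i. 0 - \<theta> i)"
      using nrm_triangle[of d "\<lambda>i. emb y i + \<theta> i" "\<lambda>i. 0 - \<theta> i"] by simp
    ultimately have "nrm d (emb y) < N" using thn N nrm_minus[of d \<theta> "\<lambda>_. 0"] by simp
    then show False using that by (simp add: Y_def in_lball)
  qed
  have "nrm d (emb (origin d)) = 0" by (simp add: nrm_def nsq_def emb_origin)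
  then have oY: "origin d \<in> Y" using N(1) r0 unfolding Y_def in_lball by simp
  have fo: "f (origin d) = ?\<Psi> \<theta>"
    unfolding f_def by (rule localD[OF local_test]) (simp add: emb_origin)
  have "(\<Sum>y\<in>F. f y * lap d ?u y) = (\<Sum>y\<in>Y. f y * lap d ?u y)"
    by (rule sum.mono_neutral_right) (use F fz in auto)
  also have "\<dots> \<le> (\<Sum>y\<in>Y. f y * (cap d H - src d n y))"
    by (intro sum_mono mult_left_mono f0) (use xs(4) in \<open>auto simp: Y_def\<close>)
  also have "\<dots> = cap d H * (\<Sum>y\<in>Y. f y) - (\<Sum>y\<in>Y. f y * src d n y)"
    unfolding right_diff_distrib sum_subtractf sum_distrib_right[symmetric] by (simp only: mult.commute)
  also have "(\<Sum>y\<in>Y. f y * src d n y) = ?\<Psi> \<theta> * real n"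
  proof -
    have "(\<Sum>y\<in>Y. f y * src d n y) = (\<Sum>y\<in>Y. if y = origin d then f y * real n else 0)"
      by (rule sum.cong) (auto simp: src_def)
    then show ?thesis using Y oY fo by simp
  qed
  finally have upper: "(\<Sum>y\<in>F. f y * lap d ?u y) \<le> cap d H * (\<Sum>y\<in>Y. f y) - ?\<Psi> \<theta> * real n" .
  \<comment> \<open>The shift has norm below \<open>d\<close>, so beyond this radius the shifted
    point is at distance at least \<open>k + 1\<close> from \<open>x\<close>, where the test
    function is subharmonic. Inside, \<open>odo_near\<close> bounds the odometer.\<close>
  define Nr where "Nr = {y \<in> F. nrm d (\<lambda>i. emb y i - emb x i) < ?r}"
  have lapf: "lap d f y = dlap d ?\<Psi> (\<lambda>i. emb y i + \<theta> i)" if "site d y" for y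
    unfolding f_def[abs_def] by (rule lap_emb[OF that])
  have far: "0 \<le> ?u y * lap d f y" if "y \<in> F" "y \<notin> Nr" for y
  proof -
    have "?r \<le> nrm d (\<lambda>i. emb y i - emb x i)" using that by (simp add: Nr_def)
    also have "\<dots> \<le> nrm d (\<lambda>i. emb y i + \<theta> i - emb x i) + nrm d (\<lambda>i. 0 - \<theta> i)"
      using nrm_triangle[of d "\<lambda>i. emb y i + \<theta> i - emb x i" "\<lambda>i. 0 - \<theta> i"] by simp
    finally have "k + 1 \<le> nrm d (\<lambda>i. emb y i + \<theta> i - emb x i)"
      using thn nrm_minus[of d \<theta> "\<lambda>_. 0"] by simp
    then have "0 \<le> dlap d ?\<Psi> (\<lambda>i. emb y i + \<theta> i)" by (intro K(3) rho(1)) simp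
    then show ?thesis using lapf F that by simp
  qed
  let ?U = "cap d H * (2 * real d + 1) ^ L"
  have near: "- (?U * (2 * real d * ((2 + K) * ?\<rho>))) \<le> ?u y * lap d f y" if "y \<in> Nr" for y
  proof -
    have s: "site d y" using that F by (simp add: Nr_def)
    have "real (l1 d y x) \<le> real d * ?r" by (rule l1_le_nrm) (use that in \<open>simp add: Nr_def\<close>)
    then have "l1 d y x \<le> L" using L by linarith
    then have u: "?u y \<le> ?U" by (intro odo_near[OF xs(3,4) N(2) s])
    have fb: "f y \<le> (2 + K) * ?\<rho>"
      unfolding f_def test_def using corr_le[OF K(1), of d "\<lambda>i. emb y i + \<theta> i - emb x i" "emb x"] K r0 d2 by auto
    have "?u y * (2 * real d * f y) \<le> ?U * (2 * real d * ((2 + K) * ?\<rho>))"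
      by (intro mult_mono mult_left_mono u fb) (use f0 cap_ge_1 in auto)
    moreover have "?u y * (- (2 * real d * f y)) \<le> ?u y * lap d f y"
      by (intro mult_left_mono lap_ge_neg[OF s] f0) auto
    ultimately show ?thesis by simp
  qed
  have U0: "0 \<le> ?U * (2 * real d * ((2 + K) * ?\<rho>))" using cap_ge_1 K r0 by simp
  have "- (real (card Nr) * (?U * (2 * real d * ((2 + K) * ?\<rho>)))) = (\<Sum>y\<in>F. if y \<in> Nr then - (?U * (2 * real d * ((2 + K) * ?\<rho>))) else 0)"
    using F(1) by (simp add: sum.If_cases Nr_def Int_def)
  also have "\<dots> \<le> (\<Sum>y\<in>F. ?u y * lap d f y)"
    by (rule sum_mono) (use near far in auto)
  finally have lower: "- (real (card Nr) * (?U * (2 * real d * ((2 + K) * ?\<rho>)))) \<le> (\<Sum>y\<in>F. ?u y * lap d f y)" .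
  have cardN: "real (card Nr) * (?U * (2 * real d * ((2 + K) * ?\<rho>))) \<le> real (card (lball d ?r)) * (?U * (2 * real d * ((2 + K) * ?\<rho>)))"
    unfolding Nr_def by (intro mult_right_mono U0) (use card_near_le[OF F(1,2) x(1)] in simp)
  have parts: "(\<Sum>y\<in>F. f y * lap d ?u y) = (\<Sum>y\<in>F. ?u y * lap d f y)"
  proof (rule sum_by_parts[OF F(1)])
    show "set xs \<subseteq> F" by (rule F(3))
    show "odo xs y = 0" if "y \<notin> set xs" for y using that odo_eq_0 by blast
  qed (use F in blast)+
  have "?\<Psi> \<theta> * real n \<le> cap d H * (\<Sum>y\<in>Y. f y) + real (card (lball d ?r)) * (?U * (2 * real d * ((2 + K) * ?\<rho>)))"
    using upper lower cardN parts by linarith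
  also have "\<dots> \<le> cap d H * (?B + 1 * ?\<rho>) + real (card (lball d ?r)) * (?U * (2 * real d * ((2 + K) * ?\<rho>)))"
    using sum_le r0 cap_ge_1 unfolding f_def by (intro add_right_mono mult_left_mono) auto
  also have "\<dots> = cap d H * (unit_ball_vol (real d) * ?\<rho>\<^sup>2 + (K * ?T + 1 + real (card (lball d ?r)) * ((2 * real d + 1) ^ L * (2 * real d * (2 + K)))) * ?\<rho>)"
    by (simp only: distrib_left distrib_right mult_ac add_ac)
  finally have main: "?\<Psi> \<theta> * real n \<le> cap d H * (unit_ball_vol (real d) * ?\<rho>\<^sup>2 + (K * ?T + 1 + real (card (lball d ?r)) * ((2 * real d + 1) ^ L * (2 * real d * (2 + K)))) * ?\<rho>)" (is "_ \<le> ?R") .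
  \<comment> \<open>Because of the shift the source at the origin is weighted by the test function
    at \<theta>. Its value there is at least that of the Poisson kernel, whose distance to the pole
    is at most \<rho> + d.\<close>
  have low: "(?\<rho>\<^sup>2 - (real d)\<^sup>2) \<le> ?\<Psi> \<theta> * (?\<rho> + real d) ^ d"
  proof -
    let ?w = "\<lambda>i. \<theta> i - emb x i"
    have w1: "k \<le> nrm d ?w"
      using nrm_triangle[of d "\<lambda>i. emb x i - \<theta> i" \<theta>] nrm_minus[of d "emb x" \<theta>] thn rho by simp
    have w2: "nrm d ?w \<le> ?\<rho> + real d"
      using nrm_diff_triangle[of d \<theta> "emb x" "\<lambda>_. 0"] nrm_minus[of d "emb x" "\<lambda>_. 0"] thn by simp
    have w0: "0 < nrm d ?w" using w1 K by simp
    have q: "0 < nsq d ?w" using w0 unfolding nrm_power2[symmetric] by simp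
    have "nsq d ?w = nrm d ?w powr 2" using w0 nrm_power2[of d ?w] by (simp add: powr_numeral)
    then have "nsq d ?w powr (- (real d / 2)) = nrm d ?w powr (- real d)" by (simp only: powr_powr) simp
    also have "\<dots> = inverse (nrm d ?w ^ d)" using w0 by (simp add: powr_minus powr_realpow)
    finally have e: "nsq d ?w powr (- (real d / 2)) = inverse (nrm d ?w ^ d)" .
    have P: "pois d (emb x) ?w = (?\<rho>\<^sup>2 - (nrm d \<theta>)\<^sup>2) / nrm d ?w ^ d"
      unfolding pois_eq[OF q] e by (rule divide_inverse[symmetric])
    have t2: "(nrm d \<theta>)\<^sup>2 \<le> (real d)\<^sup>2" by (rule power_mono) (use thn in auto)
    have "(real d)\<^sup>2 \<le> ?\<rho>\<^sup>2" by (rule power_mono) (use rho K in auto)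
    then have P0: "0 \<le> ?\<rho>\<^sup>2 - (nrm d \<theta>)\<^sup>2" using t2 by linarith
    have "pois d (emb x) ?w * nrm d ?w ^ d = ?\<rho>\<^sup>2 - (nrm d \<theta>)\<^sup>2" unfolding P using w0 by simp
    then have "?\<rho>\<^sup>2 - (real d)\<^sup>2 \<le> pois d (emb x) ?w * nrm d ?w ^ d" using t2 by linarith
    also have "\<dots> \<le> pois d (emb x) ?w * (?\<rho> + real d) ^ d"
    proof (intro mult_left_mono power_mono w2)
      show "0 \<le> pois d (emb x) ?w" unfolding P by (rule divide_nonneg_nonneg[OF P0]) simp
    qed simp
    also have "\<dots> \<le> ?\<Psi> \<theta> * (?\<rho> + real d) ^ d"
    proof (rule mult_right_mono)
      have "pois d (emb x) ?w \<le> corr d K (emb x) ?w" unfolding corr_def using K r0 by simp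
      then show "pois d (emb x) ?w \<le> ?\<Psi> \<theta>" unfolding test_def using w1 by auto
    qed simp
    finally show ?thesis .
  qed
  have "real n * (?\<rho>\<^sup>2 - (real d)\<^sup>2) \<le> real n * (?\<Psi> \<theta> * (?\<rho> + real d) ^ d)"
    by (rule mult_left_mono[OF low]) simp
  also have "\<dots> = (?\<Psi> \<theta> * real n) * (?\<rho> + real d) ^ d" by simp
  also have "\<dots> \<le> ?R * (?\<rho> + real d) ^ d" by (rule mult_right_mono[OF main]) simp
  finally show ?thesis .
qed

end


section \<open>From the pairing inequality to radii\<close>

lemma nrm_emb_origin_diff: "nrm d (\<lambda>i. emb (origin d) i - emb x i) = nrm d (emb x)"
proof -
  have "nrm d (\<lambda>i. emb (origin d) i - emb x i) = nrm d (\<lambda>i. 0 - emb x i)"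
    by (rule nrm_cong) (simp add: emb_origin)
  then show ?thesis using nrm_minus[of d "emb x" "\<lambda>_. 0"] by simp
qed

lemma root_le:
  assumes "0 < d" "0 \<le> a" "a \<le> b ^ d" "0 \<le> b"
  shows "a powr (1 / real d) \<le> b"
proof -
  have "a powr (1 / real d) \<le> (b ^ d) powr (1 / real d)" by (rule powr_mono2) (use assms in auto)
  also have "\<dots> = b"
  proof (cases "b = 0")
    case False
    then show ?thesis using assms by (simp add: powr_realpow[symmetric] powr_powr)
  qed (use assms in simp)
  finally show ?thesis .
qed

lemma radius_eq:
  assumes "0 < m" "0 \<le> v"
  shows "m powr (- 1 / real d) * v powr (1 / real d) = (v / m) powr (1 / real d)"
proof -
  have "m powr (- 1 / real d) = inverse (m powr (1 / real d))" using powr_minus[of m "1 / real d"] by simp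
  then show ?thesis using assms by (simp add: powr_divide) (simp add: divide_inverse)
qed

theorem inner_bound:
  fixes d :: nat
  assumes d: "2 \<le> d"
  shows "\<exists>c2::real. \<forall>(H::int) (n::nat). 2 - 2 * int d \<le> H \<longrightarrow>
    lball d ((2 * real d - 1 + real_of_int H) powr (- 1 / real d) * (real n / unit_ball_vol (real d)) powr (1 / real d) - c2)
      \<subseteq> visited d n H"
proof -
  obtain K k where K: "0 \<le> K" "2 \<le> k" "\<And>X z. K \<le> nrm d X \<Longrightarrow> k + 1 \<le> nrm d (\<lambda>i. z i - X i)
    \<Longrightarrow> 0 \<le> dlap d (test d K k X) z"
    using test_subharmonic[OF d] by metis
  define \<omega> where "\<omega> = unit_ball_vol (real d)"
  have w: "0 < \<omega>" by (simp add: \<omega>_def)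
  define L where "L = nat \<lceil>real d * (k + 1 + real d)\<rceil>"
  have L: "real d * (k + 1 + real d) \<le> real L" unfolding L_def by linarith
  define A0 where "A0 = K * (2 ^ (d + 1) * (2 * real d) ^ d) + 1
        + real (card (lball d (k + 1 + real d))) * ((2 * real d + 1) ^ L * (2 * real d * (2 + K)))"
  have A0: "0 \<le> A0" using K by (simp add: A0_def)
  \<comment> \<open>The added 1 leaves a spare \<rho>, which absorbs the loss from having \<rho>^2 -
    d^2 instead of \<rho>^2 on the left of \<open>duality_bound\<close>.\<close>
  define A where "A = A0 / \<omega> + 1"
  have A: "1 \<le> A" "A0 = \<omega> * (A - 1)" using A0 w by (auto simp: A_def)
  \<comment> \<open>Beyond this distance \<open>duality_bound\<close> applies and \<rho> dominates
    d^2 + A d^2; nearer sites are left to \<open>origin_lap\<close>, which is where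
    \<open>c'\<close> comes from.\<close>
  define \<rho>1 where "\<rho>1 = K + k + real d + (real d)\<^sup>2 + A * (real d)\<^sup>2"
  \<comment> \<open>Read off from (1 + A/\<rho>) (\<rho> + d) \<le> \<rho> + d + A + A d for \<rho>
    \<ge> 1.\<close>
  define c where "c = real d + A + A * real d"
  define L2 where "L2 = nat \<lceil>real d * \<rho>1\<rceil>"
  define c' where "c' = ((1 + 2 * real d * (2 * real d + 1) ^ L2) / \<omega>) powr (1 / real d)"
  show ?thesis
  proof (intro exI[of _ "max c c'"] allI impI subsetI)
    fix H :: int and n :: nat and x
    assume H: "2 - 2 * int d \<le> H"
    define m where "m = 2 * real d - 1 + real_of_int H"
    have m: "1 \<le> m" using H unfolding m_def by linarith
    assume "x \<in> lball d ((2 * real d - 1 + real_of_int H) powr (- 1 / real d) * (real n / unit_ball_vol (real d)) powr (1 / real d) - max c c')"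
    then have x: "site d x" "nrm d (emb x) < m powr (- 1 / real d) * (real n / \<omega>) powr (1 / real d) - max c c'"
      by (auto simp: in_lball m_def \<omega>_def)
    let ?\<rho> = "nrm d (emb x)"
    have R: "m powr (- 1 / real d) * (real n / \<omega>) powr (1 / real d) = (real n / (\<omega> * m)) powr (1 / real d)"
      using radius_eq[of m "real n / \<omega>" d] m w by (simp add: field_simps)
    show "x \<in> visited d n H"
    proof (rule ccontr)
      assume nv: "x \<notin> visited d n H"
      have "(real n / (\<omega> * m)) powr (1 / real d) \<le> ?\<rho> + max c c'"
      proof (cases "\<rho>1 \<le> ?\<rho>")
        case True
        have sq: "0 \<le> (real d)\<^sup>2" "0 \<le> A * (real d)\<^sup>2" using A by simp_all
        have r: "K \<le> ?\<rho>" "k + real d \<le> ?\<rho>" "(real d)\<^sup>2 + A * (real d)\<^sup>2 \<le> ?\<rho>" "1 \<le> ?\<rho>" "real d < ?\<rho>"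
          using True K sq unfolding \<rho>1_def by linarith+
        define N where "N = 2 * ?\<rho> + real d + real L + 1"
        have main: "real n * (?\<rho>\<^sup>2 - (real d)\<^sup>2) \<le> m * (\<omega> * ?\<rho>\<^sup>2 + A0 * ?\<rho>) * (?\<rho> + real d) ^ d"
          unfolding m_def \<omega>_def A0_def
          by (rule duality_bound[OF d H x(1) nv K r(1,2), of N]) (use L r(4) in \<open>auto simp: N_def\<close>)
        have pos: "0 < ?\<rho>\<^sup>2 - (real d)\<^sup>2" using r(5) by (simp add: power_strict_mono)
        have "A * (real d)\<^sup>2 / ?\<rho> \<le> A * (real d)\<^sup>2" using r(4) sq by (simp add: divide_le_eq mult_le_cancel_left1)
        then have "(A - 1) * ?\<rho> \<le> A * ?\<rho> - (real d)\<^sup>2 - A * (real d)\<^sup>2 / ?\<rho>"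
          using r(3) by (simp add: left_diff_distrib)
        then have "?\<rho>\<^sup>2 + (A - 1) * ?\<rho> \<le> (1 + A / ?\<rho>) * (?\<rho>\<^sup>2 - (real d)\<^sup>2)"
          using r(4) by (simp add: field_simps power2_eq_square)
        then have "\<omega> * (?\<rho>\<^sup>2 + (A - 1) * ?\<rho>) \<le> \<omega> * ((1 + A / ?\<rho>) * (?\<rho>\<^sup>2 - (real d)\<^sup>2))"
          using w by simp
        then have "\<omega> * ?\<rho>\<^sup>2 + A0 * ?\<rho> \<le> \<omega> * (1 + A / ?\<rho>) * (?\<rho>\<^sup>2 - (real d)\<^sup>2)"
          by (simp add: A(2) algebra_simps)
        then have "m * (\<omega> * ?\<rho>\<^sup>2 + A0 * ?\<rho>) * (?\<rho> + real d) ^ d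
            \<le> m * (\<omega> * (1 + A / ?\<rho>) * (?\<rho>\<^sup>2 - (real d)\<^sup>2)) * (?\<rho> + real d) ^ d"
          using m by (intro mult_right_mono mult_left_mono) auto
        with main have "real n * (?\<rho>\<^sup>2 - (real d)\<^sup>2) \<le> (m * \<omega> * ((1 + A / ?\<rho>) * (?\<rho> + real d) ^ d)) * (?\<rho>\<^sup>2 - (real d)\<^sup>2)"
          by (simp add: mult_ac)
        then have n1: "real n \<le> m * \<omega> * ((1 + A / ?\<rho>) * (?\<rho> + real d) ^ d)" using pos by simp
        have A1: "1 \<le> 1 + A / ?\<rho>" using A r by simp
        \<comment> \<open>The factor 1 + A/\<rho> is raised to its \<open>d\<close>-th power, a
          harmless loss, so that the right-hand side is a \<open>d\<close>-th power of a
          radius.\<close>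
        have "(1 + A / ?\<rho>) * (?\<rho> + real d) ^ d \<le> (1 + A / ?\<rho>) ^ d * (?\<rho> + real d) ^ d"
          using self_le_power[OF A1, of d] d by (intro mult_right_mono) auto
        also have "\<dots> = ((1 + A / ?\<rho>) * (?\<rho> + real d)) ^ d" by (simp add: power_mult_distrib)
        also have "\<dots> \<le> (?\<rho> + c) ^ d"
        proof (rule power_mono)
          have "0 \<le> A * real d" using A by simp
          then have "A * real d / ?\<rho> \<le> A * real d" using r(4) by (simp add: divide_le_eq mult_le_cancel_left1)
          then show "(1 + A / ?\<rho>) * (?\<rho> + real d) \<le> ?\<rho> + c"
            using r(4) by (simp add: c_def field_simps)
          show "0 \<le> (1 + A / ?\<rho>) * (?\<rho> + real d)" using A1 by simp
        qed
        finally have "real n \<le> m * \<omega> * (?\<rho> + c) ^ d"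
          using n1 m w by (meson mult_left_mono order_trans mult_nonneg_nonneg less_imp_le zero_le_one)
        then have "real n / (\<omega> * m) \<le> (?\<rho> + c) ^ d" using m w by (simp add: divide_le_eq mult_ac)
        moreover have "0 \<le> ?\<rho> + c" using A by (simp add: c_def)
        ultimately have "(real n / (\<omega> * m)) powr (1 / real d) \<le> ?\<rho> + c"
          using m w d by (intro root_le) auto
        then show ?thesis by linarith
      next
        case False
        let ?l = "l1 d (origin d) x"
        have "real ?l \<le> real d * \<rho>1"
          by (rule l1_le_nrm) (use False nrm_emb_origin_diff[of d x] in simp)
        then have l: "?l \<le> L2" unfolding L2_def by linarith
        have "real n \<le> m * (1 + 2 * real d * (2 * real d + 1) ^ ?l)"
          unfolding m_def
          by (rule origin_lap[OF d H x(1) nv, of "?\<rho> + real ?l + 1"]) (use nrm_nonneg[of d "emb x"] in linarith)+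
        also have "\<dots> \<le> m * (1 + 2 * real d * (2 * real d + 1) ^ L2)"
          using m l by (intro mult_left_mono add_left_mono power_increasing) auto
        finally have "real n / (\<omega> * m) \<le> (1 + 2 * real d * (2 * real d + 1) ^ L2) / \<omega>"
          using m w by (simp add: field_simps)
        then have "(real n / (\<omega> * m)) powr (1 / real d) \<le> c'"
          unfolding c'_def using m w by (intro powr_mono2) auto
        then show ?thesis using nrm_nonneg[of d "emb x"] by linarith
      qed
      then show False using x(2) R by linarith
    qed
  qed
qed

section \<open>A superharmonic comparison function\<close>

text \<open>The radial fundamental solution as a function of t = |z|^2, normalised to have
  derivative -t^(-d/2) in every dimension. Later arguments use this derivative and never separate d
  = 2 from d \<ge> 3.\<close>

definition phi :: "nat \<Rightarrow> real \<Rightarrow> real" where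
  "phi d t = (if d = 2 then - ln t else t powr (1 - real d / 2) / (real d / 2 - 1))"

lemma phi_deriv:
  assumes "0 < t" "2 \<le> d"
  shows "(phi d has_real_derivative - 1 * t powr (- (real d / 2))) (at t)"
proof (cases "d = 2")
  case True
  have "((\<lambda>t. - ln t) has_real_derivative - 1 * t powr (- (real d / 2))) (at t)"
    using assms True by (auto intro!: derivative_eq_intros simp: powr_minus_divide)
  then show ?thesis using True by (simp add: phi_def[abs_def])
next
  case False
  then have k: "real d / 2 - 1 \<noteq> 0" using assms by auto
  have "((\<lambda>t. t powr (1 - real d / 2) / (real d / 2 - 1)) has_real_derivative
      (1 - real d / 2) * t powr (1 - real d / 2 - 1) / (real d / 2 - 1)) (at t)"
    by (rule DERIV_cdivide[OF has_real_derivative_powr[OF assms(1)]])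
  also have "(1 - real d / 2) * t powr (1 - real d / 2 - 1) / (real d / 2 - 1) = - 1 * t powr (- (real d / 2))"
    using k by (simp add: divide_eq_eq) (simp add: algebra_simps)
  finally show ?thesis using False by (simp add: phi_def[abs_def])
qed

lemma phi_derivs:
  assumes s: "0 < s" and d: "2 \<le> d"
  defines "\<kappa> \<equiv> real d / 2"
  shows "(phi d has_real_derivative (- 1) * s powr (- \<kappa>)) (at s)"
    "((\<lambda>s. (- 1) * s powr (- \<kappa>)) has_real_derivative ((- 1) * (- \<kappa>)) * s powr (- \<kappa> - 1)) (at s)"
    "((\<lambda>s. ((- 1) * (- \<kappa>)) * s powr (- \<kappa> - 1)) has_real_derivative ((- 1) * (- \<kappa>) * (- \<kappa> - 1)) * s powr (- \<kappa> - 2)) (at s)"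
    "((\<lambda>s. ((- 1) * (- \<kappa>) * (- \<kappa> - 1)) * s powr (- \<kappa> - 2)) has_real_derivative ((- 1) * (- \<kappa>) * (- \<kappa> - 1) * (- \<kappa> - 2)) * s powr (- \<kappa> - 3)) (at s)"
  unfolding \<kappa>_def by (rule phi_deriv[OF s d] powr_derivs[OF s])+

lemma phi_taylor:
  assumes t: "0 < t" "0 < t0" and d: "2 \<le> d"
  obtains \<xi> where "min t t0 \<le> \<xi>" "\<xi> \<le> max t t0"
    "phi d t = phi d t0 - t0 powr (- (real d / 2)) * (t - t0) + real d / 4 * \<xi> powr (- (real d / 2) - 1) * (t - t0)\<^sup>2"
proof (cases "t = t0")
  case True
  then show ?thesis using that[of t0] by simp
next
  case False
  define D where "D = (\<lambda>m::nat. if m = 0 then phi d else if m = 1 then (\<lambda>s. (- 1) * s powr (- (real d / 2)))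
    else (\<lambda>s. ((- 1) * (- (real d / 2))) * s powr (- (real d / 2) - 1)))"
  have der: "\<forall>m s. m < 2 \<and> min t t0 \<le> s \<and> s \<le> max t t0 \<longrightarrow> DERIV (D m) s :> D (Suc m) s"
  proof (intro allI impI)
    fix m :: nat and s assume a: "m < 2 \<and> min t t0 \<le> s \<and> s \<le> max t t0"
    then have "0 < s" using t by (auto simp: min_def split: if_splits)
    moreover have "m = 0 \<or> m = 1" using a by auto
    ultimately show "DERIV (D m) s :> D (Suc m) s"
      using phi_derivs(1,2)[of s d] d by (auto simp: D_def)
  qed
  have "D 0 = phi d" by (simp add: D_def)
  from Taylor[OF _ this der, of t0 t] False obtain \<xi> where
    xi: "if t < t0 then t < \<xi> \<and> \<xi> < t0 else t0 < \<xi> \<and> \<xi> < t"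
    "phi d t = (\<Sum>m<2. (D m t0 / fact m) * (t - t0) ^ m) + D 2 \<xi> / fact 2 * (t - t0) ^ 2" by auto
  have "(\<Sum>m<2. (D m t0 / fact m) * (t - t0) ^ m) = phi d t0 - t0 powr (- (real d / 2)) * (t - t0)"
    by (simp add: D_def numeral_2_eq_2)
  moreover have "D 2 \<xi> / fact 2 * (t - t0) ^ 2 = real d / 4 * \<xi> powr (- (real d / 2) - 1) * (t - t0)\<^sup>2"
    by (simp add: D_def)
  ultimately show ?thesis using that[of \<xi>] xi by (auto split: if_splits)
qed

lemma phi_tangent:
  assumes t: "0 < t" "0 < t0" and d: "2 \<le> d"
  shows "phi d t0 - t0 powr (- (real d / 2)) * (t - t0) \<le> phi d t"
  by (rule phi_taylor[OF assms]) simp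

text \<open>The Laplacian of t^(-d/2) is positive and of order |z|^(-d-2), the order of the
  discretisation error of \<open>phi\<close>. Subtracting a large multiple makes the potential
  discretely superharmonic away from the origin.\<close>

definition cur :: "nat \<Rightarrow> real \<Rightarrow> real \<Rightarrow> real" where
  "cur d A t = phi d t - A * t powr (- (real d / 2))"

lemma dlap_cur:
  assumes d: "2 \<le> d"
  obtains A0 k0 where "0 \<le> A0" "2 \<le> k0" "\<And>A z. A0 \<le> A \<Longrightarrow> k0 \<le> nrm d z \<Longrightarrow> dlap d (\<lambda>z. cur d A (nsq d z)) z \<le> 0"
proof -
  define \<kappa> where "\<kappa> = real d / 2"
  have k1: "1 \<le> \<kappa>" using d by (simp add: \<kappa>_def)
  define M where "M = \<kappa> * (\<kappa> + 1) * (\<kappa> + 2)"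
  have M0: "0 \<le> M" using k1 by (simp add: M_def)
  have c: "\<bar>(- 1) * (- \<kappa>)\<bar> \<le> M" "\<bar>(- 1) * (- \<kappa>) * (- \<kappa> - 1)\<bar> \<le> M" "\<bar>(- 1) * (- \<kappa>) * (- \<kappa> - 1) * (- \<kappa> - 2)\<bar> \<le> M"
  proof -
    have "\<kappa> * 1 * 1 \<le> M" "\<kappa> * (\<kappa> + 1) * 1 \<le> M" unfolding M_def by (intro mult_mono; use k1 in simp)+
    moreover have "\<bar>(- 1) * (- \<kappa>)\<bar> = \<kappa>" using k1 by simp
    moreover have "(- 1) * (- \<kappa>) * (- \<kappa> - 1) = - (\<kappa> * (\<kappa> + 1))" by (simp add: algebra_simps)
    moreover have "(- 1) * (- \<kappa>) * (- \<kappa> - 1) * (- \<kappa> - 2) = M" by (simp add: M_def algebra_simps)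
    ultimately show "\<bar>(- 1) * (- \<kappa>)\<bar> \<le> M" "\<bar>(- 1) * (- \<kappa>) * (- \<kappa> - 1)\<bar> \<le> M" "\<bar>(- 1) * (- \<kappa>) * (- \<kappa> - 1) * (- \<kappa> - 2)\<bar> \<le> M"
      using k1 M0 by (simp_all add: abs_mult)
  qed
  have bnd: "\<bar>c * s powr e\<bar> \<le> M * s powr e'" if "\<bar>c\<bar> \<le> M" "e = e'" for c s e e' :: real
    using that by (simp add: abs_mult mult_right_mono)
  define C where "C = real d * (M * 4 powr (\<kappa> - 1 + 2) * 7)"
  have rad: "dlap d (\<lambda>z. phi d (nsq d z)) z \<le> C * nsq d z powr (- \<kappa> - 1)" if z: "4 \<le> nsq d z" for z
  proof -
    let ?q = "nsq d z"
    \<comment> \<open>Here the decay exponent of the general estimate is \<kappa> - 1, which is 0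
      for d = 2, where \<open>phi\<close> is a logarithm.\<close>
    have R: "\<bar>dlap d (\<lambda>z. phi d (nsq d z)) z - (2 * real d * ((- 1) * ?q powr (- \<kappa>)) + 4 * ?q * (((- 1) * (- \<kappa>)) * ?q powr (- \<kappa> - 1)))\<bar>
      \<le> real d * (M * 4 powr (\<kappa> - 1 + 2) * 7 * ?q powr (- (\<kappa> - 1) - 2))"
      by (rule dlap_radial[OF phi_derivs[OF _ d, folded \<kappa>_def] bnd[OF c(1)] bnd[OF c(2)] bnd[OF c(3)]])
        (use k1 M0 z in auto)
    have X0: "2 * real d * ((- 1) * ?q powr (- \<kappa>)) + 4 * ?q * (((- 1) * (- \<kappa>)) * ?q powr (- \<kappa> - 1)) = 0"
    proof -
      have "4 * ?q * (((- 1) * (- \<kappa>)) * ?q powr (- \<kappa> - 1)) = 4 * \<kappa> * (?q * ?q powr (- \<kappa> - 1))" by simp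
      also have "?q * ?q powr (- \<kappa> - 1) = ?q powr (- \<kappa>)" by (rule powr_shift) (use z in simp)
      also have "4 * \<kappa> = 2 * real d" by (simp add: \<kappa>_def)
      finally show ?thesis by simp
    qed
    have e: "- (\<kappa> - 1) - 2 = - \<kappa> - 1" by simp
    show ?thesis using R unfolding X0 e C_def by (simp add: abs_le_iff mult.assoc)
  qed
  obtain C' where C': "0 \<le> C'" "\<And>z. 4 \<le> nsq d z \<Longrightarrow>
    \<bar>dlap d (\<lambda>z. nsq d z powr (- \<kappa>)) z - 2 * \<kappa> * (2 * \<kappa> + 2 - real d) * nsq d z powr (- \<kappa> - 1)\<bar>
      \<le> C' * nsq d z powr (- \<kappa> - 2)"
    by (rule dlap_powr[of \<kappa> d]) (use k1 in auto)
  show ?thesis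
  proof (rule that[of C "2 + C'"])
    show "0 \<le> C" using M0 by (simp add: C_def)
    show "2 \<le> 2 + C'" using C' by simp
    fix A z assume A: "C \<le> A" and z: "2 + C' \<le> nrm d z"
    let ?q = "nsq d z"
    have "2 * 2 \<le> nrm d z * nrm d z" by (rule mult_mono) (use z C' in auto)
    then have q4: "4 \<le> ?q" unfolding nrm_power2[symmetric] power2_eq_square by simp
    have "C' * 1 \<le> nrm d z * nrm d z" by (rule mult_mono) (use z C' in auto)
    then have qC: "C' \<le> ?q" unfolding nrm_power2[symmetric] power2_eq_square by simp
    define t where "t = ?q powr (- \<kappa> - 1)"
    have t: "0 \<le> t" by (simp add: t_def)
    have e: "?q * ?q powr (- \<kappa> - 2) = t"
    proof -
      have two: "- \<kappa> - 1 - 1 = - \<kappa> - 2" by simp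
      show ?thesis unfolding t_def using powr_shift[of ?q "- \<kappa> - 1"] q4 unfolding two by simp
    qed
    have "C' * ?q powr (- \<kappa> - 2) \<le> ?q * ?q powr (- \<kappa> - 2)" by (rule mult_right_mono[OF qC]) simp
    moreover have m: "2 * \<kappa> * (2 * \<kappa> + 2 - real d) = 2 * real d" by (simp add: \<kappa>_def)
    ultimately have "2 * real d * t - dlap d (\<lambda>z. nsq d z powr (- \<kappa>)) z \<le> t"
      using C'(2)[OF q4] e unfolding t_def m by linarith
    moreover have "2 * 1 * t \<le> 2 * real d * t" using d t by (intro mult_right_mono) auto
    ultimately have l: "t \<le> dlap d (\<lambda>z. nsq d z powr (- \<kappa>)) z" by linarith
    have A0: "0 \<le> A" using A M0 by (simp add: C_def) (smt (verit) mult_nonneg_nonneg of_nat_0_le_iff powr_ge_zero)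
    have "dlap d (\<lambda>z. cur d A (nsq d z)) z = dlap d (\<lambda>z. 1 * phi d (nsq d z) + (- A) * nsq d z powr (- \<kappa>) + 0 * phi d (nsq d z)) z"
      by (simp add: cur_def \<kappa>_def)
    also have "\<dots> = dlap d (\<lambda>z. phi d (nsq d z)) z - A * dlap d (\<lambda>z. nsq d z powr (- \<kappa>)) z"
      unfolding dlap_lin by simp
    also have "\<dots> \<le> C * t - A * t"
      using rad[OF q4] mult_left_mono[OF l A0] unfolding t_def by simp
    also have "\<dots> \<le> 0" using mult_right_mono[OF A t] by simp
    finally show "dlap d (\<lambda>z. cur d A (nsq d z)) z \<le> 0" .
  qed
qed

text \<open>The paraboloid is the tangent of \<open>phi\<close> at t = q^2. Its Laplacian is the
  constant -2d q^(-d), so the point charge of the potential is spread over the inner ball, where the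
  averaged source lives. The minimum across the annulus preserves superharmonicity.\<close>

definition glue :: "nat \<Rightarrow> real \<Rightarrow> real \<Rightarrow> real \<Rightarrow> (nat \<Rightarrow> real) \<Rightarrow> real" where
  "glue d A p q z = (let line = phi d (q\<^sup>2) - (q\<^sup>2) powr (- (real d / 2)) * (nsq d z - q\<^sup>2) in
     if nrm d z < p then line else if nrm d z < q then min line (cur d A (nsq d z)) else cur d A (nsq d z))"

text \<open>A minimum is superharmonic once each branch, where it is attained, bounds the function
  at all neighbours. This requires \<open>cur\<close> below the line in a unit layer outside
  \<open>q\<close> (\<open>condA\<close>) and the line below \<open>cur\<close> in a unit layer at
  the inner radius (\<open>condB\<close>).\<close>

lemma glue_superharmonic:
  assumes d: "2 \<le> d"
  obtains A B j0 where "0 < A" "1 \<le> B" "1 \<le> j0"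
    "\<And>j z. j0 \<le> j \<Longrightarrow> dlap d (glue d A j (j + B)) z \<le> 0"
    "\<And>j z. j0 \<le> j \<Longrightarrow> nrm d z < j \<Longrightarrow> dlap d (glue d A j (j + B)) z \<le> - (2 * real d) * ((j + B)\<^sup>2) powr (- (real d / 2))"
proof -
  define \<kappa> where "\<kappa> = real d / 2"
  have k1: "1 \<le> \<kappa>" using d by (simp add: \<kappa>_def)
  obtain A0 k0 where A0: "0 \<le> A0" "2 \<le> k0" "\<And>A z. A0 \<le> A \<Longrightarrow> k0 \<le> nrm d z \<Longrightarrow> dlap d (\<lambda>z. cur d A (nsq d z)) z \<le> 0"
    using dlap_cur[OF d] by metis
  \<comment> \<open>Within distance 1 outside \<open>q\<close> one has t - q^2 \<le> 3q, so the
    second Taylor term of \<open>phi\<close> is at most 9/2 \<kappa> q^(-2\<kappa>); there the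
    subtracted term is at least A 4^(-\<kappa>) q^(-2\<kappa>).\<close>
  define A where "A = A0 + 9 / 2 * \<kappa> * 4 powr \<kappa>"
  have A: "A0 \<le> A" "9 / 2 * \<kappa> * 4 powr \<kappa> \<le> A" "0 < A" using A0(1) k1 by (auto simp: A_def intro: add_nonneg_pos)
  \<comment> \<open>Makes the annulus so wide that near its inner edge convexity lifts
    \<open>phi\<close> above the tangent by more than the subtracted term A t^(-\<kappa>).\<close>
  define B where "B = 2 + 2 * A * 4 powr \<kappa>"
  have B: "2 \<le> B" using A by (simp add: B_def)
  define j0 where "j0 = k0 + B"
  have j0: "1 \<le> j0" using A0 B by (simp add: j0_def)
  define line where "line q t = phi d (q\<^sup>2) - (q\<^sup>2) powr (- \<kappa>) * (t - q\<^sup>2)" for q t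
  have gl: "glue d A p q z = (if nrm d z < p then line q (nsq d z) else if nrm d z < q then min (line q (nsq d z)) (cur d A (nsq d z)) else cur d A (nsq d z))" for p q z
    by (simp add: glue_def line_def \<kappa>_def Let_def)
  have scale: "(4 * s) powr (- \<kappa>) = 4 powr (- \<kappa>) * s powr (- \<kappa>)" if "0 < s" for s
    using that by (simp add: powr_mult)
  have condA: "cur d A t \<le> line q t" if q: "1 \<le> q" and t: "q\<^sup>2 \<le> t" "t \<le> (q + 1)\<^sup>2" for q t
  proof -
    have q2: "0 < q\<^sup>2" using q by simp
    then have t0: "0 < t" using t by linarith
    obtain \<xi> where xi: "min t (q\<^sup>2) \<le> \<xi>" "\<xi> \<le> max t (q\<^sup>2)"
      "phi d t = phi d (q\<^sup>2) - (q\<^sup>2) powr (- \<kappa>) * (t - q\<^sup>2) + real d / 4 * \<xi> powr (- \<kappa> - 1) * (t - q\<^sup>2)\<^sup>2"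
      using phi_taylor[OF t0 q2 d] unfolding \<kappa>_def by metis
    have "t - q\<^sup>2 \<le> 3 * q" using t(2) q by (simp add: power2_sum)
    then have sq: "(t - q\<^sup>2)\<^sup>2 \<le> (3 * q)\<^sup>2" by (rule power_mono) (use t in simp)
    have "\<xi> powr (- \<kappa> - 1) \<le> (q\<^sup>2) powr (- \<kappa> - 1)" by (rule powr_mono2') (use xi t q2 k1 in auto)
    then have "real d / 4 * \<xi> powr (- \<kappa> - 1) * (t - q\<^sup>2)\<^sup>2 \<le> real d / 4 * (q\<^sup>2) powr (- \<kappa> - 1) * (3 * q)\<^sup>2"
      by (intro mult_mono mult_left_mono sq) auto
    also have "\<dots> = 9 / 2 * \<kappa> * (q\<^sup>2 * (q\<^sup>2) powr (- \<kappa> - 1))" by (simp add: \<kappa>_def power_mult_distrib)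
    also have "q\<^sup>2 * (q\<^sup>2) powr (- \<kappa> - 1) = (q\<^sup>2) powr (- \<kappa>)" by (rule powr_shift[OF q2])
    also have "9 / 2 * \<kappa> * (q\<^sup>2) powr (- \<kappa>) = (9 / 2 * \<kappa> * 4 powr \<kappa>) * (4 powr (- \<kappa>) * (q\<^sup>2) powr (- \<kappa>))"
      by (simp add: powr_minus)
    also have "\<dots> \<le> A * (4 powr (- \<kappa>) * (q\<^sup>2) powr (- \<kappa>))" by (rule mult_right_mono[OF A(2)]) simp
    also have "\<dots> = A * (4 * q\<^sup>2) powr (- \<kappa>)" using scale[OF q2] by simp
    also have "\<dots> \<le> A * t powr (- \<kappa>)"
    proof (intro mult_left_mono powr_mono2')
      have "(q + 1)\<^sup>2 \<le> (2 * q)\<^sup>2" by (rule power_mono) (use q in auto)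
      then show "t \<le> 4 * q\<^sup>2" using t by (simp add: power_mult_distrib)
    qed (use t0 k1 A in auto)
    finally show ?thesis using xi(3) unfolding cur_def line_def \<kappa>_def[symmetric] by linarith
  qed
  have condB: "line q (\<rho>\<^sup>2) \<le> cur d A (\<rho>\<^sup>2)" if q: "j0 \<le> j" "q = j + B" and r: "j \<le> \<rho>" "\<rho> < j + 1" for j q \<rho>
  proof -
    define b where "b = B - 1"
    have b: "1 \<le> b" "2 * A * 4 powr \<kappa> \<le> b" using B A by (auto simp: b_def B_def)
    have jB: "B \<le> j" "0 < j" using q A0 B by (auto simp: j0_def)
    have q2: "0 < q\<^sup>2" "0 < q" using q jB B by auto
    have r2: "0 < \<rho>\<^sup>2" "0 < \<rho>" using r jB by auto
    have rq: "\<rho> + b \<le> q" using r q by (simp add: b_def)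
    obtain \<xi> where xi: "min (\<rho>\<^sup>2) (q\<^sup>2) \<le> \<xi>" "\<xi> \<le> max (\<rho>\<^sup>2) (q\<^sup>2)"
      "phi d (\<rho>\<^sup>2) = phi d (q\<^sup>2) - (q\<^sup>2) powr (- \<kappa>) * (\<rho>\<^sup>2 - q\<^sup>2) + real d / 4 * \<xi> powr (- \<kappa> - 1) * (\<rho>\<^sup>2 - q\<^sup>2)\<^sup>2"
      using phi_taylor[OF r2(1) q2(1) d] unfolding \<kappa>_def by metis
    have le: "\<rho>\<^sup>2 \<le> q\<^sup>2" by (rule power_mono) (use rq b r2 in auto)
    have xi0: "0 < \<xi>" "\<xi> \<le> q\<^sup>2" using less_le_trans[OF r2(1), of \<xi>] xi(1,2) le by (simp_all add: min_absorb1 max_absorb2)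
    have "b * q \<le> (q - \<rho>) * (q + \<rho>)" by (rule mult_mono) (use rq b r2 q2 in auto)
    then have "(b * q)\<^sup>2 \<le> (q\<^sup>2 - \<rho>\<^sup>2)\<^sup>2" by (intro power_mono) (use b q2 in \<open>auto simp: algebra_simps power2_eq_square\<close>)
    then have sq: "(b * q)\<^sup>2 \<le> (\<rho>\<^sup>2 - q\<^sup>2)\<^sup>2" by (simp add: power2_commute)
    have "A * (\<rho>\<^sup>2) powr (- \<kappa>) \<le> A * (q\<^sup>2 / 4) powr (- \<kappa>)"
    proof (intro mult_left_mono powr_mono2')
      have "(q / 2)\<^sup>2 \<le> \<rho>\<^sup>2" by (rule power_mono) (use r q jB B in auto)
      then show "q\<^sup>2 / 4 \<le> \<rho>\<^sup>2" by (simp add: power_divide)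
    qed (use q2 k1 A in auto)
    also have "\<dots> = A * 4 powr \<kappa> * (q\<^sup>2) powr (- \<kappa>)" using q2 by (simp add: powr_divide powr_minus_divide)
    also have "\<dots> \<le> (\<kappa> / 2 * b\<^sup>2) * (q\<^sup>2) powr (- \<kappa>)"
    proof (rule mult_right_mono)
      have "1 * b \<le> \<kappa> * b\<^sup>2" unfolding power2_eq_square using k1 b by (intro mult_mono) (auto simp: mult_le_cancel_left1)
      then show "A * 4 powr \<kappa> \<le> \<kappa> / 2 * b\<^sup>2" using b by simp
    qed simp
    also have "(q\<^sup>2) powr (- \<kappa>) = q\<^sup>2 * (q\<^sup>2) powr (- \<kappa> - 1)" using powr_shift[OF q2(1)] by simp
    also have "(\<kappa> / 2 * b\<^sup>2) * (q\<^sup>2 * (q\<^sup>2) powr (- \<kappa> - 1)) = real d / 4 * (q\<^sup>2) powr (- \<kappa> - 1) * (b * q)\<^sup>2"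
      by (simp add: \<kappa>_def power_mult_distrib)
    also have "\<dots> \<le> real d / 4 * \<xi> powr (- \<kappa> - 1) * (\<rho>\<^sup>2 - q\<^sup>2)\<^sup>2"
      by (intro mult_mono mult_left_mono sq powr_mono2') (use xi0 k1 in auto)
    finally show ?thesis using xi(3) unfolding cur_def line_def \<kappa>_def[symmetric] by linarith
  qed
  have dline: "dlap d (\<lambda>z. line q (nsq d z)) z = - (2 * real d) * (q\<^sup>2) powr (- \<kappa>)" for q z
  proof -
    have "dlap d (\<lambda>z. line q (nsq d z)) z = dlap d (\<lambda>z. (- ((q\<^sup>2) powr (- \<kappa>))) * nsq d z + (phi d (q\<^sup>2) + (q\<^sup>2) powr (- \<kappa>) * q\<^sup>2) * 1 + 0 * 1) z"
      by (simp add: line_def algebra_simps)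
    also have "\<dots> = (- ((q\<^sup>2) powr (- \<kappa>))) * dlap d (nsq d) z + (phi d (q\<^sup>2) + (q\<^sup>2) powr (- \<kappa>) * q\<^sup>2) * dlap d (\<lambda>_. 1) z + 0 * dlap d (\<lambda>_. 1) z"
      by (rule dlap_lin)
    also have "dlap d (\<lambda>_. 1) z = 0" by (simp add: dlap_def)
    finally show ?thesis by (simp add: dlap_nsq)
  qed
  have mono: "dlap d f z \<le> dlap d g z" if "f z = g z"
    "\<And>i. i < d \<Longrightarrow> f (z(i := z i + 1)) \<le> g (z(i := z i + 1))" "\<And>i. i < d \<Longrightarrow> f (z(i := z i - 1)) \<le> g (z(i := z i - 1))" for f g z
    unfolding dlap_def by (intro sum_mono) (use that in \<open>auto intro!: add_mono diff_mono\<close>)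
  have nbr: "nrm d (z(i := z i + 1)) \<le> nrm d z + 1" "nrm d z - 1 \<le> nrm d (z(i := z i + 1))"
    "nrm d (z(i := z i - 1)) \<le> nrm d z + 1" "nrm d z - 1 \<le> nrm d (z(i := z i - 1))" if "i < d" for z i
    using nrm_upd_diff[OF that, of z "z i + 1"] nrm_upd_diff[OF that, of z "z i - 1"] by auto
  have main: "dlap d (glue d A j (j + B)) z \<le> - (2 * real d) * ((j + B)\<^sup>2) powr (- \<kappa>)"
    if j: "j0 \<le> j" and on: "glue d A j (j + B) z = line (j + B) (nsq d z)" "nrm d z < j + B" for j z
  proof -
    have "glue d A j (j + B) v \<le> line (j + B) (nsq d v)" if v: "nrm d v \<le> j + B + 1" for v
    proof (cases "nrm d v < j + B")
      case True then show ?thesis by (simp add: gl)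
    next
      case False
      have "cur d A (nsq d v) \<le> line (j + B) (nsq d v)"
      proof (rule condA)
        show "1 \<le> j + B" using j j0 B by simp
        show "(j + B)\<^sup>2 \<le> nsq d v" unfolding nrm_power2[symmetric] by (rule power_mono) (use False j j0 B in auto)
        show "nsq d v \<le> (j + B + 1)\<^sup>2" unfolding nrm_power2[symmetric] by (rule power_mono[OF v]) simp
      qed
      then show ?thesis using False B by (simp add: gl)
    qed
    note below = this
    have "dlap d (glue d A j (j + B)) z \<le> dlap d (\<lambda>z. line (j + B) (nsq d z)) z"
    proof (rule mono)
      show "glue d A j (j + B) z = line (j + B) (nsq d z)" by (rule on(1))
      fix i assume i: "i < d"
      show "glue d A j (j + B) (z(i := z i + 1)) \<le> line (j + B) (nsq d (z(i := z i + 1)))"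
        by (rule below) (use nbr[OF i, of z] on(2) in linarith)
      show "glue d A j (j + B) (z(i := z i - 1)) \<le> line (j + B) (nsq d (z(i := z i - 1)))"
        by (rule below) (use nbr[OF i, of z] on(2) in linarith)
    qed
    then show ?thesis by (simp add: dline)
  qed
  have le_cur: "glue d A j (j + B) v \<le> cur d A (nsq d v)" if "j \<le> nrm d v" for j v
    using that by (simp add: gl)
  show ?thesis
  proof (rule that[of A B j0])
    show "0 < A" "1 \<le> B" "1 \<le> j0" using A B j0 by auto
    fix j z assume j: "j0 \<le> j"
    show "dlap d (glue d A j (j + B)) z \<le> 0"
    proof (cases "nrm d z < j + B \<and> glue d A j (j + B) z = line (j + B) (nsq d z)")
      case True
      have "0 \<le> 2 * real d * ((j + B)\<^sup>2) powr (- \<kappa>)" by simp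
      then show ?thesis using main[OF j, of z] True by linarith
    next
      case False
      have far: "j + 1 \<le> nrm d z"
      proof (rule ccontr)
        assume n: "\<not> ?thesis"
        have "glue d A j (j + B) z = line (j + B) (nsq d z)"
        proof (cases "nrm d z < j")
          case False
          then have "line (j + B) ((nrm d z)\<^sup>2) \<le> cur d A ((nrm d z)\<^sup>2)" by (intro condB[OF j refl]) (use n in auto)
          then show ?thesis using n B False by (simp add: gl nrm_power2)
        qed (simp add: gl)
        then show False using False n B by auto
      qed
      have eq: "glue d A j (j + B) z = cur d A (nsq d z)" using False far by (auto simp: gl min_def split: if_splits)
      have "dlap d (glue d A j (j + B)) z \<le> dlap d (\<lambda>z. cur d A (nsq d z)) z"
      proof (rule mono)
        show "glue d A j (j + B) z = cur d A (nsq d z)" by (rule eq)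
        fix i assume i: "i < d"
        show "glue d A j (j + B) (z(i := z i + 1)) \<le> cur d A (nsq d (z(i := z i + 1)))"
          by (rule le_cur) (use nbr[OF i, of z] far in linarith)
        show "glue d A j (j + B) (z(i := z i - 1)) \<le> cur d A (nsq d (z(i := z i - 1)))"
          by (rule le_cur) (use nbr[OF i, of z] far in linarith)
      qed
      also have "\<dots> \<le> 0" by (rule A0(3)[OF A(1)]) (use far j B in \<open>auto simp: j0_def\<close>)
      finally show ?thesis .
    qed
    assume z: "nrm d z < j"
    show "dlap d (glue d A j (j + B)) z \<le> - (2 * real d) * ((j + B)\<^sup>2) powr (- (real d / 2))"
      using main[OF j, of z] z B by (simp add: gl \<kappa>_def)
  qed
qed


section \<open>Quadratic plus potential around their balance radius\<close>

lemma phi_drop: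
  assumes "0 < a" "a \<le> b" "2 \<le> d"
  shows "b powr (- (real d / 2)) * (b - a) \<le> phi d a - phi d b"
  using phi_tangent[of a b d] assms by (simp add: right_diff_distrib)

lemma phi_antimono: "0 < a \<Longrightarrow> a \<le> b \<Longrightarrow> 2 \<le> d \<Longrightarrow> phi d b \<le> phi d a"
proof -
  assume a: "0 < a" "a \<le> b" "2 \<le> d"
  have "0 \<le> b powr (- (real d / 2)) * (b - a)" using a by simp
  then show "phi d b \<le> phi d a" using phi_drop[OF a] by linarith
qed

text \<open>Two tangent estimates, from t to t/2 and from t/2 to t/4, each gain t^(1-d/2)/2, because
  the slope at least doubles in the second. A single one over the whole interval would give only
  3/4.\<close>

lemma phi_quarter:
  assumes t: "0 < t" and d: "2 \<le> d"
  shows "t powr (- (real d / 2)) * t \<le> phi d (t / 4) - phi d t"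
proof -
  let ?\<kappa> = "real d / 2"
  have 1: "t powr (- ?\<kappa>) * (t - t / 2) \<le> phi d (t / 2) - phi d t" by (rule phi_drop) (use t d in auto)
  have 2: "(t / 2) powr (- ?\<kappa>) * (t / 2 - t / 4) \<le> phi d (t / 4) - phi d (t / 2)" by (rule phi_drop) (use t d in auto)
  have "(2::real) powr 1 \<le> 2 powr ?\<kappa>" by (rule powr_mono) (use d in auto)
  then have "2 * t powr (- ?\<kappa>) \<le> 2 powr ?\<kappa> * t powr (- ?\<kappa>)" by (intro mult_right_mono) auto
  also have "\<dots> = (t / 2) powr (- ?\<kappa>)" using t by (simp add: powr_divide powr_minus_divide)
  finally have "2 * t powr (- ?\<kappa>) * (t / 4) \<le> (t / 2) powr (- ?\<kappa>) * (t / 4)" using t by (intro mult_right_mono) auto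
  then show ?thesis using 1 2 by (simp add: algebra_simps)
qed

text \<open>Passing from t to 4t lowers \<open>phi\<close> by at least 3t (4t)^(-d/2). By the lower
  bound on q^2 this exceeds the term subtracted in \<open>cur\<close>, also after t^(-d/2) has grown
  by a factor 4^(d/2) in the annulus.\<close>

lemma glue_lower:
  assumes d: "2 \<le> d" and A: "0 < A" and q: "0 < p" "p \<le> q" "q \<le> 2 * p" and Q: "A * 16 powr (real d / 2) \<le> q\<^sup>2"
  shows "phi d (4 * max (nsq d z) (q\<^sup>2)) \<le> glue d A p q z"
proof -
  define \<kappa> where "\<kappa> = real d / 2"
  have q2: "0 < q\<^sup>2" using q by simp
  have k: "0 < \<kappa>" using d by (simp add: \<kappa>_def)
  have six: "16 powr \<kappa> = 4 powr \<kappa> * 4 powr \<kappa>" using powr_mult[of 4 4 \<kappa>] by simp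
  have drop: "A * 4 powr \<kappa> * t powr (- \<kappa>) \<le> phi d t - phi d (4 * t)" if t: "q\<^sup>2 \<le> t" for t
  proof -
    have t0: "0 < t" using t q2 by linarith
    have "(4 * t) powr (- \<kappa>) * (4 * t - t) \<le> phi d t - phi d (4 * t)"
      unfolding \<kappa>_def by (rule phi_drop) (use t0 d in auto)
    moreover have "A * 4 powr \<kappa> * t powr (- \<kappa>) \<le> (4 * t) powr (- \<kappa>) * (4 * t - t)"
    proof -
      have "A * 4 powr \<kappa> * (4 powr \<kappa> * 4 powr (- \<kappa>)) * t powr (- \<kappa>) = (A * 16 powr \<kappa>) * (4 powr (- \<kappa>) * t powr (- \<kappa>))"
        by (simp add: six)
      also have "A * 16 powr \<kappa> \<le> 3 * t" using Q t t0 unfolding \<kappa>_def by linarith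
      then have "(A * 16 powr \<kappa>) * (4 powr (- \<kappa>) * t powr (- \<kappa>)) \<le> (3 * t) * (4 powr (- \<kappa>) * t powr (- \<kappa>))"
        by (rule mult_right_mono) simp
      finally show ?thesis using t0 by (simp add: powr_mult powr_minus mult_ac)
    qed
    ultimately show ?thesis by linarith
  qed
  have one: "1 \<le> 4 powr \<kappa>" using k by (simp add: ge_one_powr_ge_zero)
  show ?thesis
  proof (cases "nrm d z < q")
    case False
    then have t: "q\<^sup>2 \<le> nsq d z" unfolding nrm_power2[symmetric] using q by (intro power_mono) auto
    have "A * 1 * nsq d z powr (- \<kappa>) \<le> A * 4 powr \<kappa> * nsq d z powr (- \<kappa>)"
      using A one by (intro mult_right_mono mult_left_mono) auto
    then show ?thesis using drop[OF t] False t q by (simp add: glue_def cur_def \<kappa>_def[symmetric] max_def)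
  next
    case True
    then have t: "nsq d z \<le> q\<^sup>2" unfolding nrm_power2[symmetric] by (intro power_mono) auto
    have D: "A * 4 powr \<kappa> * (q\<^sup>2) powr (- \<kappa>) \<le> phi d (q\<^sup>2) - phi d (4 * q\<^sup>2)" by (rule drop) simp
    have "0 \<le> A * 4 powr \<kappa> * (q\<^sup>2) powr (- \<kappa>)" using A by simp
    then have line: "phi d (4 * q\<^sup>2) \<le> phi d (q\<^sup>2) - (q\<^sup>2) powr (- \<kappa>) * (nsq d z - q\<^sup>2)"
      using D mult_nonneg_nonneg[of "(q\<^sup>2) powr (- \<kappa>)" "q\<^sup>2 - nsq d z"] t by (simp add: right_diff_distrib)
    have "phi d (4 * q\<^sup>2) \<le> cur d A (nsq d z)" if p: "p \<le> nrm d z"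
    proof -
      have pt: "(q / 2)\<^sup>2 \<le> nsq d z" unfolding nrm_power2[symmetric] using q p by (intro power_mono) auto
      have z0: "0 < nsq d z" using pt q by (auto intro: less_le_trans[rotated])
      have "phi d (q\<^sup>2) \<le> phi d (nsq d z)" by (rule phi_antimono[OF z0 t d])
      moreover have "nsq d z powr (- \<kappa>) \<le> (q\<^sup>2 / 4) powr (- \<kappa>)"
        by (rule powr_mono2') (use pt q2 k in \<open>auto simp: power_divide\<close>)
      moreover have "(q\<^sup>2 / 4) powr (- \<kappa>) = 4 powr \<kappa> * (q\<^sup>2) powr (- \<kappa>)" using q2 by (simp add: powr_divide powr_minus_divide)
      ultimately have "A * nsq d z powr (- \<kappa>) \<le> A * (4 powr \<kappa> * (q\<^sup>2) powr (- \<kappa>))" "phi d (q\<^sup>2) \<le> phi d (nsq d z)"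
        using A by (auto intro: mult_left_mono)
      then show ?thesis using D unfolding cur_def \<kappa>_def[symmetric] by simp
    qed
    then show ?thesis using line True t by (auto simp: glue_def Let_def \<kappa>_def[symmetric] max_def)
  qed
qed

text \<open>\<open>ts\<close> is the square of the radius at which the quadratic and the potential balance.\<close>

definition bowl :: "nat \<Rightarrow> real \<Rightarrow> real \<Rightarrow> real \<Rightarrow> real \<Rightarrow> real \<Rightarrow> (nat \<Rightarrow> real) \<Rightarrow> real" where
  "bowl d A p q \<mu> W z = \<mu> / (2 * real d) * nsq d z + W * glue d A p q z"

text \<open>By \<open>bal\<close> the convex function \<mu>/(2d) t + W \<open>phi\<close> t has its
  minimum \<open>S\<close> at t = \<open>ts\<close>. The gluing and the correction lower this by at
  most a multiple of \<mu>. On a layer of width 2 in the radius t moves by at most 8 sqrt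
  \<open>ts\<close>, while the second derivative is of order \<mu>/\<open>ts\<close>, so the rise is
  again O(\<mu>). Neither error depends on \<open>W\<close> or \<open>ts\<close>.\<close>

lemma bowl_bounds:
  assumes d: "2 \<le> d" and A: "0 < A" and q: "0 < p" "p \<le> q" "q \<le> 2 * p" and Q: "A * 16 powr (real d / 2) \<le> q\<^sup>2"
    and mu: "0 < \<mu>" and W: "0 < W" and ts: "0 < ts" "16 * q\<^sup>2 \<le> ts" "1 \<le> ts"
    and bal: "W * ts powr (- (real d / 2)) = \<mu> / (2 * real d)"
  defines "S \<equiv> \<mu> / (2 * real d) * ts + W * phi d ts"
  shows "S - A * 16 powr (real d / 2) * \<mu> \<le> bowl d A p q \<mu> W z"
    and "sqrt ts \<le> nrm d z \<Longrightarrow> nrm d z \<le> sqrt ts + 2 \<Longrightarrow> bowl d A p q \<mu> W z \<le> S + 8 * \<mu>"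
proof -
  define \<kappa> where "\<kappa> = real d / 2"
  have k: "0 < \<kappa>" using d by (simp add: \<kappa>_def)
  have m0: "0 < \<mu> / (2 * real d)" using mu d by simp
  have mle: "\<mu> / (2 * real d) \<le> \<mu>" using mu d by (simp add: divide_le_eq)
  have tang: "S \<le> \<mu> / (2 * real d) * t + W * phi d t" if t: "0 < t" for t
  proof -
    have "W * (phi d ts - ts powr (- \<kappa>) * (t - ts)) \<le> W * phi d t"
      unfolding \<kappa>_def using W by (intro mult_left_mono phi_tangent t ts d) auto
    moreover have "W * (phi d ts - ts powr (- \<kappa>) * (t - ts)) = W * phi d ts - (W * ts powr (- \<kappa>)) * (t - ts)"
      by (simp add: algebra_simps)
    moreover have "\<dots> = W * phi d ts - \<mu> / (2 * real d) * t + \<mu> / (2 * real d) * ts"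
      unfolding bal[folded \<kappa>_def] right_diff_distrib by linarith
    ultimately show ?thesis unfolding S_def by linarith
  qed
  have C0: "0 \<le> A * 16 powr \<kappa> * \<mu>" using A mu by simp
  have far: "glue d A p q z = phi d (nsq d z) - A * nsq d z powr (- \<kappa>)" if "q\<^sup>2 \<le> nsq d z" for z
  proof -
    have "\<not> nrm d z < q"
    proof
      assume "nrm d z < q"
      then have "(nrm d z)\<^sup>2 < q\<^sup>2" by (intro power_strict_mono) auto
      then show False using that by (simp add: nrm_power2)
    qed
    then show ?thesis using q by (simp add: glue_def cur_def \<kappa>_def)
  qed
  show "S - A * 16 powr (real d / 2) * \<mu> \<le> bowl d A p q \<mu> W z"
  \<comment> \<open>Near the origin \<open>glue\<close> need not follow \<open>phi\<close>. There
    the potential alone already reaches \<open>S\<close>, by \<open>phi_quarter\<close> and the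
    assumption \<open>16 * q\<^sup>2 \<le> ts\<close>.\<close>
  proof (cases "nsq d z \<le> ts / 16")
    case True
    let ?m = "max (nsq d z) (q\<^sup>2)"
    have "0 < q\<^sup>2" using q by simp
    then have m: "0 < ?m" "4 * ?m \<le> ts / 4" using True ts by (simp_all add: less_max_iff_disj)
    have "ts powr (- \<kappa>) * ts \<le> phi d (ts / 4) - phi d ts" unfolding \<kappa>_def by (rule phi_quarter[OF ts(1) d])
    also have "phi d (ts / 4) \<le> phi d (4 * ?m)" by (rule phi_antimono) (use m d in auto)
    also have "phi d (4 * ?m) \<le> glue d A p q z" by (rule glue_lower[OF d A q Q])
    finally have "W * (ts powr (- \<kappa>) * ts) \<le> W * (glue d A p q z - phi d ts)" using W by (intro mult_left_mono) auto
    then have "(W * ts powr (- \<kappa>)) * ts + W * phi d ts \<le> W * glue d A p q z" by (simp add: algebra_simps)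
    then have "S \<le> W * glue d A p q z" unfolding S_def bal[folded \<kappa>_def] .
    moreover have "0 \<le> \<mu> / (2 * real d) * nsq d z" using m0 by (intro mult_nonneg_nonneg) auto
    ultimately show ?thesis using C0 unfolding bowl_def \<kappa>_def by linarith
  next
    case False
    then have z: "q\<^sup>2 \<le> nsq d z" "0 < nsq d z" "ts / 16 \<le> nsq d z" using ts q by auto
    have "nsq d z powr (- \<kappa>) \<le> (ts / 16) powr (- \<kappa>)" by (rule powr_mono2') (use z ts k in auto)
    also have "(ts / 16) powr (- \<kappa>) = 16 powr \<kappa> * ts powr (- \<kappa>)" using ts by (simp add: powr_divide powr_minus_divide)
    finally have "(W * A) * nsq d z powr (- \<kappa>) \<le> (W * A) * (16 powr \<kappa> * ts powr (- \<kappa>))"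
      using W A by (intro mult_left_mono) auto
    also have "\<dots> = A * 16 powr \<kappa> * (W * ts powr (- \<kappa>))" by simp
    also have "\<dots> \<le> A * 16 powr \<kappa> * \<mu>" unfolding bal[folded \<kappa>_def] using A mle by (intro mult_left_mono) auto
    finally have "W * (A * nsq d z powr (- \<kappa>)) \<le> A * 16 powr \<kappa> * \<mu>" by (simp add: mult.assoc)
    then show ?thesis using tang[OF z(2)] unfolding bowl_def far[OF z(1)] \<kappa>_def[symmetric] right_diff_distrib by linarith
  qed
  assume r: "sqrt ts \<le> nrm d z" "nrm d z \<le> sqrt ts + 2"
  let ?t = "nsq d z"
  have st: "1 \<le> sqrt ts" "(sqrt ts)\<^sup>2 = ts" using ts by auto
  have t1: "ts \<le> ?t" using power_mono[OF r(1), of 2] st ts by (simp add: nrm_power2)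
  have t2: "?t \<le> (sqrt ts + 2)\<^sup>2" unfolding nrm_power2[symmetric] by (rule power_mono[OF r(2)]) simp
  have "q\<^sup>2 \<le> 16 * q\<^sup>2" by simp
  then have zq: "q\<^sup>2 \<le> ?t" using t1 ts by linarith
  have "(sqrt ts + 2)\<^sup>2 = ts + 4 * sqrt ts + 4" using st(2) by (simp add: power2_sum)
  then have "?t - ts \<le> 8 * sqrt ts" using t2 st(1) by linarith
  then have sq: "(?t - ts)\<^sup>2 \<le> (8 * sqrt ts)\<^sup>2" by (rule power_mono) (use t1 in simp)
  obtain \<xi> where xi: "min ?t ts \<le> \<xi>" "\<xi> \<le> max ?t ts"
    "phi d ?t = phi d ts - ts powr (- \<kappa>) * (?t - ts) + real d / 4 * \<xi> powr (- \<kappa> - 1) * (?t - ts)\<^sup>2"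
    using phi_taylor[of ?t ts d] t1 ts d unfolding \<kappa>_def by (metis less_le_trans)
  have xts: "ts \<le> \<xi>" using xi(1) t1 by simp
  have "real d / 4 * \<xi> powr (- \<kappa> - 1) * (?t - ts)\<^sup>2 \<le> real d / 4 * ts powr (- \<kappa> - 1) * (8 * sqrt ts)\<^sup>2"
    by (intro mult_mono mult_left_mono sq powr_mono2') (use xts ts k in auto)
  also have "\<dots> = 16 * real d * (ts * ts powr (- \<kappa> - 1))" using st by (simp add: power_mult_distrib)
  also have "ts * ts powr (- \<kappa> - 1) = ts powr (- \<kappa>)" by (rule powr_shift[OF ts(1)])
  finally have "phi d ?t \<le> phi d ts - ts powr (- \<kappa>) * (?t - ts) + 16 * real d * ts powr (- \<kappa>)" using xi(3) by linarith
  then have "W * phi d ?t \<le> W * (phi d ts - ts powr (- \<kappa>) * (?t - ts) + 16 * real d * ts powr (- \<kappa>))"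
    using W by (intro mult_left_mono) auto
  also have "\<dots> = W * phi d ts - (W * ts powr (- \<kappa>)) * (?t - ts) + 16 * real d * (W * ts powr (- \<kappa>))"
    by (simp add: algebra_simps)
  also have "\<dots> = W * phi d ts - \<mu> / (2 * real d) * (?t - ts) + 8 * \<mu>" unfolding bal[folded \<kappa>_def] using d by simp
  finally have "\<mu> / (2 * real d) * ?t + W * phi d ?t \<le> S + 8 * \<mu>" unfolding S_def right_diff_distrib by linarith
  moreover have "0 \<le> W * (A * ?t powr (- \<kappa>))" using W A by simp
  ultimately show "bowl d A p q \<mu> W z \<le> S + 8 * \<mu>"
    unfolding bowl_def far[OF zq] right_diff_distrib by linarith
qed

section \<open>The outer bound\<close>

lemma card_lball_ratio:
  fixes a :: real
  assumes d: "0 < d"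
  shows "((\<lambda>j. real (card (lball d (j + a))) / (unit_ball_vol (real d) * j ^ d)) \<longlongrightarrow> 1) at_top"
proof -
  have lim: "((\<lambda>j::real. ((j + b) / j) ^ d) \<longlongrightarrow> 1) at_top" for b
  proof -
    have "((\<lambda>j::real. (1 + b / j) ^ d) \<longlongrightarrow> (1 + 0) ^ d) at_top"
      by (intro tendsto_intros tendsto_divide_0[OF tendsto_const] filterlim_at_top_imp_at_infinity filterlim_ident)
    moreover have "eventually (\<lambda>j::real. (1 + b / j) ^ d = ((j + b) / j) ^ d) at_top"
      using eventually_gt_at_top[of 0] by eventually_elim (simp add: add_divide_distrib)
    ultimately show ?thesis using Lim_transform_eventually by fastforce
  qed
  have w: "0 < unit_ball_vol (real d)" by simp
  show ?thesis
  proof (rule tendsto_sandwich[OF _ _ lim[of "a - real d"] lim[of "a + real d"]])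
    show "eventually (\<lambda>j. ((j + (a - real d)) / j) ^ d \<le> real (card (lball d (j + a))) / (unit_ball_vol (real d) * j ^ d)) at_top"
      using eventually_gt_at_top[of "max 0 (real d - a)"]
    proof eventually_elim
      case (elim j)
      have "unit_ball_vol (real d) * (j + a - real d) ^ d \<le> real (card (lball d (j + a)))"
        by (rule card_lball_bounds(1)[OF d]) (use elim in simp)
      then have "unit_ball_vol (real d) * (j + (a - real d)) ^ d / (unit_ball_vol (real d) * j ^ d)
          \<le> real (card (lball d (j + a))) / (unit_ball_vol (real d) * j ^ d)"
        using elim w by (intro divide_right_mono) (auto simp: algebra_simps)
      then show ?case using w by (simp add: power_divide)
    qed
    show "eventually (\<lambda>j. real (card (lball d (j + a))) / (unit_ball_vol (real d) * j ^ d) \<le> ((j + (a + real d)) / j) ^ d) at_top"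
      using eventually_gt_at_top[of "max 0 (- a)"]
    proof eventually_elim
      case (elim j)
      have "real (card (lball d (j + a))) \<le> unit_ball_vol (real d) * (j + a + real d) ^ d"
        by (rule card_lball_bounds(2)[OF d]) (use elim in simp)
      then have "real (card (lball d (j + a))) / (unit_ball_vol (real d) * j ^ d)
          \<le> unit_ball_vol (real d) * (j + (a + real d)) ^ d / (unit_ball_vol (real d) * j ^ d)"
        using elim w by (intro divide_right_mono) (auto simp: algebra_simps)
      then show ?case using w by (simp add: power_divide)
    qed
  qed
qed

text \<open>The boundary layer of a large ball is a small fraction of its sites, and widening the
  ball by the fixed width \<open>B\<close> hardly changes its volume. How large it must be depends
  on \<delta> and \<open>B\<close>, not on \<open>n\<close>.\<close>

lemma good_radius:
  fixes B \<delta> :: real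
  assumes d: "0 < d" and \<delta>: "0 < \<delta>"
  shows "eventually (\<lambda>j. real (card (lball d (j + 1))) - real (card (lball d (j - 1))) \<le> \<delta> * real (card (lball d j))
    \<and> unit_ball_vol (real d) * (j + B) ^ d \<le> (1 + \<delta>) * real (card (lball d j)) \<and> 0 < real (card (lball d j))) at_top"
proof -
  let ?v = "\<lambda>j. unit_ball_vol (real d) * j ^ d"
  have w: "0 < unit_ball_vol (real d)" by simp
  have l0: "((\<lambda>j. real (card (lball d j)) / ?v j) \<longlongrightarrow> 1) at_top" using card_lball_ratio[OF d, of 0] by simp
  have l1: "((\<lambda>j. real (card (lball d (j + 1))) / ?v j) \<longlongrightarrow> 1) at_top" by (rule card_lball_ratio[OF d])
  have l2: "((\<lambda>j. real (card (lball d (j - 1))) / ?v j) \<longlongrightarrow> 1) at_top" using card_lball_ratio[OF d, of "-1"] by simp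
  have l3: "((\<lambda>j::real. ((j + B) / j) ^ d) \<longlongrightarrow> 1) at_top"
  proof -
    have "((\<lambda>j::real. (1 + B / j) ^ d) \<longlongrightarrow> (1 + 0) ^ d) at_top"
      by (intro tendsto_intros tendsto_divide_0[OF tendsto_const] filterlim_at_top_imp_at_infinity filterlim_ident)
    moreover have "eventually (\<lambda>j::real. (1 + B / j) ^ d = ((j + B) / j) ^ d) at_top"
      using eventually_gt_at_top[of 0] by eventually_elim (simp add: add_divide_distrib)
    ultimately show ?thesis using Lim_transform_eventually by fastforce
  qed
  have a: "((\<lambda>j. \<delta> * (real (card (lball d j)) / ?v j) - (real (card (lball d (j + 1))) / ?v j - real (card (lball d (j - 1))) / ?v j)) \<longlongrightarrow> \<delta> * 1 - (1 - 1)) at_top"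
    by (intro tendsto_intros l0 l1 l2)
  have b: "((\<lambda>j. (1 + \<delta>) * (real (card (lball d j)) / ?v j) - ((j + B) / j) ^ d) \<longlongrightarrow> (1 + \<delta>) * 1 - 1) at_top"
    by (intro tendsto_intros l0 l3)
  have ea: "eventually (\<lambda>j. 0 < \<delta> * (real (card (lball d j)) / ?v j) - (real (card (lball d (j + 1))) / ?v j - real (card (lball d (j - 1))) / ?v j)) at_top"
    by (rule order_tendstoD(1)[OF a]) (use \<delta> in simp)
  have eb: "eventually (\<lambda>j. 0 < (1 + \<delta>) * (real (card (lball d j)) / ?v j) - ((j + B) / j) ^ d) at_top"
    by (rule order_tendstoD(1)[OF b]) (use \<delta> in simp)
  have ec: "eventually (\<lambda>j. 0 < real (card (lball d j)) / ?v j) at_top"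
    by (rule order_tendstoD(1)[OF l0]) simp
  show ?thesis
    using ea eb ec eventually_gt_at_top[of 0]
  proof eventually_elim
    case (elim j)
    have v: "0 < ?v j" using elim w by simp
    have "real (card (lball d (j + 1))) / ?v j - real (card (lball d (j - 1))) / ?v j \<le> \<delta> * (real (card (lball d j)) / ?v j)" using elim by simp
    then have "(real (card (lball d (j + 1))) - real (card (lball d (j - 1)))) / ?v j \<le> (\<delta> * real (card (lball d j))) / ?v j"
      by (simp add: diff_divide_distrib)
    then have 1: "real (card (lball d (j + 1))) - real (card (lball d (j - 1))) \<le> \<delta> * real (card (lball d j))"
      using v by (simp only: divide_le_cancel)
    have "((j + B) / j) ^ d \<le> ((1 + \<delta>) * real (card (lball d j))) / ?v j" using elim by simp
    then have "((j + B) / j) ^ d * ?v j \<le> (1 + \<delta>) * real (card (lball d j))" using v by (simp add: pos_le_divide_eq)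
    moreover have "((j + B) / j) ^ d * ?v j = unit_ball_vol (real d) * (j + B) ^ d" using elim by (simp add: power_divide)
    moreover have "0 < real (card (lball d j))" using elim v by (simp add: zero_less_divide_iff)
    ultimately show ?case using 1 by simp
  qed
qed

section \<open>Sums over translated balls and the maximum principle\<close>

definition tr :: "nat \<Rightarrow> int list \<Rightarrow> int list \<Rightarrow> int list" where
  "tr d y w = map (\<lambda>i. y ! i + w ! i) [0..<d]"

lemma site_tr [simp]: "site d (tr d y w)"
  by (simp add: tr_def site_def)

lemma emb_tr: "i < d \<Longrightarrow> emb (tr d y w) i = emb y i + emb w i"
  by (simp add: emb_def tr_def)

lemma nrm_tr_diff: "nrm d (\<lambda>i. emb (tr d y w) i - emb y i) = nrm d (emb w)"
  by (rule nrm_cong) (simp add: emb_tr)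

lemma tr_inj: "site d w \<Longrightarrow> site d w' \<Longrightarrow> tr d y w = tr d y w' \<Longrightarrow> w = w'"
  by (auto simp: tr_def site_def list_eq_iff_nth_eq)

lemma inj_on_tr: "inj_on (tr d y) (lball d j)"
  by (rule inj_onI) (rule tr_inj[of d _ _ y], auto simp: in_lball)

lemma tr_upd:
  assumes "site d y" "i < d"
  shows "tr d (y[i := y ! i + c]) w = (tr d y w)[i := tr d y w ! i + c]"
  using assms by (auto simp: tr_def site_def list_eq_iff_nth_eq nth_list_update)

lemma in_tr_image:
  assumes y: "site d y" and z: "site d z"
  shows "z \<in> tr d y ` lball d j \<longleftrightarrow> nrm d (\<lambda>i. emb z i - emb y i) < j"
proof
  assume "z \<in> tr d y ` lball d j"
  then show "nrm d (\<lambda>i. emb z i - emb y i) < j" using nrm_tr_diff by (auto simp: in_lball)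
next
  assume l: "nrm d (\<lambda>i. emb z i - emb y i) < j"
  let ?w = "map (\<lambda>i. z ! i - y ! i) [0..<d]"
  have "z = tr d y ?w" using z by (auto simp: tr_def site_def list_eq_iff_nth_eq)
  moreover have "nrm d (emb ?w) = nrm d (\<lambda>i. emb z i - emb y i)" by (rule nrm_cong) (simp add: emb_def)
  ultimately show "z \<in> tr d y ` lball d j" using l by (auto simp: in_lball site_def)
qed

lemma card_tr_image: "card (tr d y ` lball d j) = card (lball d j)"
  by (rule card_image[OF inj_on_tr])

lemma tr_image_self: "site d y \<Longrightarrow> 0 < j \<Longrightarrow> y \<in> tr d y ` lball d j"
  by (simp add: in_tr_image nrm_def nsq_def)

text \<open>A sum rather than a mean, so that for nonnegative \<open>u\<close> it dominates
  \<open>u y\<close> itself; the division by the number of sites is made where needed.\<close>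

definition avg :: "nat \<Rightarrow> real \<Rightarrow> (int list \<Rightarrow> real) \<Rightarrow> int list \<Rightarrow> real" where
  "avg d j u y = (\<Sum>w\<in>lball d j. u (tr d y w))"

lemma avg_image: "avg d j u y = (\<Sum>z\<in>tr d y ` lball d j. u z)"
  unfolding avg_def by (simp add: sum.reindex[OF inj_on_tr])

lemma lap_avg:
  assumes y: "site d y"
  shows "lap d (avg d j u) y = avg d j (lap d u) y"
proof -
  have "lap d (avg d j u) y = (\<Sum>i<d. avg d j u (y[i := y ! i + 1]) + avg d j u (y[i := y ! i - 1]) - 2 * avg d j u y)"
    by (rule lap_coord[OF y])
  also have "\<dots> = (\<Sum>i<d. \<Sum>w\<in>lball d j. u ((tr d y w)[i := tr d y w ! i + 1]) + u ((tr d y w)[i := tr d y w ! i - 1]) - 2 * u (tr d y w))"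
    using tr_upd[OF y, of _ 1] tr_upd[OF y, of _ "-1"]
    by (intro sum.cong refl) (simp add: avg_def sum.distrib sum_subtractf sum_distrib_left)
  also have "\<dots> = (\<Sum>w\<in>lball d j. \<Sum>i<d. u ((tr d y w)[i := tr d y w ! i + 1]) + u ((tr d y w)[i := tr d y w ! i - 1]) - 2 * u (tr d y w))"
    by (rule sum.swap)
  also have "\<dots> = avg d j (lap d u) y" unfolding avg_def by (simp add: lap_coord)
  finally show ?thesis .
qed

text \<open>Among the maximisers one with the largest coordinate 0 is taken. The neighbour one step
  further has a strictly smaller value and no neighbour a larger one, so the Laplacian is negative
  there.\<close>

lemma max_principle:
  fixes f :: "int list \<Rightarrow> real"
  assumes D: "finite D" "\<And>y. y \<in> D \<Longrightarrow> site d y" and d: "0 < d"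
    and sub: "\<And>y. y \<in> D \<Longrightarrow> 0 \<le> lap d f y"
    and bd: "\<And>y z. y \<in> D \<Longrightarrow> z \<in> nbrs d y \<Longrightarrow> z \<notin> D \<Longrightarrow> f z \<le> C"
    and y: "y \<in> D"
  shows "f y \<le> C"
proof (rule ccontr)
  assume "\<not> f y \<le> C"
  define m where "m = Max (f ` D)"
  have m: "f z \<le> m" if "z \<in> D" for z using D that by (simp add: m_def)
  have mC: "C < m" using m[OF y] \<open>\<not> f y \<le> C\<close> by linarith
  define E where "E = {z \<in> D. f z = m}"
  have "m \<in> f ` D" unfolding m_def using D y by (intro Max_in) auto
  then have E: "finite E" "E \<noteq> {}" using D by (auto simp: E_def)
  define k where "k = Max ((\<lambda>z. z ! 0) ` E)"
  have "k \<in> (\<lambda>z. z ! 0) ` E" unfolding k_def using E by (intro Max_in) auto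
  then obtain z where z: "z \<in> E" "z ! 0 = k" by blast
  have kmax: "v ! 0 \<le> k" if "v \<in> E" for v using E that by (simp add: k_def)
  have zD: "z \<in> D" "f z = m" and s: "site d z" using z D by (auto simp: E_def)
  define v where "v = z[0 := z ! 0 + 1]"
  have vn: "v \<in> nbrs d z" using s d unfolding nbrs_def adjacent_def v_def by auto
  have "v ! 0 = k + 1" using s d z by (simp add: v_def site_def)
  then have "v \<notin> E" using kmax[of v] by auto
  then have fv: "f v < m"
    using m[of v] bd[OF zD(1) vn] mC by (cases "v \<in> D") (auto simp: E_def)
  have le: "f x \<le> m" if "x \<in> nbrs d z" for x
    using m[of x] bd[OF zD(1) that] mC by (cases "x \<in> D") auto
  have "lap d f z < (\<Sum>x\<in>nbrs d z. 0)" unfolding lap_def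
    by (rule sum_strict_mono_ex1) (use le fv vn zD in auto)
  then show False using sub[OF zD(1)] by simp
qed

section \<open>Estimates for a stabilising sequence\<close>

context
  fixes d n :: nat and H :: int and xs :: "int list list"
  assumes d2: "2 \<le> d" and H: "1 - int d \<le> H"
    and leg: "legal d (init_config d n H) xs"
    and stab: "\<And>y. site d y \<Longrightarrow> foldl (topple d) (init_config d n H) xs y < 2 * int d"
begin

abbreviation (input) dens where "dens \<equiv> real d + real_of_int H"

lemma dens_ge_1: "1 \<le> dens"
  using H by linarith

lemma cap_pos: "1 \<le> cap d H"
  using H d2 by linarith

lemma lap_odo_le: "site d y \<Longrightarrow> lap d (odo xs) y \<le> cap d H - src d n y"
proof -
  assume y: "site d y"
  have "real_of_int (foldl (topple d) (init_config d n H) xs y) \<le> 2 * real d - 1" using stab[OF y] by linarith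
  then show ?thesis using lap_odo[OF leg y] by linarith
qed

lemma lap_odo_le_cap: "site d y \<Longrightarrow> lap d (odo xs) y \<le> cap d H"
  using lap_odo_le[of y] by (auto simp: src_def split: if_splits)

definition nbhd :: "int list set" where
  "nbhd = set xs \<union> (\<Union>y\<in>set xs. nbrs d y)"

lemma nbhd: "finite nbhd" "\<And>y. y \<in> nbhd \<Longrightarrow> site d y" "set xs \<subseteq> nbhd" "\<And>y. y \<in> set xs \<Longrightarrow> nbrs d y \<subseteq> nbhd"
  using legal_sites[OF leg] nbrs_site unfolding nbhd_def by auto

text \<open>\<open>weighted_mass_lower\<close> with the indicator of the translated ball as weight.
  The weight changes only along edges that start in the shell \<open>Sh\<close> of unit thickness on
  either side of the sphere, which gives the boundary term.\<close>

lemma avg_lap_lower: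
  assumes y: "site d y" and sub: "tr d y ` lball d j \<subseteq> set xs"
  shows "dens * real (card (lball d j)) - real d * (real (card (lball d (j + 1))) - real (card (lball d (j - 1))))
      - (if nrm d (emb y) < j then real n else 0) \<le> lap d (avg d j (odo xs)) y"
proof -
  let ?B = "tr d y ` lball d j" and ?T = "set xs" and ?u = "odo xs"
  define \<psi> where "\<psi> z = (if z \<in> ?B then 1 else 0 :: real)" for z
  have fB: "finite ?B" by (simp add: finite_lball)
  have main: "dens * (\<Sum>z\<in>?T. \<psi> z) - (\<Sum>z\<in>?T. \<Sum>v\<in>nbrs d z. \<bar>\<psi> z - \<psi> v\<bar>) / 2
    \<le> (\<Sum>z\<in>nbhd. \<psi> z * (lap d ?u z + src d n z))"
    by (rule weighted_mass_lower[OF leg nbhd]) (auto simp: \<psi>_def)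
  have s1: "(\<Sum>z\<in>?T. \<psi> z) = real (card (lball d j))"
    using sub fB by (simp add: \<psi>_def sum.If_cases Int_absorb1 card_tr_image)
  have s2: "(\<Sum>z\<in>nbhd. \<psi> z * (lap d ?u z + src d n z)) = (\<Sum>z\<in>?B. lap d ?u z) + (\<Sum>z\<in>?B. src d n z)"
  proof -
    have "(\<Sum>z\<in>nbhd. \<psi> z * (lap d ?u z + src d n z)) = (\<Sum>z\<in>?B. lap d ?u z + src d n z)"
      by (rule sum.mono_neutral_cong_right) (use nbhd sub in \<open>auto simp: \<psi>_def\<close>)
    then show ?thesis by (simp add: sum.distrib)
  qed
  have s3: "(\<Sum>z\<in>?B. src d n z) \<le> (if nrm d (emb y) < j then real n else 0)"
  proof -
    have "(\<Sum>z\<in>?B. src d n z) = (if origin d \<in> ?B then real n else 0)"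
      unfolding src_def using fB by (simp add: sum.delta)
    moreover have "origin d \<in> ?B \<longleftrightarrow> nrm d (emb y) < j"
      using in_tr_image[OF y site_origin, of j] nrm_emb_origin_diff[of d y] by simp
    ultimately show ?thesis by simp
  qed
  define Sh where "Sh = {z \<in> ?T. j - 1 \<le> nrm d (\<lambda>i. emb z i - emb y i) \<and> nrm d (\<lambda>i. emb z i - emb y i) < j + 1}"
  have in1: "(\<Sum>v\<in>nbrs d z. \<bar>\<psi> z - \<psi> v\<bar>) \<le> (if z \<in> Sh then 2 * real d else 0)" if z: "z \<in> ?T" for z
  proof -
    have sz: "site d z" using legal_sites[OF leg z] .
    show ?thesis
    proof (cases "z \<in> Sh")
      case True
      have "(\<Sum>v\<in>nbrs d z. \<bar>\<psi> z - \<psi> v\<bar>) \<le> (\<Sum>v\<in>nbrs d z. 1)" by (rule sum_mono) (simp add: \<psi>_def)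
      then show ?thesis using True card_nbrs[OF sz] by simp
    next
      case False
      have "\<psi> z = \<psi> v" if v: "v \<in> nbrs d z" for v
      proof -
        have sv: "site d v" using nbrs_site[OF v] by simp
        have "nrm d (\<lambda>i. emb z i - emb y i) < j - 1 \<or> j + 1 \<le> nrm d (\<lambda>i. emb z i - emb y i)"
          using False z by (auto simp: Sh_def)
        moreover have "\<bar>nrm d (\<lambda>i. emb v i - emb y i) - nrm d (\<lambda>i. emb z i - emb y i)\<bar> \<le> 1" by (rule nrm_nbr[OF v])
        ultimately have "nrm d (\<lambda>i. emb z i - emb y i) < j \<longleftrightarrow> nrm d (\<lambda>i. emb v i - emb y i) < j" by linarith
        then show ?thesis unfolding \<psi>_def in_tr_image[OF y sz] in_tr_image[OF y sv] by simp
      qed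
      then show ?thesis using False by simp
    qed
  qed
  have "(\<Sum>z\<in>?T. \<Sum>v\<in>nbrs d z. \<bar>\<psi> z - \<psi> v\<bar>) \<le> (\<Sum>z\<in>?T. if z \<in> Sh then 2 * real d else 0)"
    by (rule sum_mono[OF in1])
  also have "\<dots> = 2 * real d * real (card Sh)"
    by (simp add: sum.If_cases Sh_def Int_def)
  also have "\<dots> \<le> 2 * real d * (real (card (lball d (j + 1))) - real (card (lball d (j - 1))))"
  proof (rule mult_left_mono)
    have "Sh \<subseteq> tr d y ` lball d (j + 1) - tr d y ` lball d (j - 1)"
      using legal_sites[OF leg] in_tr_image[OF y] by (auto simp: Sh_def nrm_tr_diff in_lball)
    then have "card Sh \<le> card (tr d y ` lball d (j + 1) - tr d y ` lball d (j - 1))"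
      by (intro card_mono) (auto simp: finite_lball)
    moreover have "tr d y ` lball d (j - 1) \<subseteq> tr d y ` lball d (j + 1)" by (auto simp: in_lball)
    then have "card (tr d y ` lball d (j + 1) - tr d y ` lball d (j - 1)) = card (lball d (j + 1)) - card (lball d (j - 1))"
      by (subst card_Diff_subset) (auto simp: finite_lball card_tr_image)
    moreover have "card (lball d (j - 1)) \<le> card (lball d (j + 1))"
      by (rule card_mono[OF finite_lball]) (auto simp: in_lball)
    ultimately show "real (card Sh) \<le> real (card (lball d (j + 1))) - real (card (lball d (j - 1)))" by linarith
  qed simp
  finally have s4: "(\<Sum>z\<in>?T. \<Sum>v\<in>nbrs d z. \<bar>\<psi> z - \<psi> v\<bar>) / 2 \<le> real d * (real (card (lball d (j + 1))) - real (card (lball d (j - 1))))" by simp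
  have "lap d (avg d j ?u) y = (\<Sum>z\<in>?B. lap d ?u z)" unfolding lap_avg[OF y] avg_image ..
  then show ?thesis using main s1 s2 s3 s4 by simp
qed

text \<open>If the ball contains an untoppled site, the odometer is zero there and
  \<open>growth_from_zero\<close> bounds it on the whole ball, whose diameter is at most
  \<open>2 * j\<close>.\<close>

lemma avg_small:
  assumes y: "site d y" and nsub: "\<not> tr d y ` lball d j \<subseteq> set xs"
  shows "avg d j (odo xs) y \<le> real (card (lball d j)) * (cap d H * (2 * real d + 1) ^ nat \<lceil>real d * (2 * j)\<rceil>)"
proof -
  from nsub obtain w0 where w0: "w0 \<in> lball d j" "tr d y w0 \<notin> set xs" by blast
  let ?L = "nat \<lceil>real d * (2 * j)\<rceil>"
  have "odo xs (tr d y w) \<le> cap d H * (2 * real d + 1) ^ ?L" if w: "w \<in> lball d j" for w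
  proof -
    have "nrm d (\<lambda>i. emb (tr d y w) i - emb (tr d y w0) i) = nrm d (\<lambda>i. emb w i - emb w0 i)"
      by (rule nrm_cong) (simp add: emb_tr)
    also have "\<dots> \<le> nrm d (\<lambda>i. emb w i - 0) + nrm d (\<lambda>i. 0 - emb w0 i)" by (rule nrm_diff_triangle)
    also have "\<dots> \<le> 2 * j" using w w0 nrm_minus[of d "emb w0" "\<lambda>_. 0"] by (simp add: in_lball)
    finally have "real (l1 d (tr d y w) (tr d y w0)) \<le> real d * (2 * j)" by (rule l1_le_nrm)
    then have l: "l1 d (tr d y w) (tr d y w0) \<le> ?L" by linarith
    have "odo xs (tr d y w) \<le> cap d H * (2 * real d + 1) ^ l1 d (tr d y w) (tr d y w0)"
      by (rule growth_from_zero[where u = "odo xs" and L = ?L])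
        (use w0 lap_odo_le_cap cap_pos l odo_eq_0 in auto)
    also have "\<dots> \<le> cap d H * (2 * real d + 1) ^ ?L"
      by (intro mult_left_mono power_increasing l) (use cap_pos in auto)
    finally show ?thesis .
  qed
  then have "avg d j (odo xs) y \<le> (\<Sum>w\<in>lball d j. cap d H * (2 * real d + 1) ^ ?L)"
    unfolding avg_def by (rule sum_mono)
  then show ?thesis by simp
qed

text \<open>The maximum principle acts twice. Comparison with \<open>bowl\<close> on all of
  \<open>D\<close> bounds the averaged odometer by \<open>bowl - S\<close> plus a constant, hence by
  a constant just outside the balance radius. From there on the averaged odometer is subharmonic by
  itself, and the bound spreads outwards.\<close>

lemma odo_bounded_outside:
  fixes A B j \<mu> ts :: real
  defines "q \<equiv> j + B" and "N \<equiv> real (card (lball d j))" and "C1 \<equiv> cap d H * (2 * real d + 1) ^ nat \<lceil>real d * (2 * j)\<rceil>"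
  assumes A: "0 < A" and B: "1 \<le> B" "B \<le> j" and Q: "A * 16 powr (real d / 2) \<le> q\<^sup>2"
    and glue: "\<And>z. dlap d (glue d A j q) z \<le> 0"
      "\<And>z. nrm d z < j \<Longrightarrow> dlap d (glue d A j q) z \<le> - (2 * real d) * (q\<^sup>2) powr (- (real d / 2))"
    and N: "0 < N" and mu: "0 < \<mu>"
    and bdry: "real d * (real (card (lball d (j + 1))) - real (card (lball d (j - 1)))) \<le> (dens - \<mu>) * N"
    and n: "1 \<le> n" and ts: "16 * q\<^sup>2 \<le> ts" "1 \<le> ts" "ts powr (real d / 2) = real n * q ^ d / (N * \<mu>)"
    and y: "site d y" "sqrt ts + 1 \<le> nrm d (emb y)"
  shows "odo xs y \<le> N * (C1 + A * 16 powr (real d / 2) * \<mu> + 8 * \<mu>)"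
proof -
  let ?u = "odo xs" and ?K = "A * 16 powr (real d / 2) * \<mu>"
  \<comment> \<open>Chosen so that \<open>W\<close> times the Laplacian -2d q^(-d) of the inner
    paraboloid is \<open>- n / N\<close>, which cancels the averaged source.\<close>
  define W where "W = real n * q ^ d / (2 * real d * N)"
  have q0: "0 < q" "0 < j" using B by (auto simp: q_def)
  have ts0: "0 < ts" using ts by simp
  have W0: "0 < W" using n q0 d2 N by (simp add: W_def)
  have qd: "(q\<^sup>2) powr (- (real d / 2)) = inverse (q ^ d)"
  proof -
    have "q\<^sup>2 = q powr 2" using q0 by (simp add: powr_numeral)
    then have "(q\<^sup>2) powr (- (real d / 2)) = q powr (- real d)" by (simp only: powr_powr) simp
    then show ?thesis using q0 by (simp add: powr_minus powr_realpow)
  qed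
  have bal: "W * ts powr (- (real d / 2)) = \<mu> / (2 * real d)"
    unfolding W_def powr_minus ts(3) using n q0 d2 N mu by (simp add: field_simps)
  define S where "S = \<mu> / (2 * real d) * ts + W * phi d ts"
  have jq: "j \<le> q" "q \<le> 2 * j" using B by (auto simp: q_def)
  have low: "S - ?K \<le> bowl d A j q \<mu> W z" for z
    unfolding S_def by (rule bowl_bounds(1)[OF d2 A q0(2) jq Q mu W0 ts0 ts(1,2) bal])
  have up: "bowl d A j q \<mu> W z \<le> S + 8 * \<mu>" if "sqrt ts \<le> nrm d z" "nrm d z \<le> sqrt ts + 2" for z
    unfolding S_def by (rule bowl_bounds(2)[OF d2 A q0(2) jq Q mu W0 ts0 ts(1,2) bal that])
  have lapb: "lap d (\<lambda>y. bowl d A j q \<mu> W (emb y)) y \<le> \<mu> - (if nrm d (emb y) < j then real n / N else 0)" if y: "site d y" for y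
  proof -
    have "lap d (\<lambda>y. bowl d A j q \<mu> W (emb y)) y = dlap d (bowl d A j q \<mu> W) (emb y)"
      using lap_emb_diff[OF y, of "bowl d A j q \<mu> W" "\<lambda>_. 0"] by simp
    also have "\<dots> = dlap d (\<lambda>z. \<mu> / (2 * real d) * nsq d z + W * glue d A j q z + 0 * 0) (emb y)"
      by (simp add: bowl_def[abs_def])
    also have "\<dots> = \<mu> / (2 * real d) * dlap d (nsq d) (emb y) + W * dlap d (glue d A j q) (emb y) + 0 * dlap d (\<lambda>_. 0) (emb y)"
      by (rule dlap_lin)
    also have "\<dots> = \<mu> + W * dlap d (glue d A j q) (emb y)" using d2 by (simp add: dlap_nsq)
    also have "\<dots> \<le> \<mu> - (if nrm d (emb y) < j then real n / N else 0)"
    proof (cases "nrm d (emb y) < j")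
      case True
      have "W * dlap d (glue d A j q) (emb y) \<le> W * (- (2 * real d) * (q\<^sup>2) powr (- (real d / 2)))"
        using W0 by (intro mult_left_mono glue(2)[OF True]) auto
      also have "\<dots> = - (real n / N)" unfolding qd W_def using q0 d2 N by (simp add: field_simps)
      finally show ?thesis using True by simp
    next
      case False
      then show ?thesis using glue(1)[of "emb y"] W0 by (simp add: mult_nonneg_nonpos)
    qed
    finally show ?thesis .
  qed
  define g where "g y = avg d j ?u y / N" for y
  have lapg_eq: "lap d g y = lap d (avg d j ?u) y / N" for y
    unfolding g_def[abs_def] lap_def by (simp add: sum_divide_distrib diff_divide_distrib)
  define D where "D = {y. site d y \<and> tr d y ` lball d j \<subseteq> set xs}"
  have D: "finite D" "\<And>y. y \<in> D \<Longrightarrow> site d y"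
  proof -
    have "D \<subseteq> set xs" using tr_image_self q0 by (auto simp: D_def)
    then show "finite D" by (rule finite_subset) simp
  qed (simp add: D_def)
  have lapg: "\<mu> - (if nrm d (emb y) < j then real n / N else 0) \<le> lap d g y" if y: "y \<in> D" for y
  proof -
    have "dens * N - (dens - \<mu>) * N - (if nrm d (emb y) < j then real n else 0) \<le> lap d (avg d j ?u) y"
      using avg_lap_lower[of y j] y bdry unfolding N_def[symmetric] D_def by auto
    then have "(\<mu> * N - (if nrm d (emb y) < j then real n else 0)) / N \<le> lap d (avg d j ?u) y / N"
      using N by (intro divide_right_mono) (auto simp: algebra_simps)
    then show ?thesis unfolding lapg_eq using N by (simp add: diff_divide_distrib split: if_splits)
  qed
  have off: "g y \<le> C1" if "site d y" "y \<notin> D" for y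
    using avg_small[of y j] that N unfolding g_def D_def C1_def N_def[symmetric]
    by (simp add: divide_le_eq mult.commute)
  have C10: "0 \<le> C1" using cap_pos by (simp add: C1_def)
  define f where "f y = g y - bowl d A j q \<mu> W (emb y)" for y
  have foff: "f y \<le> C1 - S + ?K" if "site d y" "y \<notin> D" for y
    using off[OF that] low[of "emb y"] by (simp add: f_def)
  have fall: "f y \<le> C1 - S + ?K" if y: "site d y" for y
  proof (cases "y \<in> D")
    case True
    show ?thesis
    proof (rule max_principle[OF D _ _ _ True])
      show "0 < d" using d2 by simp
      show "0 \<le> lap d f z" if "z \<in> D" for z
      proof -
        have "lap d f z = lap d g z - lap d (\<lambda>y. bowl d A j q \<mu> W (emb y)) z"
          unfolding f_def[abs_def] lap_def sum_subtractf[symmetric] by (rule sum.cong) auto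
        then show ?thesis using lapg[OF that] lapb[OF D(2)[OF that]] by linarith
      qed
      show "f z \<le> C1 - S + ?K" if "v \<in> D" "z \<in> nbrs d v" "z \<notin> D" for v z
        using foff that nbrs_site by blast
    qed
  qed (rule foff[OF y])
  let ?C = "C1 + ?K + 8 * \<mu>"
  have K0: "0 \<le> ?K" using A mu by simp
  \<comment> \<open>Starts one step beyond sqrt \<open>ts\<close>, so that a step from
    \<open>D2\<close> to a site of \<open>D\<close> outside it lands where the upper bound on
    \<open>bowl\<close> holds.\<close>
  define D2 where "D2 = {y \<in> D. sqrt ts + 1 \<le> nrm d (emb y)}"
  have jts: "j \<le> sqrt ts"
  proof (rule real_le_rsqrt)
    have "j\<^sup>2 \<le> q\<^sup>2" using jq q0 by (intro power_mono) auto
    then show "j\<^sup>2 \<le> ts" using ts(1) zero_le_power2[of q] by linarith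
  qed
  have gy: "g y \<le> ?C"
  proof (cases "y \<in> D2")
    case True
    show ?thesis
    proof (rule max_principle[OF _ _ _ _ _ True])
      show "finite D2" "\<And>y. y \<in> D2 \<Longrightarrow> site d y" using D by (auto simp: D2_def)
      show "0 < d" using d2 by simp
      show "0 \<le> lap d g z" if "z \<in> D2" for z
        using lapg[of z] that mu jts by (auto simp: D2_def split: if_splits)
      show "g z \<le> ?C" if v: "v \<in> D2" and z: "z \<in> nbrs d v" "z \<notin> D2" for v z
      proof (cases "z \<in> D")
        case False
        then show ?thesis using off[of z] nbrs_site[OF z(1)] K0 mu by auto
      next
        case True
        then have "nrm d (emb z) < sqrt ts + 1" using z by (simp add: D2_def)
        moreover have "sqrt ts \<le> nrm d (emb z)" using nrm_nbr0[OF z(1)] v unfolding D2_def mem_Collect_eq by linarith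
        ultimately have "bowl d A j q \<mu> W (emb z) \<le> S + 8 * \<mu>" by (intro up) auto
        then show ?thesis using fall[OF D(2)[OF True]] unfolding f_def by linarith
      qed
    qed
  next
    case False
    then have "y \<notin> D" using y by (simp add: D2_def)
    then show ?thesis using off[OF y(1)] K0 mu by simp
  qed
  have "?u y \<le> avg d j ?u y"
    unfolding avg_image by (rule member_le_sum) (use tr_image_self[OF y(1) q0(2)] finite_lball in auto)
  also have "\<dots> = N * g y" using N by (simp add: g_def)
  also have "\<dots> \<le> N * ?C" using gy N by (intro mult_left_mono) auto
  finally show ?thesis by simp
qed

text \<open>The odometer is paired with |y|^2 as in \<open>legal_length_bound\<close>, now with
  explicit factors: norms are at most \<open>n\<close>, at most (2d + 1) n sites matter, and the
  Laplacian is at most \<open>cap d H\<close>.\<close>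

lemma length_bound: "real (length xs) \<le> (2 * real d + 1) * cap d H * real n ^ 3"
proof (cases "xs = []")
  case True
  then show ?thesis using cap_pos by simp
next
  case False
  let ?u = "odo xs"
  have cn: "card (set xs) \<le> n" by (rule card_toppled_le[OF leg H])
  have H': "2 - 2 * int d \<le> H" using H d2 by linarith
  have nr: "nrm d (emb y) \<le> real n" if y: "y \<in> nbhd" for y
  proof (cases "y \<in> set xs")
    case True
    then show ?thesis using toppled_nrm[OF leg True H'] cn by linarith
  next
    case False
    then obtain x where x: "x \<in> set xs" "y \<in> nbrs d x" using y by (auto simp: nbhd_def)
    then show ?thesis using toppled_nrm[OF leg x(1) H'] nrm_nbr0[OF x(2)] cn by linarith
  qed
  have cF: "card nbhd \<le> (2 * d + 1) * n"
  proof -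
    have "card nbhd \<le> card (set xs) + card (\<Union>y\<in>set xs. nbrs d y)" unfolding nbhd_def by (rule card_Un_le)
    also have "card (\<Union>y\<in>set xs. nbrs d y) \<le> (\<Sum>y\<in>set xs. card (nbrs d y))" by (rule card_UN_le) simp
    also have "\<dots> = 2 * d * card (set xs)" using legal_sites[OF leg] by (simp add: card_nbrs)
    finally have "card nbhd \<le> (2 * d + 1) * card (set xs)" by simp
    also have "\<dots> \<le> (2 * d + 1) * n" by (rule mult_left_mono[OF cn]) simp
    finally show ?thesis .
  qed
  have "2 * real d * (\<Sum>y\<in>nbhd. ?u y) = (\<Sum>y\<in>nbhd. ?u y * lap d (\<lambda>y. nsq d (emb y)) y)"
    unfolding sum_distrib_left by (rule sum.cong) (use nbhd in \<open>auto simp: lap_nsq_emb\<close>)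
  also have "\<dots> = (\<Sum>y\<in>nbhd. nsq d (emb y) * lap d ?u y)"
    using sum_by_parts[OF nbhd, of ?u "\<lambda>y. nsq d (emb y)"] by (simp add: odo_eq_0)
  also have "\<dots> \<le> (\<Sum>y\<in>nbhd. (real n)\<^sup>2 * cap d H)"
  proof (rule sum_mono)
    fix y assume y: "y \<in> nbhd"
    have "nsq d (emb y) * lap d ?u y \<le> nsq d (emb y) * cap d H"
      by (rule mult_left_mono[OF lap_odo_le_cap[OF nbhd(2)[OF y]]]) simp
    also have "\<dots> \<le> (real n)\<^sup>2 * cap d H"
      unfolding nrm_power2[symmetric] using nr[OF y] cap_pos by (intro mult_right_mono power_mono) auto
    finally show "nsq d (emb y) * lap d ?u y \<le> (real n)\<^sup>2 * cap d H" .
  qed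
  also have "\<dots> = real (card nbhd) * ((real n)\<^sup>2 * cap d H)" by simp
  also have "\<dots> \<le> real ((2 * d + 1) * n) * ((real n)\<^sup>2 * cap d H)"
    using cF cap_pos by (intro mult_right_mono) (auto simp del: of_nat_mult of_nat_add)
  also have "\<dots> = (2 * real d + 1) * cap d H * real n ^ 3" by (simp add: power2_eq_square power3_eq_cube algebra_simps)
  finally have "2 * real d * (\<Sum>y\<in>nbhd. ?u y) \<le> (2 * real d + 1) * cap d H * real n ^ 3" .
  moreover have "(\<Sum>y\<in>nbhd. ?u y) = real (length xs)"
    unfolding odo_def using sum_count_set[OF nbhd(3,1)] by (metis of_nat_sum)
  moreover have "1 * real (length xs) \<le> 2 * real d * real (length xs)"
    by (rule mult_right_mono) (use d2 in auto)
  ultimately show ?thesis by simp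
qed

text \<open>The weight exp(-l |y - x|) changes by a relative amount of at most \<eta> along an edge.
  Beyond \<open>R\<close> the odometer is at most \<open>C\<close>, and elsewhere the weight is at
  most exp(-l g). Pairing and mass bound together leave half of the weighted mass, which is at least
  the weight 1 at \<open>x\<close>.\<close>

lemma exponential_decay:
  assumes C: "0 \<le> C" "\<And>y. site d y \<Longrightarrow> R \<le> nrm d (emb y) \<Longrightarrow> odo xs y \<le> C" and R: "0 \<le> R" "0 \<le> g"
    and x: "x \<in> set xs" "R + g \<le> nrm d (emb x)"
  shows "1 / 2 \<le> (real (length xs) + real n) * exp (- (ln (1 + 1 / (2 * real d * (1 + 2 * C))) * g))"
proof -
  \<comment> \<open>The gradient term costs d \<eta> and the Laplacian of the weight 2d \<eta> C per
    unit of weighted mass; this choice makes the sum 1/2, against a density of at least 1.\<close>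
  define \<eta> where "\<eta> = 1 / (2 * real d * (1 + 2 * C))"
  define l where "l = ln (1 + \<eta>)"
  let ?u = "odo xs" and ?T = "set xs"
  have e0: "0 < \<eta>" using C d2 by (simp add: \<eta>_def)
  have e1: "real d * \<eta> * (1 + 2 * C) = 1 / 2"
  proof -
    define a where "a = real d * (1 + 2 * C)"
    have "0 < a" using C d2 by (simp add: a_def)
    moreover have "\<eta> = 1 / (2 * a)" by (simp add: \<eta>_def a_def mult.assoc)
    ultimately have "a * \<eta> = 1 / 2" by simp
    then show ?thesis by (simp add: a_def mult_ac)
  qed
  have e2: "2 * real d * \<eta> \<le> 1"
  proof -
    have "real d * \<eta> * 1 \<le> real d * \<eta> * (1 + 2 * C)" using C e0 by (intro mult_left_mono) auto
    then show ?thesis using e1 by simp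
  qed
  have l0: "0 < l" "exp l = 1 + \<eta>" using e0 by (auto simp: l_def)
  define r where "r y = nrm d (\<lambda>i. emb y i - emb x i)" for y
  define \<psi> where "\<psi> y = exp (- (l * r y))" for y
  have p0: "0 < \<psi> y" for y by (simp add: \<psi>_def)
  have nb: "\<bar>\<psi> y - \<psi> z\<bar> \<le> \<eta> * \<psi> y" if z: "z \<in> nbrs d y" for y z
  proof -
    have dr: "\<bar>r z - r y\<bar> \<le> 1" unfolding r_def by (rule nrm_nbr[OF z])
    have pz: "\<psi> z = \<psi> y * exp (l * (r y - r z))"
      unfolding \<psi>_def exp_add[symmetric] by (simp add: algebra_simps)
    have "l * (r y - r z) \<le> l * 1" "l * (- 1) \<le> l * (r y - r z)"
      using dr l0 by (intro mult_left_mono; simp add: abs_le_iff)+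
    then have b: "exp (l * (r y - r z)) \<le> exp l" "exp (- l) \<le> exp (l * (r y - r z))" by auto
    have "1 - \<eta> \<le> exp (- l)"
    proof -
      have "(1 - \<eta>) * (1 + \<eta>) \<le> 1" by (simp add: algebra_simps)
      then show ?thesis using e0 l0 by (simp add: exp_minus field_simps)
    qed
    then have "\<bar>1 - exp (l * (r y - r z))\<bar> \<le> \<eta>" using b l0(2) unfolding abs_le_iff by linarith
    then have "\<psi> y * \<bar>1 - exp (l * (r y - r z))\<bar> \<le> \<psi> y * \<eta>" using p0[of y] by (intro mult_left_mono) auto
    moreover have "\<psi> y - \<psi> z = \<psi> y * (1 - exp (l * (r y - r z)))" unfolding pz by (simp add: algebra_simps)
    ultimately show ?thesis using p0[of y] by (simp add: abs_mult mult.commute)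
  qed
  have sT: "site d y" if "y \<in> ?T" for y using legal_sites[OF leg that] .
  have lower: "dens * (\<Sum>y\<in>?T. \<psi> y) - real d * \<eta> * (\<Sum>y\<in>?T. \<psi> y) \<le> (\<Sum>y\<in>nbhd. \<psi> y * (lap d ?u y + src d n y))"
  proof -
    have "(\<Sum>y\<in>?T. \<Sum>z\<in>nbrs d y. \<bar>\<psi> y - \<psi> z\<bar>) \<le> (\<Sum>y\<in>?T. 2 * real d * (\<eta> * \<psi> y))"
    proof (rule sum_mono)
      fix y assume y: "y \<in> ?T"
      have "(\<Sum>z\<in>nbrs d y. \<bar>\<psi> y - \<psi> z\<bar>) \<le> (\<Sum>z\<in>nbrs d y. \<eta> * \<psi> y)" by (rule sum_mono[OF nb])
      then show "(\<Sum>z\<in>nbrs d y. \<bar>\<psi> y - \<psi> z\<bar>) \<le> 2 * real d * (\<eta> * \<psi> y)" using card_nbrs[OF sT[OF y]] by simp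
    qed
    also have "\<dots> = 2 * (real d * \<eta> * (\<Sum>y\<in>?T. \<psi> y))" by (simp add: sum_distrib_left mult.assoc)
    finally show ?thesis using weighted_mass_lower[OF leg nbhd, of \<psi>] p0 by (simp add: less_imp_le)
  qed
  have upper: "(\<Sum>y\<in>nbhd. \<psi> y * (lap d ?u y + src d n y)) \<le> 2 * real d * \<eta> * (\<Sum>y\<in>?T. ?u y * \<psi> y) + real n * exp (- (l * g))"
  proof -
    have "(\<Sum>y\<in>nbhd. \<psi> y * lap d ?u y) = (\<Sum>y\<in>nbhd. ?u y * lap d \<psi> y)"
      using sum_by_parts[OF nbhd, of ?u \<psi>] by (simp add: odo_eq_0)
    also have "\<dots> = (\<Sum>y\<in>?T. ?u y * lap d \<psi> y)"
      by (rule sum.mono_neutral_right) (use nbhd odo_eq_0 in auto)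
    also have "\<dots> \<le> (\<Sum>y\<in>?T. 2 * real d * \<eta> * (?u y * \<psi> y))"
    proof (rule sum_mono)
      fix y assume y: "y \<in> ?T"
      have "lap d \<psi> y \<le> (\<Sum>z\<in>nbrs d y. \<eta> * \<psi> y)"
        unfolding lap_def by (rule sum_mono) (use nb in \<open>force simp: abs_le_iff\<close>)
      also have "\<dots> = 2 * real d * \<eta> * \<psi> y" using card_nbrs[OF sT[OF y]] by simp
      finally have "?u y * lap d \<psi> y \<le> ?u y * (2 * real d * \<eta> * \<psi> y)" by (rule mult_left_mono) simp
      then show "?u y * lap d \<psi> y \<le> 2 * real d * \<eta> * (?u y * \<psi> y)" by (simp add: mult_ac)
    qed
    also have "\<dots> = 2 * real d * \<eta> * (\<Sum>y\<in>?T. ?u y * \<psi> y)" by (simp add: sum_distrib_left)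
    finally have 1: "(\<Sum>y\<in>nbhd. \<psi> y * lap d ?u y) \<le> 2 * real d * \<eta> * (\<Sum>y\<in>?T. ?u y * \<psi> y)" .
    have "(\<Sum>y\<in>nbhd. \<psi> y * src d n y) = (\<Sum>y\<in>nbhd. if y = origin d then \<psi> y * real n else 0)"
      by (rule sum.cong) (auto simp: src_def)
    also have "\<dots> \<le> \<psi> (origin d) * real n" using nbhd(1) p0[of "origin d"] by (simp add: sum.delta)
    also have "\<dots> \<le> exp (- (l * g)) * real n"
    proof (rule mult_right_mono)
      have "g \<le> r (origin d)" unfolding r_def nrm_emb_origin_diff using x R by linarith
      then show "\<psi> (origin d) \<le> exp (- (l * g))" unfolding \<psi>_def using l0 by simp
    qed simp
    finally have "(\<Sum>y\<in>nbhd. \<psi> y * src d n y) \<le> real n * exp (- (l * g))" by (simp add: mult.commute)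
    then show ?thesis using 1 by (simp add: distrib_left sum.distrib)
  qed
  have split: "(\<Sum>y\<in>?T. ?u y * \<psi> y) \<le> C * (\<Sum>y\<in>?T. \<psi> y) + real (length xs) * exp (- (l * g))"
  proof -
    have "(\<Sum>y\<in>?T. ?u y * \<psi> y) \<le> (\<Sum>y\<in>?T. C * \<psi> y + ?u y * exp (- (l * g)))"
    proof (rule sum_mono)
      fix y assume y: "y \<in> ?T"
      show "?u y * \<psi> y \<le> C * \<psi> y + ?u y * exp (- (l * g))"
      proof (cases "R \<le> nrm d (emb y)")
        case True
        then have "?u y * \<psi> y \<le> C * \<psi> y" using C(2)[OF sT[OF y]] p0[of y] by (intro mult_right_mono) auto
        moreover have "0 \<le> ?u y * exp (- (l * g))" by simp
        ultimately show ?thesis by linarith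
      next
        case False
        have "nrm d (emb x) \<le> nrm d (\<lambda>i. emb x i - emb y i) + nrm d (emb y)"
          using nrm_triangle[of d "\<lambda>i. emb x i - emb y i" "emb y"] by simp
        then have "g \<le> r y" unfolding r_def using False x nrm_minus[of d "emb y" "emb x"] by simp
        then have "\<psi> y \<le> exp (- (l * g))" unfolding \<psi>_def using l0 by simp
        then have "?u y * \<psi> y \<le> ?u y * exp (- (l * g))" by (rule mult_left_mono) simp
        moreover have "0 \<le> C * \<psi> y" using C p0[of y] by simp
        ultimately show ?thesis by linarith
      qed
    qed
    also have "\<dots> = C * (\<Sum>y\<in>?T. \<psi> y) + (\<Sum>y\<in>?T. ?u y) * exp (- (l * g))"
      by (simp add: sum.distrib sum_distrib_left sum_distrib_right)
    also have "(\<Sum>y\<in>?T. ?u y) = real (length xs)"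
      unfolding odo_def using sum_count_set[of xs "set xs"] by (metis List.finite_set of_nat_sum order_refl)
    finally show ?thesis .
  qed
  let ?S = "\<Sum>y\<in>?T. \<psi> y"
  have S1: "1 \<le> ?S"
  proof -
    have "\<psi> x = 1" by (simp add: \<psi>_def r_def nrm_def nsq_def)
    moreover have "\<psi> x \<le> ?S" by (rule member_le_sum) (use x p0 in \<open>auto simp: less_imp_le\<close>)
    ultimately show ?thesis by simp
  qed
  have "2 * real d * \<eta> * (\<Sum>y\<in>?T. ?u y * \<psi> y) \<le> 2 * real d * \<eta> * (C * ?S + real (length xs) * exp (- (l * g)))"
    using e0 by (intro mult_left_mono split) auto
  also have "\<dots> = 2 * real d * \<eta> * C * ?S + 2 * real d * \<eta> * (real (length xs) * exp (- (l * g)))" by (simp add: algebra_simps)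
  also have "\<dots> \<le> 2 * real d * \<eta> * C * ?S + 1 * (real (length xs) * exp (- (l * g)))"
    by (intro add_left_mono mult_right_mono e2) auto
  finally have "dens * ?S - real d * \<eta> * ?S \<le> 2 * real d * \<eta> * C * ?S + real (length xs) * exp (- (l * g)) + real n * exp (- (l * g))"
    using lower upper by linarith
  moreover have "real d * \<eta> * ?S + 2 * real d * \<eta> * C * ?S = (real d * \<eta> * (1 + 2 * C)) * ?S" by (simp add: algebra_simps)
  ultimately have "dens * ?S - 1 / 2 * ?S \<le> (real (length xs) + real n) * exp (- (l * g))"
    unfolding e1 by (simp add: algebra_simps)
  moreover have "1 * ?S \<le> dens * ?S" using dens_ge_1 S1 by (intro mult_right_mono) auto
  ultimately show ?thesis using S1 unfolding l_def \<eta>_def by linarith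
qed

end


section \<open>Asymptotics in n and the choice of constants\<close>

lemma powr_at_top:
  assumes "0 < (b::real)"
  shows "filterlim (\<lambda>x::real. x powr b) at_top at_top"
proof -
  have "filterlim (\<lambda>x::real. exp (b * ln x)) at_top at_top"
    by (intro filterlim_compose[OF exp_at_top] filterlim_tendsto_pos_mult_at_top[OF tendsto_const assms ln_at_top])
  moreover have "eventually (\<lambda>x::real. exp (b * ln x) = x powr b) at_top"
    using eventually_gt_at_top[of 0] by eventually_elim (simp add: powr_def)
  ultimately show ?thesis using filterlim_cong[OF refl refl, of "\<lambda>x. exp (b * ln x)" "\<lambda>x. x powr b" at_top at_top] by simp
qed

lemma stretched_exp_limit:
  fixes k a :: real
  assumes k: "0 < k" and a: "0 < a" and d: "0 < d"
  shows "((\<lambda>x::real. x ^ 3 * exp (- (k * (a * x powr (1 / real d) - 1)))) \<longlongrightarrow> 0) at_top"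
proof -
  have ka: "0 < k * a" using k a by simp
  have tt: "filterlim (\<lambda>x::real. k * a * x powr (1 / real d)) at_top at_top"
    by (intro filterlim_tendsto_pos_mult_at_top[OF tendsto_const ka] powr_at_top) (use d in simp)
  have "((\<lambda>x. exp k / (k * a) ^ (3 * d) * ((k * a * x powr (1 / real d)) ^ (3 * d) / exp (k * a * x powr (1 / real d)))) \<longlongrightarrow> exp k / (k * a) ^ (3 * d) * 0) at_top"
    by (intro tendsto_mult tendsto_const filterlim_compose[OF tendsto_power_div_exp_0 tt])
  moreover have "eventually (\<lambda>x. exp k / (k * a) ^ (3 * d) * ((k * a * x powr (1 / real d)) ^ (3 * d) / exp (k * a * x powr (1 / real d)))
      = x ^ 3 * exp (- (k * (a * x powr (1 / real d) - 1)))) at_top"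
    using eventually_gt_at_top[of 0]
  proof eventually_elim
    case (elim x)
    have "(x powr (1 / real d)) ^ (3 * d) = x powr (1 / real d * (3 * real d))"
      using elim powr_realpow[of "x powr (1 / real d)" "3 * d"] by (simp add: powr_powr)
    also have "1 / real d * (3 * real d) = 3" using d by simp
    finally have p: "(x powr (1 / real d)) ^ (3 * d) = x ^ 3" using elim by (simp only: powr_numeral less_imp_le)
    have e: "exp (- (k * (a * x powr (1 / real d) - 1))) = exp k / exp (k * a * x powr (1 / real d))"
      unfolding exp_diff[symmetric] by (simp add: algebra_simps)
    have "exp k / (k * a) ^ (3 * d) * ((k * a * x powr (1 / real d)) ^ (3 * d) / exp (k * a * x powr (1 / real d)))
      = (x powr (1 / real d)) ^ (3 * d) * (exp k / exp (k * a * x powr (1 / real d)))"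
      unfolding power_mult_distrib[of "k * a"] using k a by simp
    then show ?case unfolding p e .
  qed
  ultimately show ?thesis using Lim_transform_eventually by fastforce
qed

theorem outer_bound:
  fixes d :: nat and H :: int and \<epsilon> :: real
  assumes d: "2 \<le> d" and H: "1 - int d \<le> H" and eps: "0 < \<epsilon>" "\<epsilon> < real d + real_of_int H"
  shows "\<exists>c::real. \<forall>n::nat. 1 \<le> n \<longrightarrow>
    visited d n H \<subseteq> lball d ((real d - \<epsilon> + real_of_int H) powr (- 1 / real d) * (real n / unit_ball_vol (real d)) powr (1 / real d) + c)"
proof -
  define \<omega> where "\<omega> = unit_ball_vol (real d)"
  have w: "0 < \<omega>" by (simp add: \<omega>_def)
  define \<mu>0 where "\<mu>0 = real d - \<epsilon> + real_of_int H"
  \<comment> \<open>Halfway between the density \<open>\<mu>0\<close> belonging to the claimed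
    radius and the full density d + H.\<close>
  define \<mu> where "\<mu> = \<mu>0 + \<epsilon> / 2"
  have mu: "0 < \<mu>0" "\<mu>0 < \<mu>" using eps by (auto simp: \<mu>0_def \<mu>_def)
  obtain A B j0 where glue: "0 < A" "1 \<le> B" "1 \<le> j0"
    "\<And>j z. j0 \<le> j \<Longrightarrow> dlap d (glue d A j (j + B)) z \<le> 0"
    "\<And>j z. j0 \<le> j \<Longrightarrow> nrm d z < j \<Longrightarrow> dlap d (glue d A j (j + B)) z \<le> - (2 * real d) * ((j + B)\<^sup>2) powr (- (real d / 2))"
    using glue_superharmonic[OF d] by metis
  \<comment> \<open>The first bound keeps the boundary loss below \<epsilon>/2, so that density
    \<mu> survives the averaging; the second keeps the widened ball from using up the margin between
    \<open>\<mu>0\<close> and \<mu>.\<close>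
  define \<delta> where "\<delta> = min (\<epsilon> / (2 * real d)) ((\<mu> / \<mu>0 - 1) / 2)"
  have d0: "0 < d" using d by simp
  have delta: "0 < \<delta>" "real d * \<delta> \<le> \<epsilon> / 2" "(1 + \<delta>) * \<mu>0 < \<mu>"
  proof -
    show "0 < \<delta>" using eps mu d by (simp add: \<delta>_def)
    have "real d * \<delta> \<le> real d * (\<epsilon> / (2 * real d))" by (rule mult_left_mono) (auto simp: \<delta>_def)
    then show "real d * \<delta> \<le> \<epsilon> / 2" using d by simp
    have "1 < \<mu> / \<mu>0" using mu by simp
    moreover have "\<delta> \<le> (\<mu> / \<mu>0 - 1) / 2" unfolding \<delta>_def by (rule min.cobounded2)
    moreover have "1 + y < X" if "1 < X" "y \<le> (X - 1) / 2" for X y :: real using that by (simp add: field_simps)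
    ultimately have "1 + \<delta> < \<mu> / \<mu>0" by blast
    then show "(1 + \<delta>) * \<mu>0 < \<mu>" using mu by (simp add: pos_less_divide_eq)
  qed
  have "eventually (\<lambda>j::real. A * 16 powr (real d / 2) \<le> j) at_top" by (rule eventually_ge_at_top)
  with good_radius[OF d0 delta(1), of B] eventually_ge_at_top[of "max j0 (max B 1)"]
  have "eventually (\<lambda>j. (real (card (lball d (j + 1))) - real (card (lball d (j - 1))) \<le> \<delta> * real (card (lball d j))
    \<and> unit_ball_vol (real d) * (j + B) ^ d \<le> (1 + \<delta>) * real (card (lball d j)) \<and> 0 < real (card (lball d j)))
    \<and> max j0 (max B 1) \<le> j \<and> A * 16 powr (real d / 2) \<le> j) at_top"
    by (rule eventually_conj[OF _ eventually_conj])
  then obtain j where j: "real (card (lball d (j + 1))) - real (card (lball d (j - 1))) \<le> \<delta> * real (card (lball d j))"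
    "\<omega> * (j + B) ^ d \<le> (1 + \<delta>) * real (card (lball d j))" "0 < real (card (lball d j))"
    "j0 \<le> j" "B \<le> j" "1 \<le> j" "A * 16 powr (real d / 2) \<le> j"
    unfolding eventually_at_top_linorder \<omega>_def by auto
  define N where "N = real (card (lball d j))"
  define q where "q = j + B"
  have q0: "1 \<le> q" using j glue by (simp add: q_def)
  have Q: "A * 16 powr (real d / 2) \<le> (j + B)\<^sup>2"
  proof -
    have "j * 1 \<le> (j + B) * (j + B)" by (rule mult_mono) (use j glue in auto)
    then show ?thesis using j(7) by (simp add: power2_eq_square)
  qed
  have bdry: "real d * (real (card (lball d (j + 1))) - real (card (lball d (j - 1)))) \<le> (real d + real_of_int H - \<mu>) * real (card (lball d j))"
  proof -
    have "real d * (real (card (lball d (j + 1))) - real (card (lball d (j - 1)))) \<le> real d * (\<delta> * N)"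
      unfolding N_def by (rule mult_left_mono[OF j(1)]) simp
    also have "\<dots> = (real d * \<delta>) * N" by simp
    also have "\<dots> \<le> (\<epsilon> / 2) * N" by (rule mult_right_mono[OF delta(2)]) (simp add: N_def)
    also have "\<epsilon> / 2 = real d + real_of_int H - \<mu>" by (simp add: \<mu>_def \<mu>0_def)
    finally show ?thesis by (simp add: N_def)
  qed
  define C5 where "C5 = N * (cap d H * (2 * real d + 1) ^ nat \<lceil>real d * (2 * j)\<rceil> + A * 16 powr (real d / 2) * \<mu> + 8 * \<mu>)"
  have cap1: "1 \<le> cap d H" using H d by linarith
  have C5: "0 \<le> C5" using cap1 glue(1) mu by (simp add: C5_def N_def)
  define l where "l = ln (1 + 1 / (2 * real d * (1 + 2 * C5)))"
  have l0: "0 < l" using C5 d unfolding l_def by (intro ln_gt_zero) simp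
  \<comment> \<open>Bounds the ratio of the balance radius to the claimed radius \<open>R n\<close>.
    Being less than 1, it leaves a gap proportional to n^(1/d).\<close>
  define \<theta> where "\<theta> = ((1 + \<delta>) * \<mu>0 / \<mu>) powr (1 / real d)"
  have th: "0 \<le> \<theta>" "\<theta> < 1"
  proof -
    have "(1 + \<delta>) * \<mu>0 / \<mu> < 1" using delta mu by simp
    then have "\<theta> < 1 powr (1 / real d)" unfolding \<theta>_def by (intro powr_less_mono2) (use delta mu d in auto)
    then show "\<theta> < 1" by simp
  qed (simp add: \<theta>_def)
  define \<kappa>0 where "\<kappa>0 = (1 / (\<omega> * \<mu>0)) powr (1 / real d)"
  have k0: "0 < \<kappa>0" using w mu by (simp add: \<kappa>0_def)
  define R where "R n = (real n / (\<omega> * \<mu>0)) powr (1 / real d)" for n :: nat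
  have Rk: "R n = \<kappa>0 * real n powr (1 / real d)" for n
  proof -
    have "R n = (1 / (\<omega> * \<mu>0) * real n) powr (1 / real d)" by (simp add: R_def)
    also have "\<dots> = \<kappa>0 * real n powr (1 / real d)" unfolding \<kappa>0_def using w mu by (subst powr_mult) auto
    finally show ?thesis .
  qed
  define \<kappa>1 where "\<kappa>1 = (q ^ d / (N * \<mu>)) powr (1 / real d)"
  have k1: "0 < \<kappa>1" using q0 j(3) mu by (simp add: \<kappa>1_def N_def)
  define a where "a = (1 - \<theta>) * \<kappa>0"
  have a0: "0 < a" using th k0 by (simp add: a_def)
  define Cl where "Cl = (2 * real d + 1) * cap d H + 1"
  have lim0: "((\<lambda>n::nat. Cl * (real n ^ 3 * exp (- (l * (a * real n powr (1 / real d) - 1))))) \<longlongrightarrow> Cl * 0) sequentially"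
    by (intro tendsto_mult tendsto_const
        filterlim_compose[OF stretched_exp_limit[OF l0 a0 d0] filterlim_real_sequentially])
  have ev1: "eventually (\<lambda>n::nat. Cl * (real n ^ 3 * exp (- (l * (a * real n powr (1 / real d) - 1)))) < 1 / 2) sequentially"
    using order_tendstoD(2)[OF lim0, of "1/2"] by simp
  have tt: "filterlim (\<lambda>n::nat. k * real n powr (1 / real d)) at_top sequentially" if "0 < k" for k
    by (intro filterlim_tendsto_pos_mult_at_top[OF tendsto_const that]
        filterlim_compose[OF powr_at_top filterlim_real_sequentially]) (use d in simp)
  have ev2: "eventually (\<lambda>n::nat. max 1 (4 * q) \<le> \<kappa>1 * real n powr (1 / real d)) sequentially"
    using tt[OF k1] unfolding filterlim_at_top by blast
  have ev3: "eventually (\<lambda>n::nat. 1 \<le> a * real n powr (1 / real d)) sequentially"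
    using tt[OF a0] unfolding filterlim_at_top by blast
  obtain n0 where n0: "\<And>n. n0 \<le> n \<Longrightarrow> Cl * (real n ^ 3 * exp (- (l * (a * real n powr (1 / real d) - 1)))) < 1 / 2"
    "\<And>n. n0 \<le> n \<Longrightarrow> max 1 (4 * q) \<le> \<kappa>1 * real n powr (1 / real d)"
    "\<And>n. n0 \<le> n \<Longrightarrow> 1 \<le> a * real n powr (1 / real d)"
    using eventually_conj[OF ev1 eventually_conj[OF ev2 ev3]] unfolding eventually_sequentially by blast
  have H': "2 - 2 * int d \<le> H" using H d by linarith
  have toppled: "nrm d (emb x) < R n + real n0" if n: "1 \<le> n" and leg0: "legal d (init_config d n H) xs0" and x0: "x \<in> set xs0" for n xs0 x
  \<comment> \<open>For small \<open>n\<close> fewer than \<open>n0\<close> sites topple, so the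
    additive constant \<open>n0\<close> alone suffices.\<close>
  proof (cases "n0 \<le> n")
    case False
    have "nrm d (emb x) + 1 \<le> real (card (set xs0))" by (rule toppled_nrm[OF leg0 x0 H'])
    also have "\<dots> \<le> real n" using card_toppled_le[OF leg0 H] by simp
    finally show ?thesis using False R_def[of n] powr_ge_zero[of "real n / (\<omega> * \<mu>0)" "1 / real d"] by linarith
  next
    case True
    have inb: "set ys \<subseteq> lball d (real n)" if "legal d (init_config d n H) ys" for ys
    proof
      fix y assume y: "y \<in> set ys"
      have "nrm d (emb y) + 1 \<le> real (card (set ys))" by (rule toppled_nrm[OF that y H'])
      also have "\<dots> \<le> real n" using card_toppled_le[OF that H] by simp
      finally show "y \<in> lball d (real n)" using legal_sites[OF that y] by (simp add: in_lball)
    qed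
    obtain xs where xs: "legal d (init_config d n H) xs" "set xs0 \<subseteq> set xs"
      "\<And>y. y \<in> lball d (real n) \<Longrightarrow> site d y \<Longrightarrow> foldl (topple d) (init_config d n H) xs y < 2 * int d"
      using maximal_legal[OF finite_lball d0 leg0 inb[OF leg0]] by metis
    \<comment> \<open>One more toppling would again give a legal sequence, and all of these stay in
      the ball of radius \<open>n\<close>; stability inside that ball is therefore stability
      everywhere.\<close>
    have stab: "foldl (topple d) (init_config d n H) xs y < 2 * int d" if y: "site d y" for y
    proof (rule ccontr)
      assume u: "\<not> ?thesis"
      then have "legal d (init_config d n H) (xs @ [y])" using xs(1) y by (simp add: legal_append)
      from inb[OF this] have "y \<in> lball d (real n)" by simp
      then show False using xs(3) y u by blast
    qed
    define Rs where "Rs = \<kappa>1 * real n powr (1 / real d)"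
    have Rs: "1 \<le> Rs" "4 * q \<le> Rs" using n0(2)[OF True] by (auto simp: Rs_def)
    have Rsd: "Rs ^ d = real n * q ^ d / (N * \<mu>)"
    proof -
      have "Rs = (q ^ d / (N * \<mu>) * real n) powr (1 / real d)"
        unfolding Rs_def \<kappa>1_def using q0 j(3) mu by (subst powr_mult) (auto simp: N_def)
      moreover have p: "0 < q ^ d / (N * \<mu>) * real n" using q0 j(3) mu n by (simp add: N_def)
      moreover have "0 < Rs" using Rs by simp
      ultimately have "Rs ^ d = ((q ^ d / (N * \<mu>) * real n) powr (1 / real d)) powr real d"
        using powr_realpow[of Rs d] by metis
      also have "\<dots> = q ^ d / (N * \<mu>) * real n" unfolding powr_powr using d p by (metis d0 less_imp_le nonzero_divide_eq_eq of_nat_0_less_iff order_less_irrefl powr_one)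
      finally show ?thesis by simp
    qed
    have RsR: "Rs \<le> \<theta> * R n"
    proof -
      have "q ^ d / (N * \<mu>) \<le> (1 + \<delta>) * \<mu>0 / \<mu> * (1 / (\<omega> * \<mu>0))"
      proof -
        have "\<omega> * q ^ d / \<omega> \<le> (1 + \<delta>) * N / \<omega>"
          by (rule divide_right_mono) (use j(2) w in \<open>simp_all add: q_def N_def\<close>)
        then have "q ^ d \<le> (1 + \<delta>) * N / \<omega>" using w by simp
        then have "q ^ d / (N * \<mu>) \<le> (1 + \<delta>) * N / \<omega> / (N * \<mu>)"
          by (rule divide_right_mono) (use mu in \<open>simp add: N_def\<close>)
        also have "\<dots> = (1 + \<delta>) * \<mu>0 / \<mu> * (1 / (\<omega> * \<mu>0))" using j(3) mu w by (simp add: N_def)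
        finally show ?thesis .
      qed
      then have "\<kappa>1 \<le> ((1 + \<delta>) * \<mu>0 / \<mu> * (1 / (\<omega> * \<mu>0))) powr (1 / real d)"
        unfolding \<kappa>1_def using q0 j(3) mu by (intro powr_mono2) (auto simp: N_def)
      also have "\<dots> = \<theta> * \<kappa>0" unfolding \<theta>_def \<kappa>0_def using delta mu w by (subst powr_mult) auto
      finally show ?thesis unfolding Rs_def Rk by (simp add: mult_right_mono mult.assoc[symmetric])
    qed
    have out: "odo xs y \<le> C5" if y: "site d y" "Rs + 1 \<le> nrm d (emb y)" for y
      unfolding C5_def N_def
    proof (rule odo_bounded_outside[where ts = "Rs\<^sup>2"])
      show "2 \<le> d" "1 - int d \<le> H" "legal d (init_config d n H) xs" by (rule d H xs)+
      show "\<And>y. site d y \<Longrightarrow> foldl (topple d) (init_config d n H) xs y < 2 * int d" by (rule stab)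
      show "0 < A" "1 \<le> B" "B \<le> j" "0 < real (card (lball d j))" "0 < \<mu>" "1 \<le> n" "site d y" using glue j mu n y by auto
      show "A * 16 powr (real d / 2) \<le> (j + B)\<^sup>2" by (rule Q)
      show "\<And>z. dlap d (glue d A j (j + B)) z \<le> 0" by (rule glue(4)[OF j(4)])
      show "\<And>z. nrm d z < j \<Longrightarrow> dlap d (glue d A j (j + B)) z \<le> - (2 * real d) * ((j + B)\<^sup>2) powr (- (real d / 2))"
        by (rule glue(5)[OF j(4)])
      show "real d * (real (card (lball d (j + 1))) - real (card (lball d (j - 1)))) \<le> (real d + real_of_int H - \<mu>) * real (card (lball d j))"
        by (rule bdry)
      have "(4 * q)\<^sup>2 \<le> Rs\<^sup>2" by (rule power_mono) (use Rs q0 in auto)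
      then show "16 * (j + B)\<^sup>2 \<le> Rs\<^sup>2" unfolding power_mult_distrib q_def by simp
      show "1 \<le> Rs\<^sup>2" using Rs by simp
      show "Rs\<^sup>2 powr (real d / 2) = real n * (j + B) ^ d / (real (card (lball d j)) * \<mu>)"
      proof -
        have "Rs\<^sup>2 = Rs powr 2" using Rs by (simp add: powr_numeral)
        then have "Rs\<^sup>2 powr (real d / 2) = Rs powr real d" by (simp only: powr_powr) simp
        also have "\<dots> = Rs ^ d" using Rs by (simp add: powr_realpow)
        finally show ?thesis using Rsd by (simp add: q_def N_def)
      qed
      show "sqrt (Rs\<^sup>2) + 1 \<le> nrm d (emb y)" using y Rs by simp
    qed
    show ?thesis
    proof (rule ccontr)
      assume "\<not> ?thesis"
      then have xR: "R n \<le> nrm d (emb x)" by simp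
      \<comment> \<open>What remains of the gap between \<open>R n\<close> and the balance radius
        after the layer of width 1 required by \<open>odo_bounded_outside\<close>.\<close>
      define g where "g = a * real n powr (1 / real d) - 1"
      have gR: "g = (1 - \<theta>) * R n - 1" unfolding g_def a_def Rk by simp
      have "1 / 2 \<le> (real (length xs) + real n) * exp (- (ln (1 + 1 / (2 * real d * (1 + 2 * C5))) * g))"
      proof (rule exponential_decay[OF d H xs(1) stab C5 out])
        show "0 \<le> Rs + 1" using Rs by simp
        show "0 \<le> g" using n0(3)[OF True] by (simp add: g_def)
        show "x \<in> set xs" using x0 xs(2) by blast
        show "Rs + 1 + g \<le> nrm d (emb x)" using RsR xR unfolding gR by (simp add: left_diff_distrib)
      qed auto
      also have "\<dots> \<le> (Cl * real n ^ 3) * exp (- (l * g))"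
        unfolding l_def[symmetric]
      proof (rule mult_right_mono)
        have "real (length xs) \<le> (2 * real d + 1) * cap d H * real n ^ 3"
          by (rule length_bound[OF d H xs(1) stab])
        moreover have "real n \<le> real n ^ 3" using n by (simp add: self_le_power)
        ultimately show "real (length xs) + real n \<le> Cl * real n ^ 3" unfolding Cl_def distrib_right by linarith
      qed simp
      also have "\<dots> < 1 / 2" using n0(1)[OF True] by (simp add: g_def mult.assoc)
      finally show False by simp
    qed
  qed
  have Req: "\<mu>0 powr (- 1 / real d) * (real n / \<omega>) powr (1 / real d) = R n" for n
    using radius_eq[of \<mu>0 "real n / \<omega>" d] mu w by (simp add: R_def)
  show ?thesis
  \<comment> \<open>Visited sites other than the origin are neighbours of toppled ones, hence the
    additional 1.\<close>
  proof (intro exI[of _ "real n0 + 1"] allI impI subsetI)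
    fix n :: nat and y assume n: "1 \<le> n" and y: "y \<in> visited d n H"
    have "site d y \<and> nrm d (emb y) < R n + (real n0 + 1)"
    proof (cases "y = origin d")
      case True
      have "nrm d (emb (origin d)) = 0" by (simp add: nrm_def nsq_def emb_origin)
      moreover have "0 \<le> R n" by (simp add: R_def)
      ultimately show ?thesis using True by simp
    next
      case False
      then obtain xs x where x: "legal d (init_config d n H) xs" "x \<in> set xs" "y \<in> nbrs d x"
        using y by (auto simp: visited_def nbrs_def)
      then show ?thesis using toppled[OF n x(1,2)] nrm_nbr0[OF x(3)] nbrs_site[OF x(3)] by auto
    qed
    then show "y \<in> lball d ((real d - \<epsilon> + real_of_int H) powr (- 1 / real d) * (real n / unit_ball_vol (real d)) powr (1 / real d) + (real n0 + 1))"
      using Req[of n] by (simp add: in_lball \<mu>0_def \<omega>_def)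
  qed
qed

theorem theorem4p1:
  fixes d :: nat
  assumes "d \<ge> 2"
  shows "(\<exists>c2::real. \<forall>(H::int) (n::nat). H \<ge> 2 - 2 * int d \<longrightarrow> n \<ge> 1 \<longrightarrow>
            (let r = (real n / unit_ball_vol (real d)) powr (1 / real d);
                 c1 = (real_of_int (2 * int d - 1 + H)) powr (- 1 / real d)
             in lball d (c1 * r - c2) \<subseteq> visited d n H))
       \<and> (\<forall>(H::int) (\<epsilon>::real). H \<ge> 1 - int d \<longrightarrow> 0 < \<epsilon> \<longrightarrow> \<epsilon> < real d + real_of_int H \<longrightarrow>
            (\<exists>c2'::real. \<forall>n::nat. n \<ge> 1 \<longrightarrow>
              (let r = (real n / unit_ball_vol (real d)) powr (1 / real d);
                   c1' = (real d - \<epsilon> + real_of_int H) powr (- 1 / real d)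
               in visited d n H \<subseteq> lball d (c1' * r + c2'))))"
proof -
  have e: "real_of_int (2 * int d - 1 + H) = 2 * real d - 1 + real_of_int H" for H by simp
  show ?thesis
    unfolding Let_def e
    using inner_bound[OF assms] outer_bound[OF assms] by meson
qed

end
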